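(* Let $X$ be an infinite-dimensional Banach space which is nicely embedded into $C^b(S)$ and for which $\{p_s\colon s\in S\}$ is (pairwise) linearly independent (in particular, this holds if $X$ is an infinite-dimensional function algebra, with $S$ its Choquet boundary). Then each of the following conditions implies that $X$ has the convex-DLD2P: (a) there is a net $\{p_{s_\lambda}\}$ of distinct elements which is weak-star convergent to some $p_{s_0}$ with $s_0\in S$; (b) $\{p_s\colon s\in S\}$ is weak-star closed; (c) $S_X$ contains a $\Delta$-point at which the norm is smooth.
   Context: Banach spaces are over $\mathbb{K}\in\{\mathbb{R},\mathbb{C}\}$; $B_X$, $S_X$ are the closed unit ball and unit sphere. For a Hausdorff topological space $S$, $C^b(S)$ is the sup-normed space of bounded continuous scalar functions on $S$ and $\delta_s(f)=f(s)$. $X$ is nicely embedded into $C^b(S)$ if there is a linear isometry (into) $J\colon X\to C^b(S)$ such that for all $s\in S$, with $p_s:=J^*(\delta_s)\in X^*$: (N1) $\|p_s\|=1$; (N2) $\mathbb{K}p_s$ is an $L$-summand in $X^*$, i.e. the range of a linear projection $P$ with $\|x^*\|=\|Px^*\|+\|x^*-Px^*\|$ for all $x^*\in X^*$. Pairwise linear independence means that $p_s,p_t$ are linearly independent whenever $s\neq t$. A function algebra on a compact Hausdorff space $K$ is a closed subalgebra $A$ of $C(K)$ separating the points of $K$ and containing the constants; its Choquet boundary is $\partial A=\{k\in K\colon\delta_k|_A\in\mathrm{ext}(B_{A^*})\}$. A point $x\in S_X$ is a $\Delta$-point if for every $\varepsilon>0$ and every slice $S_0$ of $B_X$ containing $x$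 (a slice being a set $\{y\in B_X\colon \mathrm{Re}\,x^*(y)>\sup\mathrm{Re}\,x^*(B_X)-\alpha\}$ with $x^*\in X^*$, $\alpha>0$) there is $y\in S_0$ with $\|x-y\|>2-\varepsilon$. $X$ has the convex diametral local diameter two property (convex-DLD2P) if $B_X=\overline{\mathrm{conv}}(\Delta_X)$, where $\Delta_X$ is the set of $\Delta$-points of $S_X$. The norm is smooth at $x\in S_X$ if there is exactly one $x^*\in S_{X^*}$ with $x^*(x)=1$. In (a), the directed index set of the net is understood to have no greatest element (so that the convergence is not trivial). *)

theory Defs
  imports "HOL-Analysis.Analysis"
begin

text \<open>Up to isometric isomorphism a type of this class is one of the two fields of real and of
  complex numbers, so quantifying over the class renders \<open>\<bbbK> \<in> {\<real>, \<complex>}\<close>.\<close>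

class rc_scalar = real_normed_field +
  fixes to_complex :: "'a \<Rightarrow> complex"
  assumes to_complex_add: "to_complex (x + y) = to_complex x + to_complex y"
    and to_complex_mult: "to_complex (x * y) = to_complex x * to_complex y"
    and to_complex_scaleR_one: "to_complex (r *\<^sub>R 1) = complex_of_real r"
    and norm_to_complex: "norm (to_complex x) = norm x"
    and range_to_complex: "range to_complex = \<real> \<or> range to_complex = UNIV"

instantiation real :: rc_scalar
begin
definition to_complex_real :: "real \<Rightarrow> complex" where "to_complex_real = complex_of_real"
instance by standard (auto simp: to_complex_real_def Reals_def)
end

instantiation complex :: rc_scalar
begin
definition to_complex_complex :: "complex \<Rightarrow> complex" where "to_complex_complex = (\<lambda>z. z)"
instance by standard (auto simp: to_complex_complex_def scaleR_conv_of_real)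
end

definition re :: "'k::rc_scalar \<Rightarrow> real" where
  "re c = Re (to_complex c)"

text \<open>A space is a set \<open>X\<close> inside an ambient normed space \<open>'v\<close> with scalar multiplication \<open>sc\<close>
  (\<open>X = UNIV\<close> is allowed), so that function algebras, which are subsets of a space of continuous
  functions, are covered directly.\<close>

definition normed_space_over :: "('k::rc_scalar \<Rightarrow> 'v::real_normed_vector \<Rightarrow> 'v) \<Rightarrow> bool" where
  "normed_space_over sc \<longleftrightarrow> vector_space sc \<and>
     (\<forall>r x. sc (of_real r) x = r *\<^sub>R x) \<and> (\<forall>c x. norm (sc c x) = norm c * norm x)"

definition banach_space_over ::
    "('k::rc_scalar \<Rightarrow> 'v::real_normed_vector \<Rightarrow> 'v) \<Rightarrow> 'v set \<Rightarrow> bool" where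
  "banach_space_over sc X \<longleftrightarrow> normed_space_over sc \<and> module.subspace sc X \<and> complete X"

definition infinite_dimensional ::
    "('k::rc_scalar \<Rightarrow> 'v::real_normed_vector \<Rightarrow> 'v) \<Rightarrow> 'v set \<Rightarrow> bool" where
  "infinite_dimensional sc X \<longleftrightarrow> \<not> (\<exists>B. finite B \<and> X = module.span sc B)"

definition unit_ball :: "'v::real_normed_vector set \<Rightarrow> 'v set" where
  "unit_ball X = {x \<in> X. norm x \<le> 1}"

definition unit_sphere :: "'v::real_normed_vector set \<Rightarrow> 'v set" where
  "unit_sphere X = {x \<in> X. norm x = 1}"

text \<open>Functionals on \<open>X\<close> are extended by 0 outside \<open>X\<close>, so that distinct functions are distinct
  functionals.\<close>

definition dual ::
    "('k::rc_scalar \<Rightarrow> 'v::real_normed_vector \<Rightarrow> 'v) \<Rightarrow> 'v set \<Rightarrow> ('v \<Rightarrow> 'k) set" where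
  "dual sc X = {f. (\<forall>x\<in>X. \<forall>y\<in>X. f (x + y) = f x + f y) \<and>
                   (\<forall>c. \<forall>x\<in>X. f (sc c x) = c * f x) \<and>
                   (\<exists>C. \<forall>x\<in>X. norm (f x) \<le> C * norm x) \<and>
                   (\<forall>x. x \<notin> X \<longrightarrow> f x = 0)}"

definition dual_norm :: "'v::real_normed_vector set \<Rightarrow> ('v \<Rightarrow> 'k::rc_scalar) \<Rightarrow> real" where
  "dual_norm X f = (SUP x\<in>unit_ball X. norm (f x))"

definition dual_ball ::
    "('k::rc_scalar \<Rightarrow> 'v::real_normed_vector \<Rightarrow> 'v) \<Rightarrow> 'v set \<Rightarrow> ('v \<Rightarrow> 'k) set" where
  "dual_ball sc X = {f \<in> dual sc X. dual_norm X f \<le> 1}"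

text \<open>On \<open>'v \<Rightarrow> 'k\<close> the topology \<open>euclidean\<close> is the product topology, i.e. that of pointwise
  convergence; on \<open>dual sc X\<close> all coordinates outside \<open>X\<close> are constantly 0.\<close>

definition weak_star ::
    "('k::rc_scalar \<Rightarrow> 'v::real_normed_vector \<Rightarrow> 'v) \<Rightarrow> 'v set \<Rightarrow> ('v \<Rightarrow> 'k) topology" where
  "weak_star sc X = subtopology euclidean (dual sc X)"

definition L_summand ::
    "('k::rc_scalar \<Rightarrow> 'v::real_normed_vector \<Rightarrow> 'v) \<Rightarrow> 'v set \<Rightarrow> ('v \<Rightarrow> 'k) set \<Rightarrow> bool" where
  "L_summand sc X L \<longleftrightarrow>
     (\<exists>P :: ('v \<Rightarrow> 'k) \<Rightarrow> ('v \<Rightarrow> 'k).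
        P ` dual sc X = L \<and>
        (\<forall>f\<in>dual sc X. P f \<in> dual sc X \<and> P (P f) = P f) \<and>
        (\<forall>f\<in>dual sc X. \<forall>g\<in>dual sc X. P (\<lambda>x. f x + g x) = (\<lambda>x. P f x + P g x)) \<and>
        (\<forall>c. \<forall>f\<in>dual sc X. P (\<lambda>x. c * f x) = (\<lambda>x. c * P f x)) \<and>
        (\<forall>f\<in>dual sc X. dual_norm X f = dual_norm X (P f) + dual_norm X (\<lambda>x. f x - P f x)))"

text \<open>The analogue of \<^const>\<open>extreme_point_of\<close>, which needs a real vector space type and hence is
  not available for sets of functions \<open>'v \<Rightarrow> 'k\<close>.\<close>

definition extreme_functional ::
    "('v::real_normed_vector \<Rightarrow> 'k::rc_scalar) \<Rightarrow> ('v \<Rightarrow> 'k) set \<Rightarrow> bool" where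
  "extreme_functional f B \<longleftrightarrow> f \<in> B \<and>
     (\<forall>g\<in>B. \<forall>h\<in>B. g \<noteq> h \<longrightarrow>
        \<not> (\<exists>t. 0 < t \<and> t < 1 \<and> f = (\<lambda>x. (1 - t) *\<^sub>R g x + t *\<^sub>R h x)))"

text \<open>Elements of \<open>C\<^sup>b(S)\<close> are represented by functions on the whole type whose values outside \<open>S\<close>
  are irrelevant. Inserting 0 only matters for \<open>S = {}\<close>, where it makes the norm 0.\<close>

definition Cb :: "'s::t2_space set \<Rightarrow> ('s \<Rightarrow> 'k::rc_scalar) set" where
  "Cb S = {f. continuous_on S f \<and> bounded (f ` S)}"

definition sup_norm :: "'s set \<Rightarrow> ('s \<Rightarrow> 'k::rc_scalar) \<Rightarrow> real" where
  "sup_norm S f = Sup (insert 0 ((\<lambda>s. norm (f s)) ` S))"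

definition linear_isometry_Cb ::
    "('k::rc_scalar \<Rightarrow> 'v::real_normed_vector \<Rightarrow> 'v) \<Rightarrow> 'v set \<Rightarrow> 's::t2_space set \<Rightarrow>
     ('v \<Rightarrow> 's \<Rightarrow> 'k) \<Rightarrow> bool" where
  "linear_isometry_Cb sc X S J \<longleftrightarrow>
     (\<forall>x\<in>X. J x \<in> Cb S \<and> sup_norm S (J x) = norm x) \<and>
     (\<forall>x\<in>X. \<forall>y\<in>X. \<forall>s\<in>S. J (x + y) s = J x s + J y s) \<and>
     (\<forall>c. \<forall>x\<in>X. \<forall>s\<in>S. J (sc c x) s = c * J x s)"

text \<open>\<open>J\<^sup>*(\<delta>\<^sub>s) = \<delta>\<^sub>s \<circ> J\<close> as an element of \<^const>\<open>dual\<close>.\<close>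

definition point_functional ::
    "'v::real_normed_vector set \<Rightarrow> ('v \<Rightarrow> 's \<Rightarrow> 'k::rc_scalar) \<Rightarrow> 's \<Rightarrow> 'v \<Rightarrow> 'k" where
  "point_functional X J s = (\<lambda>x. if x \<in> X then J x s else 0)"

definition nice_embedding ::
    "('k::rc_scalar \<Rightarrow> 'v::real_normed_vector \<Rightarrow> 'v) \<Rightarrow> 'v set \<Rightarrow> 's::t2_space set \<Rightarrow>
     ('v \<Rightarrow> 's \<Rightarrow> 'k) \<Rightarrow> bool" where
  "nice_embedding sc X S J \<longleftrightarrow> linear_isometry_Cb sc X S J \<and>
     (\<forall>s\<in>S. dual_norm X (point_functional X J s) = 1 \<and>
            L_summand sc X (range (\<lambda>c x. c * point_functional X J s x)))"

definition pairwise_independent :: "'s set \<Rightarrow> ('s \<Rightarrow> 'v \<Rightarrow> 'k::rc_scalar) \<Rightarrow> bool" where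
  "pairwise_independent S p \<longleftrightarrow>
     (\<forall>s\<in>S. \<forall>t\<in>S. s \<noteq> t \<longrightarrow>
        (\<forall>a b. (\<forall>x. a * p s x + b * p t x = 0) \<longrightarrow> a = 0 \<and> b = 0))"

definition directed_set :: "'i set \<Rightarrow> ('i \<Rightarrow> 'i \<Rightarrow> bool) \<Rightarrow> bool" where
  "directed_set I le \<longleftrightarrow> I \<noteq> {} \<and> (\<forall>a\<in>I. le a a) \<and>
     (\<forall>a\<in>I. \<forall>b\<in>I. \<forall>c\<in>I. le a b \<longrightarrow> le b c \<longrightarrow> le a c) \<and>
     (\<forall>a\<in>I. \<forall>b\<in>I. \<exists>c\<in>I. le a c \<and> le b c)"

definition net_converges ::
    "'a topology \<Rightarrow> 'i set \<Rightarrow> ('i \<Rightarrow> 'i \<Rightarrow> bool) \<Rightarrow> ('i \<Rightarrow> 'a) \<Rightarrow> 'a \<Rightarrow> bool" where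
  "net_converges T I le x l \<longleftrightarrow> l \<in> topspace T \<and>
     (\<forall>U. openin T U \<and> l \<in> U \<longrightarrow> (\<exists>a\<in>I. \<forall>b\<in>I. le a b \<longrightarrow> x b \<in> U))"

definition slice ::
    "'v::real_normed_vector set \<Rightarrow> ('v \<Rightarrow> 'k::rc_scalar) \<Rightarrow> real \<Rightarrow> 'v set" where
  "slice X f \<alpha> = {y \<in> unit_ball X. re (f y) > (SUP z\<in>unit_ball X. re (f z)) - \<alpha>}"

definition Delta_points ::
    "('k::rc_scalar \<Rightarrow> 'v::real_normed_vector \<Rightarrow> 'v) \<Rightarrow> 'v set \<Rightarrow> 'v set" where
  "Delta_points sc X = {x \<in> unit_sphere X.
     \<forall>\<epsilon>>0. \<forall>f\<in>dual sc X. \<forall>\<alpha>>0. x \<in> slice X f \<alpha> \<longrightarrow>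
       (\<exists>y\<in>slice X f \<alpha>. norm (x - y) > 2 - \<epsilon>)}"

text \<open>As \<open>X\<close> is complete, the closure in the ambient space is the closure in \<open>X\<close>.\<close>

definition convex_DLD2P ::
    "('k::rc_scalar \<Rightarrow> 'v::real_normed_vector \<Rightarrow> 'v) \<Rightarrow> 'v set \<Rightarrow> bool" where
  "convex_DLD2P sc X \<longleftrightarrow> unit_ball X = closure (convex hull (Delta_points sc X))"

definition smooth_at ::
    "('k::rc_scalar \<Rightarrow> 'v::real_normed_vector \<Rightarrow> 'v) \<Rightarrow> 'v set \<Rightarrow> 'v \<Rightarrow> bool" where
  "smooth_at sc X x \<longleftrightarrow> (\<exists>!f. f \<in> dual sc X \<and> dual_norm X f = 1 \<and> f x = 1)"

text \<open>The compact Hausdorff space \<open>K\<close> is a type \<open>'c :: t2_space\<close> with compact universe; then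
  \<open>'c \<Rightarrow>\<^sub>C 'k\<close> is \<open>C(K)\<close> with the sup norm.\<close>

definition scale_bcontfun ::
    "'k::rc_scalar \<Rightarrow> ('c::topological_space \<Rightarrow>\<^sub>C 'k) \<Rightarrow> ('c \<Rightarrow>\<^sub>C 'k)" where
  "scale_bcontfun c f = Bcontfun (\<lambda>k. c * f k)"

lemma apply_scale_bcontfun [simp]: "scale_bcontfun c f k = c * f k"
proof -
  have "(\<lambda>k. c * f k) \<in> bcontfun"
  proof (rule bcontfun_normI)
    show "continuous_on UNIV (\<lambda>k. c * f k)" by (intro continuous_intros) auto
    show "norm (c * f k) \<le> norm c * norm f" for k
      by (simp add: norm_mult mult_left_mono norm_bounded)
  qed
  then show ?thesis by (simp add: scale_bcontfun_def Bcontfun_inverse)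
qed

lemma normed_space_over_scale_bcontfun:
  "normed_space_over (scale_bcontfun :: 'k::rc_scalar \<Rightarrow> ('c::topological_space \<Rightarrow>\<^sub>C 'k) \<Rightarrow> _)"
  unfolding normed_space_over_def
proof (intro conjI allI)
  show "vector_space (scale_bcontfun :: 'k \<Rightarrow> ('c \<Rightarrow>\<^sub>C 'k) \<Rightarrow> _)"
    by standard (auto intro!: bcontfun_eqI simp: algebra_simps)
  show "scale_bcontfun (of_real r) f = r *\<^sub>R f" for r and f :: "'c \<Rightarrow>\<^sub>C 'k"
    by (rule bcontfun_eqI) (simp add: scaleR_conv_of_real)
  have le: "norm (scale_bcontfun c f) \<le> norm c * norm f" for c and f :: "'c \<Rightarrow>\<^sub>C 'k"
    by (rule norm_bound) (simp add: norm_mult mult_left_mono norm_bounded)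
  show "norm (scale_bcontfun c f) = norm c * norm f" for c and f :: "'c \<Rightarrow>\<^sub>C 'k"
  proof (cases "c = 0")
    case True
    then show ?thesis using le[of c f] by simp
  next
    case False
    have "scale_bcontfun (inverse c) (scale_bcontfun c f) = f"
      by (rule bcontfun_eqI) (simp add: False)
    then have "norm f \<le> norm (inverse c) * norm (scale_bcontfun c f)"
      by (metis le)
    then have "norm c * norm f \<le> norm (scale_bcontfun c f)"
      using False by (simp add: norm_inverse norm_divide field_simps)
    with le[of c f] show ?thesis by simp
  qed
qed

definition function_algebra :: "('c::t2_space \<Rightarrow>\<^sub>C 'k::rc_scalar) set \<Rightarrow> bool" where
  "function_algebra A \<longleftrightarrow> compact (UNIV :: 'c set) \<and>
     closed A \<and> module.subspace scale_bcontfun A \<and>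
     (\<forall>f\<in>A. \<forall>g\<in>A. \<exists>h\<in>A. \<forall>k. h k = f k * g k) \<and>
     (\<forall>k l. k \<noteq> l \<longrightarrow> (\<exists>f\<in>A. f k \<noteq> f l)) \<and>
     (\<forall>c. const_bcontfun c \<in> A)"

definition choquet_boundary :: "('c::t2_space \<Rightarrow>\<^sub>C 'k::rc_scalar) set \<Rightarrow> 'c set" where
  "choquet_boundary A =
     {k. extreme_functional (point_functional A apply_bcontfun k) (dual_ball scale_bcontfun A)}"

end

theory Submission
  imports Defs
begin

text \<open>
  Let \<open>p s\<close> be the evaluation at \<open>s\<close>, as a functional on \<open>X\<close>. Independent one-dimensional
  L-summands add up in the \<open>\<ell>\<^sub>1\<close>-sense: for finite \<open>F \<subseteq> S\<close>, a functional \<open>f\<close> is the sum of multiples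
  \<open>c\<^sub>s p s\<close> with \<open>s \<in> F\<close> and a rest, and the norms of all these parts add up to the norm of \<open>f\<close>
  (\<open>norm_eq_sum_coef\<close>). In particular only finitely many \<open>|c\<^sub>s|\<close> exceed a given positive number.
  Hence \<open>x\<close> with \<open>\<parallel>x\<parallel> = 1\<close> is a \<open>\<Delta>\<close>-point if for every \<open>\<epsilon> > 0\<close> there are infinitely many \<open>s\<close> with
  \<open>|p s x| > 1 - \<epsilon>\<close> (\<open>Delta_pointI\<close>): for a slice given by \<open>f\<close> choose such \<open>s\<close> with \<open>|c\<^sub>s|\<close> small and
  reverse the sign of \<open>x\<close> at \<open>p s\<close>. This produces an element of the bidual, not of \<open>X\<close>, but elements of
  the bidual can be approximated in \<open>X\<close> at finitely many functionals.

  On the other hand, let \<open>L\<close> be any nonzero L-summand of the dual. Then the closed convex hull of the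
  points of norm 1 at which the supremum of \<open>|f x|\<close> over \<open>f\<close> in the unit ball of \<open>L\<close> is exactly 1 is the
  unit ball (\<open>ball_eq_hull_of_normed_points\<close>). In the bidual this is clear, since an element of the unit
  ball can be changed on \<open>L\<close> independently of what it does on the complement; the return to \<open>X\<close> uses a weak
  form of local reflexivity (\<open>adherent_near\<close>) and an iteration that makes approximate equalities exact.

  So it remains to find an L-summand \<open>L\<close> such that every point of norm 1 whose \<open>L\<close>-norm is 1,
  too, is almost normed by infinitely many \<open>p s\<close> (\<open>convex_DLD2P_criterion\<close>). In (a) this is the line spanned by the limit \<open>p s0\<close>; in
  (b) weak-star compactness of \<open>{p s | s \<in> S}\<close>, which is infinite, yields an accumulation point that can
  take the role of the limit. In (c) let \<open>f\<close> be the unique norming functional of the smooth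
  \<open>\<Delta>\<close>-point \<open>x0\<close>. As \<open>f\<close> is extreme, it is either a multiple of some \<open>p s\<close>, and then smoothness makes
  functionals \<open>p t\<close> that almost norm \<open>x0\<close> accumulate at \<open>p s\<close> up to unimodular factors; or all
  coefficients \<open>c\<^sub>s\<close> of \<open>f\<close> vanish, and then \<open>L\<close> can be the set of all functionals with this property,
  because for \<open>f\<close> in this set with \<open>\<parallel>f\<parallel> \<le> 1\<close> and for finite \<open>F\<close>, the value \<open>|f x|\<close> is at most the
  supremum of \<open>|p s x|\<close> over \<open>s\<close> outside \<open>F\<close> (\<open>uncharging_functional_le\<close>).

  For a function algebra \<open>A\<close>, positive functionals on the real continuous functions take the place of
  measures. A point \<open>k\<close> lies in the Choquet boundary iff only the evaluation at \<open>k\<close> represents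
  \<open>\<delta>\<^sub>k|A\<close> (\<open>supp_represents_extreme\<close>, \<open>choquet_boundaryI\<close>). This implies on the one hand that all
  functions in \<open>A\<close> attain their norms on the Choquet boundary, by a Krein-Milman argument for closed subsets
  of \<open>K\<close>. On the other hand it provides functions in \<open>A\<close> that peak near \<open>k\<close> (\<open>peaking_function\<close>), so that
  functionals that annihilate \<open>A\<close> have no mass at \<open>k\<close>; therefore the mass at \<open>k\<close> of a functional on \<open>A\<close> is
  well defined, and splitting it off is an L-projection.
\<close>

section \<open>The scalar field\<close>

lemma to_complex_diff: "to_complex (x - y) = to_complex x - to_complex (y::'k::rc_scalar)"
  by (metis add_diff_cancel diff_add_cancel to_complex_add)

lemma to_complex_of_real [simp]: "to_complex (of_real r :: 'k::rc_scalar) = of_real r"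
  by (simp add: of_real_def to_complex_scaleR_one)

lemma re_of_real [simp]: "re (of_real r :: 'k::rc_scalar) = r"
  by (simp add: re_def)

lemma re_0 [simp]: "re (0::'k::rc_scalar) = 0"
  using re_of_real[of 0, where 'k='k] by (simp del: re_of_real)

lemma re_1 [simp]: "re (1::'k::rc_scalar) = 1"
  using re_of_real[of 1, where 'k='k] by (simp del: re_of_real)

lemma re_add [simp]: "re (x + y :: 'k::rc_scalar) = re x + re y"
  by (simp add: re_def to_complex_add)

lemma re_diff [simp]: "re (x - y :: 'k::rc_scalar) = re x - re y"
  by (simp add: re_def to_complex_diff)

lemma re_minus [simp]: "re (- x :: 'k::rc_scalar) = - re x"
  using re_diff[of 0 x] by simp

lemma re_of_real_mult [simp]: "re (of_real r * x :: 'k::rc_scalar) = r * re x"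
  by (simp add: re_def to_complex_mult)

lemma re_scaleR [simp]: "re (r *\<^sub>R x :: 'k::rc_scalar) = r * re x"
  by (simp add: scaleR_conv_of_real)

lemma abs_re_le: "\<bar>re (x::'k::rc_scalar)\<bar> \<le> norm x"
  unfolding re_def by (metis abs_Re_le_cmod norm_to_complex)

lemma re_le: "re (x::'k::rc_scalar) \<le> norm x"
  using abs_re_le[of x] by linarith

lemma bounded_linear_re: "bounded_linear (re :: 'k::rc_scalar \<Rightarrow> real)"
  by (rule bounded_linear_intro[where K=1]) (auto simp: abs_re_le)

lemmas continuous_on_re [continuous_intros] =
  bounded_linear.continuous_on[OF bounded_linear_re]

lemma eq_norm_if_re_ge_norm:
  fixes x :: "'k::rc_scalar"
  assumes "re x \<ge> norm x"
  shows "x = of_real (norm x)"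
proof -
  let ?z = "to_complex x"
  have "Re ?z = cmod ?z"
    using assms re_le[of x] by (simp add: re_def norm_to_complex)
  then have "?z = of_real (norm x)"
    by (metis cmod_eq_Re complex_eq_iff norm_to_complex Re_complex_of_real Im_complex_of_real
        cmod_def add_cancel_left_right power2_eq_iff real_sqrt_abs real_sqrt_eq_iff abs_norm_cancel
        cmod_power2 zero_eq_power2)
  then have "norm (x - of_real (norm x)) = 0"
    by (metis norm_to_complex to_complex_diff to_complex_of_real diff_self norm_zero)
  then show ?thesis by simp
qed

lemma norm_diff_sq: "(norm (x - y :: 'k::rc_scalar))\<^sup>2 =
    (norm x)\<^sup>2 + (norm y)\<^sup>2 - 2 * Re (to_complex x * cnj (to_complex y))"
proof -
  have "(norm (x - y))\<^sup>2 = (cmod (to_complex x - to_complex y))\<^sup>2"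
    by (metis norm_to_complex to_complex_diff)
  also have "\<dots> = (cmod (to_complex x))\<^sup>2 + (cmod (to_complex y))\<^sup>2
      - 2 * Re (to_complex x * cnj (to_complex y))"
    by (simp only: cmod_power2) (simp add: power2_eq_square algebra_simps)
  finally show ?thesis by (simp add: norm_to_complex)
qed

lemma norm_1_diff_sq: "(norm (1 - y :: 'k::rc_scalar))\<^sup>2 = 1 + (norm y)\<^sup>2 - 2 * re y"
  using norm_diff_sq[of 1 y] to_complex_of_real[of 1, where 'k='k] by (simp add: re_def del: to_complex_of_real)

lemma obtain_rotation:
  fixes c :: "'k::rc_scalar"
  obtains \<theta> where "norm \<theta> = 1" "\<theta> * c = of_real (norm c)"
proof (cases "c = 0")
  case True
  then show ?thesis using that[of 1] by simp
next
  case False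
  then show ?thesis
    using that[of "of_real (norm c) / c"] by (simp add: norm_divide)
qed

lemma obtain_imaginary_unit:
  assumes "\<not> range (to_complex :: 'k \<Rightarrow> complex) \<subseteq> \<real>"
  obtains \<iota> :: "'k::rc_scalar" where "\<iota> * \<iota> = -1" "to_complex \<iota> = \<i>"
proof -
  obtain \<iota> :: 'k where i: "to_complex \<iota> = \<i>"
    using assms range_to_complex[where 'a='k] by (metis order_refl UNIV_I image_iff)
  have "to_complex (\<iota> * \<iota> + 1) = 0"
    using to_complex_of_real[of 1, where 'k='k] by (simp add: i to_complex_add to_complex_mult del: to_complex_of_real)
  then have "\<iota> * \<iota> + 1 = 0" by (metis norm_eq_zero norm_to_complex)
  then show ?thesis using that i by (simp add: eq_neg_iff_add_eq_0)
qed

text \<open>Local compactness of the scalar field gives weak-star compactness of dual balls; its completeness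
  gives convergence of absolutely convergent series of scalars.\<close>

instance rc_scalar \<subseteq> heine_borel
proof
  fix f :: "nat \<Rightarrow> 'a"
  assume "bounded (range f)"
  then have "bounded (range (to_complex \<circ> f))"
    by (auto simp: bounded_iff norm_to_complex)
  then obtain l r where r: "strict_mono r" "((to_complex \<circ> f) \<circ> r) \<longlonglongrightarrow> l"
    using bounded_imp_convergent_subsequence by blast
  have "closed (range (to_complex :: 'a \<Rightarrow> complex))"
    using range_to_complex[where 'a='a] closed_complex_Reals by auto
  then have "l \<in> range (to_complex :: 'a \<Rightarrow> complex)"
    by (rule closed_sequentially[OF _ _ r(2)]) auto
  then obtain a :: 'a where a: "l = to_complex a" by auto
  have "(f \<circ> r) \<longlonglongrightarrow> a"
    using r(2) unfolding a tendsto_iff dist_norm o_def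
    by (simp flip: to_complex_diff add: norm_to_complex)
  with r(1) show "\<exists>l r. strict_mono (r::nat\<Rightarrow>nat) \<and> (f \<circ> r) \<longlonglongrightarrow> l" by blast
qed

instance rc_scalar \<subseteq> banach ..

section \<open>Hahn-Banach separation\<close>

definition sublinear :: "('w::real_vector \<Rightarrow> real) \<Rightarrow> bool" where
  "sublinear q \<longleftrightarrow> (\<forall>x y. q (x + y) \<le> q x + q y) \<and> (\<forall>r\<ge>0. \<forall>x. q (r *\<^sub>R x) = r * q x)"

lemma sublinear_0: "sublinear q \<Longrightarrow> q 0 = 0"
  unfolding sublinear_def by (metis mult_zero_left order_refl scaleR_zero_left)

lemma sublinear_add: "sublinear q \<Longrightarrow> q (x + y) \<le> q x + q y"
  by (simp add: sublinear_def)

lemma sublinear_scaleR: "sublinear q \<Longrightarrow> 0 \<le> r \<Longrightarrow> q (r *\<^sub>R x) = r * q x"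
  by (simp add: sublinear_def)

text \<open>Sublinear functionals will always be given by the convex cone of the pairs \<open>(v, r)\<close> for which
  \<open>r\<close> is an upper bound of the value wanted at \<open>v\<close>. The values are finite because \<open>(v, r)\<close> and
  \<open>(-v, s)\<close> add up to a bound of the value at 0.\<close>

definition bound_cone :: "('w::real_vector \<times> real) set \<Rightarrow> bool" where
  "bound_cone R \<longleftrightarrow> (0, 0) \<in> R \<and>
     (\<forall>v r w s. (v, r) \<in> R \<longrightarrow> (w, s) \<in> R \<longrightarrow> (v + w, r + s) \<in> R) \<and>
     (\<forall>v r t. (v, r) \<in> R \<longrightarrow> 0 < t \<longrightarrow> (t *\<^sub>R v, t * r) \<in> R) \<and>
     (\<forall>r. (0, r) \<in> R \<longrightarrow> 0 \<le> r) \<and> (\<forall>v. \<exists>r. (v, r) \<in> R)"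

lemma bound_coneI:
  assumes "(0, 0) \<in> R" "\<And>v r w s. (v, r) \<in> R \<Longrightarrow> (w, s) \<in> R \<Longrightarrow> (v + w, r + s) \<in> R"
    and "\<And>v r t. (v, r) \<in> R \<Longrightarrow> 0 < t \<Longrightarrow> (t *\<^sub>R v, t * r) \<in> R"
    and "\<And>r. (0, r) \<in> R \<Longrightarrow> 0 \<le> r" "\<And>v. \<exists>r. (v, r) \<in> R"
  shows "bound_cone R"
  using assms unfolding bound_cone_def by blast

definition best_bound :: "('w \<times> real) set \<Rightarrow> 'w \<Rightarrow> real" where
  "best_bound R v = Inf {r. (v, r) \<in> R}"

lemma best_bound_le:
  assumes R: "bound_cone R" and "(v, r) \<in> R"
  shows "best_bound R v \<le> r"
proof -
  obtain s where s: "(- v, s) \<in> R" using R unfolding bound_cone_def by blast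
  have "- s \<le> r" if "(v, r) \<in> R" for r
  proof -
    have "(v + - v, r + s) \<in> R" using R that s unfolding bound_cone_def by blast
    then have "(0, r + s) \<in> R" by simp
    then have "0 \<le> r + s" using R unfolding bound_cone_def by blast
    then show ?thesis by simp
  qed
  then show ?thesis
    unfolding best_bound_def using assms(2) by (intro cInf_lower bdd_belowI[of _ "- s"]) auto
qed

lemma best_bound_ge:
  assumes R: "bound_cone R" and "\<And>r. (v, r) \<in> R \<Longrightarrow> m \<le> r"
  shows "m \<le> best_bound R v"
  unfolding best_bound_def
  by (rule cInf_greatest) (use assms in \<open>auto simp: bound_cone_def\<close>)

lemma sublinear_best_bound:
  assumes R: "bound_cone R"
  shows "sublinear (best_bound R)"
proof -
  let ?q = "best_bound R"
  have zero: "?q 0 = 0"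
    using best_bound_le[OF R, of 0 0] best_bound_ge[OF R, of 0 0] R by (force simp: bound_cone_def)
  have add: "?q (v + w) \<le> ?q v + ?q w" for v w
  proof -
    have "?q (v + w) - ?q v \<le> ?q w"
    proof (rule best_bound_ge[OF R])
      fix s assume s: "(w, s) \<in> R"
      have "?q (v + w) - s \<le> r" if "(v, r) \<in> R" for r
      proof -
        have "(v + w, r + s) \<in> R" using R that s unfolding bound_cone_def by blast
        from best_bound_le[OF R this] show ?thesis by simp
      qed
      then have "?q (v + w) - s \<le> ?q v" by (rule best_bound_ge[OF R])
      then show "?q (v + w) - ?q v \<le> s" by simp
    qed
    then show ?thesis by simp
  qed
  have scale: "?q (t *\<^sub>R v) \<le> t * ?q v" if t: "0 < t" for t v
  proof -
    have "?q (t *\<^sub>R v) / t \<le> ?q v"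
    proof (rule best_bound_ge[OF R])
      fix r assume "(v, r) \<in> R"
      then have "(t *\<^sub>R v, t * r) \<in> R" using R t unfolding bound_cone_def by blast
      from best_bound_le[OF R this] show "?q (t *\<^sub>R v) / t \<le> r" using t by (simp add: field_simps)
    qed
    then show ?thesis using t by (simp add: field_simps)
  qed
  have "?q (t *\<^sub>R v) = t * ?q v" if "0 \<le> t" for t v
  proof (cases "t = 0")
    case False
    with that have t: "0 < t" by simp
    have "?q ((1 / t) *\<^sub>R (t *\<^sub>R v)) \<le> (1 / t) * ?q (t *\<^sub>R v)" using t by (intro scale) simp
    then have "t * ?q v \<le> ?q (t *\<^sub>R v)" using t by (simp add: field_simps)
    with scale[OF t] show ?thesis by (rule antisym)
  qed (simp add: zero)
  then show ?thesis using add by (simp add: sublinear_def)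
qed

text \<open>The best bounds in this cone form the largest sublinear functional below \<open>q\<close> whose value at
  \<open>-h\<close> is at most \<open>- q h\<close>.\<close>

definition tilt_cone :: "('w::real_vector \<Rightarrow> real) \<Rightarrow> 'w \<Rightarrow> ('w \<times> real) set" where
  "tilt_cone q h = {(v, r). \<exists>t\<ge>0. q (v + t *\<^sub>R h) \<le> r + t * q h}"

definition tilt :: "('w::real_vector \<Rightarrow> real) \<Rightarrow> 'w \<Rightarrow> 'w \<Rightarrow> real" where
  "tilt q h = best_bound (tilt_cone q h)"

lemma tilt_coneI: "0 \<le> t \<Longrightarrow> q (v + t *\<^sub>R h) \<le> r + t * q h \<Longrightarrow> (v, r) \<in> tilt_cone q h"
  unfolding tilt_cone_def by blast

lemma bound_cone_tilt:
  assumes q: "sublinear q"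
  shows "bound_cone (tilt_cone q h)"
proof (rule bound_coneI)
  show "(0, 0) \<in> tilt_cone q h"
    by (rule tilt_coneI[of 0]) (simp_all add: sublinear_0[OF q])
  show "(v + w, r + s) \<in> tilt_cone q h"
    if vr: "(v, r) \<in> tilt_cone q h" and ws: "(w, s) \<in> tilt_cone q h" for v r w s
  proof -
    obtain t u where tu: "0 \<le> t" "0 \<le> u" "q (v + t *\<^sub>R h) \<le> r + t * q h"
      "q (w + u *\<^sub>R h) \<le> s + u * q h" using vr ws by (auto simp: tilt_cone_def)
    have "(v + w) + (t + u) *\<^sub>R h = (v + t *\<^sub>R h) + (w + u *\<^sub>R h)" by (simp add: algebra_simps)
    then have "q ((v + w) + (t + u) *\<^sub>R h) \<le> (r + s) + (t + u) * q h"
      using sublinear_add[OF q, of "v + t *\<^sub>R h" "w + u *\<^sub>R h"] tu by (simp add: algebra_simps)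
    then show ?thesis using tu by (intro tilt_coneI[of "t + u"]) auto
  qed
  show "(a *\<^sub>R v, a * r) \<in> tilt_cone q h" if vr: "(v, r) \<in> tilt_cone q h" and a: "0 < a" for v r a
  proof -
    obtain t where t: "0 \<le> t" "q (v + t *\<^sub>R h) \<le> r + t * q h" using vr by (auto simp: tilt_cone_def)
    have "q (a *\<^sub>R v + (a * t) *\<^sub>R h) = a * q (v + t *\<^sub>R h)"
      using sublinear_scaleR[OF q, of a "v + t *\<^sub>R h"] a by (simp add: scaleR_add_right)
    also have "\<dots> \<le> a * (r + t * q h)" using t a by (intro mult_left_mono) auto
    finally show ?thesis
      using t a by (intro tilt_coneI[of "a * t"]) (auto simp: algebra_simps)
  qed
  show "0 \<le> r" if "(0, r) \<in> tilt_cone q h" for r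
    using that by (auto simp: tilt_cone_def sublinear_scaleR[OF q])
  show "\<exists>r. (v, r) \<in> tilt_cone q h" for v
    by (rule exI[of _ "q v"], rule tilt_coneI[of 0]) auto
qed

lemma tilt_le: "sublinear q \<Longrightarrow> 0 \<le> t \<Longrightarrow> tilt q h v \<le> q (v + t *\<^sub>R h) - t * q h"
  unfolding tilt_def by (rule best_bound_le[OF bound_cone_tilt]) (auto intro: tilt_coneI)

lemma tilt_le_self: "sublinear q \<Longrightarrow> tilt q h v \<le> q v"
  using tilt_le[of q 0 h v] by simp

lemma tilt_neg: "sublinear q \<Longrightarrow> tilt q h (- h) \<le> - q h"
  using tilt_le[of q 1 h "-h"] by (simp add: sublinear_0)

lemma tilt_ge:
  "sublinear q \<Longrightarrow> (\<And>t. 0 \<le> t \<Longrightarrow> m \<le> q (v + t *\<^sub>R h) - t * q h) \<Longrightarrow> m \<le> tilt q h v"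
  unfolding tilt_def
  by (rule best_bound_ge[OF bound_cone_tilt]) (force simp: tilt_cone_def)+

lemma sublinear_tilt: "sublinear q \<Longrightarrow> sublinear (tilt q h)"
  unfolding tilt_def by (rule sublinear_best_bound[OF bound_cone_tilt])

text \<open>A minimal sublinear functional \<open>m\<close> coincides with all its tilts, which says
  \<open>m v + m w \<le> m (v + w)\<close>; so minimal sublinear functionals are linear, and Zorn's lemma provides
  one below any given sublinear functional.\<close>

theorem Hahn_Banach_sublinear:
  fixes q :: "'w::real_vector \<Rightarrow> real"
  assumes q: "sublinear q"
  obtains F where "linear F" "\<And>x. F x \<le> q x"
proof -
  define A where "A = {p. sublinear p \<and> (\<forall>x. p x \<le> q x)}"
  \<comment> \<open>the order is reversed, as Zorn's lemma is stated for maximal elements\<close>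
  define P where "P = (\<lambda>p p' :: 'w \<Rightarrow> real. p' \<le> p)"
  have "\<exists>m\<in>A. \<forall>a\<in>A. P m a \<longrightarrow> a = m"
  proof (rule predicate_Zorn)
    show "partial_order_on A (relation_of P A)"
      unfolding P_def by (rule partial_order_on_relation_ofI) auto
    fix C assume C: "C \<in> Chains (relation_of P A)"
    have CA: "sublinear p" "\<And>x. p x \<le> q x" if "p \<in> C" for p
      using C that by (auto simp: Chains_def relation_of_def A_def)
    have chain: "p \<le> p' \<or> p' \<le> p" if "p \<in> C" "p' \<in> C" for p p'
      using C that by (auto simp: Chains_def relation_of_def P_def)
    show "\<exists>u\<in>A. \<forall>a\<in>C. P a u"
    proof (cases "C = {}")
      case True
      then show ?thesis using q by (auto simp: A_def)
    next
      case False
      define R where "R = {(v, r). \<exists>p\<in>C. p v \<le> r}"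
      have R: "bound_cone R"
      proof (rule bound_coneI)
        show "(v + w, r + s) \<in> R" if vr: "(v, r) \<in> R" and ws: "(w, s) \<in> R" for v r w s
        proof -
          obtain p p' where p: "p \<in> C" "p v \<le> r" "p' \<in> C" "p' w \<le> s" using vr ws by (auto simp: R_def)
          obtain p0 where p0: "p0 \<in> C" "p0 \<le> p" "p0 \<le> p'" using chain[OF p(1,3)] p by blast
          have "p0 (v + w) \<le> p0 v + p0 w" by (rule sublinear_add[OF CA(1)[OF p0(1)]])
          also have "\<dots> \<le> r + s"
            using p p0 by (intro add_mono) (auto simp: le_fun_def intro: order_trans)
          finally show ?thesis using p0(1) by (auto simp: R_def)
        qed
        show "(t *\<^sub>R v, t * r) \<in> R" if vr: "(v, r) \<in> R" and t: "0 < t" for v r t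
        proof -
          obtain p where p: "p \<in> C" "p v \<le> r" using vr by (auto simp: R_def)
          then have "p (t *\<^sub>R v) \<le> t * r" using t by (simp add: sublinear_scaleR[OF CA(1)])
          then show ?thesis using p(1) by (auto simp: R_def)
        qed
        obtain p where p: "p \<in> C" using False by blast
        have "p 0 \<le> 0" using sublinear_0[OF CA(1)[OF p]] by simp
        then show "(0, 0) \<in> R" using p by (auto simp: R_def)
        show "0 \<le> r" if "(0, r) \<in> R" for r
        proof -
          obtain p where p: "p \<in> C" "p 0 \<le> r" using \<open>(0, r) \<in> R\<close> by (auto simp: R_def)
          then show ?thesis using sublinear_0[OF CA(1)[OF p(1)]] by simp
        qed
        show "\<exists>r. (v, r) \<in> R" for v using p by (auto simp: R_def)
      qed
      have le: "best_bound R x \<le> p x" if "p \<in> C" for p x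
        by (rule best_bound_le[OF R]) (use that in \<open>auto simp: R_def\<close>)
      then have "best_bound R x \<le> q x" for x
        using False CA(2) by (meson ex_in_conv order_trans)
      then show ?thesis
        using le sublinear_best_bound[OF R]
        by (intro bexI[of _ "best_bound R"]) (auto simp: A_def P_def le_fun_def)
    qed
  qed
  then obtain m where m: "sublinear m" "\<And>x. m x \<le> q x"
    and min: "\<And>p. sublinear p \<Longrightarrow> (\<And>x. p x \<le> m x) \<Longrightarrow> p = m"
    by (auto simp: A_def P_def le_fun_def) (meson order_trans)
  have tilt: "tilt m w = m" for w
    by (rule min) (auto simp: m sublinear_tilt tilt_le_self)
  have add: "m (v + w) = m v + m w" for v w
    using tilt_le[OF m(1), of 1 w v] sublinear_add[OF m(1), of v w] by (simp add: tilt)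
  have "m (- v) = - m v" for v
    using add[of v "- v"] by (simp add: sublinear_0[OF m(1)])
  then have "m (r *\<^sub>R v) = r * m v" for r v
    using sublinear_scaleR[OF m(1), of r v] sublinear_scaleR[OF m(1), of "- r" v]
    by (cases "0 \<le> r") (simp_all add: minus_equation_iff)
  then have "linear m" by (intro linearI) (auto simp: add)
  then show ?thesis using that m by blast
qed

text \<open>Tilting first makes the functional attain the bound at a prescribed point.\<close>

corollary Hahn_Banach_sublinear_at:
  fixes q :: "'w::real_vector \<Rightarrow> real"
  assumes q: "sublinear q"
  obtains F where "linear F" "\<And>x. F x \<le> q x" "F h = q h"
proof -
  obtain F where F: "linear F" "\<And>x. F x \<le> tilt q h x"
    using Hahn_Banach_sublinear[OF sublinear_tilt[OF q]] by blast
  have "F (- h) \<le> - q h" using F(2)[of "-h"] tilt_neg[OF q, of h] by linarith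
  then have "q h \<le> F h" using F(1) by (simp add: linear_neg)
  moreover have le: "F x \<le> q x" for x
    using F(2)[of x] tilt_le_self[OF q, of h x] by linarith
  ultimately show ?thesis using that F(1) by (meson antisym)
qed

corollary Hahn_Banach_cone:
  assumes R: "bound_cone R" and e: "0 < e"
  obtains F r where "linear F" "\<forall>v r. (v, r) \<in> R \<longrightarrow> F v \<le> r" "(h, r) \<in> R" "r < F h + e"
proof -
  obtain F where F: "linear F" "\<And>v. F v \<le> best_bound R v" "F h = best_bound R h"
    using Hahn_Banach_sublinear_at[OF sublinear_best_bound[OF R]] by blast
  have "\<exists>r. (h, r) \<in> R \<and> r < F h + e"
  proof (rule ccontr)
    assume "\<not> ?thesis"
    then have "F h + e \<le> best_bound R h" by (intro best_bound_ge[OF R]) (auto simp: not_less)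
    then show False using F(3) e by simp
  qed
  moreover have "F v \<le> r" if "(v, r) \<in> R" for v r
    using F(2)[of v] best_bound_le[OF R that] by simp
  ultimately show ?thesis using that F(1) by blast
qed

lemma sublinear_norm: "sublinear (norm :: 'w::real_normed_vector \<Rightarrow> real)"
  by (simp add: sublinear_def norm_triangle_ineq)

text \<open>The separating functional \<open>F\<close> is obtained from the bounds \<open>\<parallel>v + t (z - c)\<parallel> - t d\<close> for \<open>F v\<close>,
  where \<open>t \<ge> 0\<close> and \<open>c \<in> C\<close> and \<open>d\<close> is a lower bound of the distances \<open>\<parallel>z - c\<parallel>\<close>: this is what makes
  all bounds for \<open>F 0\<close> nonnegative.\<close>

theorem separation_from_convex:
  fixes C :: "'w::real_normed_vector set"
  assumes C: "convex C" and z: "z \<notin> closure C"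
  obtains F d where "linear F" "\<And>x. \<bar>F x\<bar> \<le> norm x" "0 < d" "\<And>c. c \<in> C \<Longrightarrow> F c + d \<le> F z"
proof (cases "C = {}")
  case True
  then show ?thesis
    using that[of "\<lambda>_. 0" 1] by (auto simp: module_hom_zero)
next
  case False
  obtain d where d: "0 < d" "\<And>c. c \<in> C \<Longrightarrow> d \<le> norm (z - c)"
    using z unfolding closure_approachable by (auto simp: dist_norm norm_minus_commute not_less)
  define R where "R = {(v, r). \<exists>t\<ge>0. \<exists>c\<in>C. norm (v + t *\<^sub>R (z - c)) \<le> r + t * d}"
  have RI: "(v, r) \<in> R" if "0 \<le> t" "c \<in> C" "norm (v + t *\<^sub>R (z - c)) \<le> r + t * d" for v r t c
    using that by (auto simp: R_def)
  have R: "bound_cone R"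
  proof (rule bound_coneI)
    show "(0, 0) \<in> R" using False RI[of 0 _ 0 0] by auto
    show "(v + w, r + s) \<in> R" if vr: "(v, r) \<in> R" and ws: "(w, s) \<in> R" for v r w s
    proof -
      obtain t c u b where tu: "0 \<le> t" "c \<in> C" "0 \<le> u" "b \<in> C"
        "norm (v + t *\<^sub>R (z - c)) \<le> r + t * d" "norm (w + u *\<^sub>R (z - b)) \<le> s + u * d"
        using vr ws unfolding R_def by blast
      have sum: "norm ((v + w) + (t *\<^sub>R (z - c) + u *\<^sub>R (z - b))) \<le> (r + s) + (t + u) * d"
        using norm_triangle_ineq[of "v + t *\<^sub>R (z - c)" "w + u *\<^sub>R (z - b)"] tu(5,6)
        by (simp add: algebra_simps)
      show ?thesis
      proof (cases "t + u = 0")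
        case True
        then have "t = 0" "u = 0" using tu by linarith+
        then show ?thesis using sum tu(2) by (intro RI[of 0 c]) auto
      next
        case False
        then have pos: "0 < t + u" using tu by linarith
        define a where "a = (t / (t + u)) *\<^sub>R c + (u / (t + u)) *\<^sub>R b"
        have "a \<in> C"
          unfolding a_def using pos tu by (intro convexD[OF C]) (auto simp flip: add_divide_distrib)
        moreover have "(t + u) *\<^sub>R a = t *\<^sub>R c + u *\<^sub>R b"
          using pos by (simp add: a_def scaleR_add_right)
        then have "(t + u) *\<^sub>R (z - a) = t *\<^sub>R (z - c) + u *\<^sub>R (z - b)"
          by (simp add: algebra_simps)
        ultimately show ?thesis using sum pos by (intro RI[of "t + u" a]) auto
      qed
    qed
    show "(a *\<^sub>R v, a * r) \<in> R" if vr: "(v, r) \<in> R" and a: "0 < a" for v r a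
    proof -
      obtain t c where t: "0 \<le> t" "c \<in> C" "norm (v + t *\<^sub>R (z - c)) \<le> r + t * d"
        using vr unfolding R_def by blast
      have "norm (a *\<^sub>R (v + t *\<^sub>R (z - c))) = a * norm (v + t *\<^sub>R (z - c))" using a by simp
      also have "\<dots> \<le> a * (r + t * d)" using t(3) a by (intro mult_left_mono) auto
      finally have "norm (a *\<^sub>R v + (a * t) *\<^sub>R (z - c)) \<le> a * r + (a * t) * d"
        by (simp add: scaleR_add_right distrib_left mult.assoc)
      then show ?thesis using t a by (intro RI[of "a * t" c]) auto
    qed
    show "0 \<le> r" if "(0, r) \<in> R" for r
    proof -
      obtain t c where t: "0 \<le> t" "c \<in> C" "t * norm (z - c) \<le> r + t * d"
        using \<open>(0, r) \<in> R\<close> by (auto simp: R_def)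
      then show ?thesis using mult_left_mono[OF d(2)[OF t(2)] t(1)] by linarith
    qed
    show "\<exists>r. (v, r) \<in> R" for v using False RI[of 0 _ v "norm v"] by auto
  qed
  obtain F r where "linear F" "\<forall>v r. (v, r) \<in> R \<longrightarrow> F v \<le> r" "(0, r) \<in> R" "r < F 0 + 1"
    by (rule Hahn_Banach_cone[OF R zero_less_one])
  then have F: "linear F" "\<And>v r. (v, r) \<in> R \<Longrightarrow> F v \<le> r" by auto
  have Fn: "F x \<le> norm x" for x
    using False by (intro F(2)) (auto intro: RI[of 0])
  have "\<bar>F x\<bar> \<le> norm x" for x
    using Fn[of x] Fn[of "- x"] F(1) by (simp add: linear_neg abs_le_iff)
  moreover have "F c + d \<le> F z" if "c \<in> C" for c
  proof -
    have "F (c - z) \<le> - d" using that by (intro F(2) RI[of 1 c]) auto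
    then show ?thesis using F(1) by (simp add: linear_diff)
  qed
  ultimately show ?thesis using that F(1) d(1) by blast
qed

section \<open>Dual spaces and functionals on them\<close>

locale normed_subspace =
  fixes sc :: "'k::rc_scalar \<Rightarrow> 'v::real_normed_vector \<Rightarrow> 'v" and X :: "'v set"
  assumes normed: "normed_space_over sc" and subspace: "module.subspace sc X"
begin

sublocale vs: vector_space sc
  using normed by (simp add: normed_space_over_def)

lemma sc_of_real: "sc (of_real r) x = r *\<^sub>R x"
  using normed by (simp add: normed_space_over_def)

lemma norm_sc: "norm (sc c x) = norm c * norm x"
  using normed by (simp add: normed_space_over_def)

lemma zero_mem [simp, intro]: "0 \<in> X"
  using subspace by (rule vs.subspace_0)

lemma add_mem [intro]: "x \<in> X \<Longrightarrow> y \<in> X \<Longrightarrow> x + y \<in> X"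
  using subspace by (rule vs.subspace_add)

lemma diff_mem [intro]: "x \<in> X \<Longrightarrow> y \<in> X \<Longrightarrow> x - y \<in> X"
  using subspace by (rule vs.subspace_diff)

lemma sc_mem [intro]: "x \<in> X \<Longrightarrow> sc c x \<in> X"
  using subspace by (rule vs.subspace_scale)

lemma scaleR_mem [intro]: "x \<in> X \<Longrightarrow> r *\<^sub>R x \<in> X"
  using sc_mem[of x "of_real r"] by (simp add: sc_of_real)

lemma neg_mem [intro]: "x \<in> X \<Longrightarrow> - x \<in> X"
  using scaleR_mem[of x "-1"] by simp

lemma convex_X: "convex X"
  by (auto simp: convex_def)

lemma zero_unit_ball: "0 \<in> unit_ball X"
  by (simp add: unit_ball_def)

lemma dual_add: "f \<in> dual sc X \<Longrightarrow> x \<in> X \<Longrightarrow> y \<in> X \<Longrightarrow> f (x + y) = f x + f y"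
  by (simp add: dual_def)

lemma dual_sc: "f \<in> dual sc X \<Longrightarrow> x \<in> X \<Longrightarrow> f (sc c x) = c * f x"
  by (simp add: dual_def)

lemma dual_outside: "f \<in> dual sc X \<Longrightarrow> x \<notin> X \<Longrightarrow> f x = 0"
  by (simp add: dual_def)

lemma dual_scaleR: "f \<in> dual sc X \<Longrightarrow> x \<in> X \<Longrightarrow> f (r *\<^sub>R x) = of_real r * f x"
  using dual_sc[of f x "of_real r"] by (simp add: sc_of_real)

lemma dual_0: "f \<in> dual sc X \<Longrightarrow> f 0 = 0"
  using dual_scaleR[of f 0 0] by simp

lemma dual_diff: "f \<in> dual sc X \<Longrightarrow> x \<in> X \<Longrightarrow> y \<in> X \<Longrightarrow> f (x - y) = f x - f y"
  using dual_add[of f x "(-1) *\<^sub>R y"] dual_scaleR[of f y "-1"] by auto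

lemma dualI:
  assumes "\<And>x y. x \<in> X \<Longrightarrow> y \<in> X \<Longrightarrow> f (x + y) = f x + f y"
    and "\<And>c x. x \<in> X \<Longrightarrow> f (sc c x) = c * f x"
    and "\<And>x. x \<in> X \<Longrightarrow> norm (f x) \<le> C * norm x"
    and "\<And>x. x \<notin> X \<Longrightarrow> f x = 0"
  shows "f \<in> dual sc X"
  using assms unfolding dual_def by blast

lemma dual_bdd:
  assumes "f \<in> dual sc X"
  shows "bdd_above ((\<lambda>x. norm (f x)) ` unit_ball X)"
proof -
  obtain C where C: "\<And>x. x \<in> X \<Longrightarrow> norm (f x) \<le> C * norm x"
    using assms unfolding dual_def by blast
  show ?thesis
  proof (rule bdd_aboveI2)
    fix x assume x: "x \<in> unit_ball X"
    have "norm (f x) \<le> \<bar>C\<bar> * norm x"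
      using order_trans[OF C[of x] mult_right_mono[OF abs_ge_self norm_ge_zero]] x
      by (simp add: unit_ball_def)
    also have "\<dots> \<le> \<bar>C\<bar> * 1"
      using x by (intro mult_left_mono) (auto simp: unit_ball_def)
    finally show "norm (f x) \<le> \<bar>C\<bar>" by simp
  qed
qed

lemma norm_le_dual_norm_ball:
  "f \<in> dual sc X \<Longrightarrow> x \<in> X \<Longrightarrow> norm x \<le> 1 \<Longrightarrow> norm (f x) \<le> dual_norm X f"
  unfolding dual_norm_def by (intro cSUP_upper dual_bdd) (auto simp: unit_ball_def)

lemma dual_norm_nonneg: "f \<in> dual sc X \<Longrightarrow> 0 \<le> dual_norm X f"
  using norm_le_dual_norm_ball[of f 0] by (simp add: dual_0)

lemma norm_le_dual_norm:
  assumes f: "f \<in> dual sc X" and x: "x \<in> X"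
  shows "norm (f x) \<le> dual_norm X f * norm x"
proof (cases "x = 0")
  case False
  have "norm (f ((1 / norm x) *\<^sub>R x)) \<le> dual_norm X f"
    using f x False by (intro norm_le_dual_norm_ball) auto
  then show ?thesis
    using f x False by (simp add: dual_scaleR norm_mult norm_divide field_simps)
qed (simp add: dual_0 f)

lemma dual_norm_le:
  assumes "\<And>x. x \<in> X \<Longrightarrow> norm x \<le> 1 \<Longrightarrow> norm (f x) \<le> C"
  shows "dual_norm X f \<le> C"
  unfolding dual_norm_def
  by (rule cSUP_least) (use zero_unit_ball assms in \<open>auto simp: unit_ball_def\<close>)

lemma dual_norm_le_mult:
  assumes "\<And>x. x \<in> X \<Longrightarrow> norm (f x) \<le> C * norm x" "0 \<le> C"
  shows "dual_norm X f \<le> C"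
proof (rule dual_norm_le)
  fix x assume "x \<in> X" "norm x \<le> 1"
  then show "norm (f x) \<le> C"
    using assms(1)[of x] mult_left_mono[of "norm x" 1 C] assms(2) by simp
qed

lemma rotate_dual:
  assumes "f \<in> dual sc X" "x \<in> X"
  obtains \<theta> where "norm \<theta> = 1" "f (sc \<theta> x) = of_real (norm (f x))" "norm (sc \<theta> x) = norm x"
proof -
  obtain \<theta> where "norm \<theta> = 1" "\<theta> * f x = of_real (norm (f x))"
    using obtain_rotation by blast
  then show ?thesis using that[of \<theta>] assms by (simp add: dual_sc norm_sc)
qed

lemma norm_le_if_re_le:
  assumes f: "f \<in> dual sc X" and C: "\<And>x. x \<in> X \<Longrightarrow> re (f x) \<le> C * norm x" and x: "x \<in> X"
  shows "norm (f x) \<le> C * norm x"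
proof -
  obtain \<theta> where "f (sc \<theta> x) = of_real (norm (f x))" "norm (sc \<theta> x) = norm x"
    using rotate_dual[OF f x] .
  then show ?thesis using C[of "sc \<theta> x"] x sc_mem by auto
qed

lemma dual_norm_approx:
  assumes f: "f \<in> dual sc X" and d: "0 < d"
  obtains u where "u \<in> X" "norm u \<le> 1" "dual_norm X f - d < re (f u)"
proof -
  have "\<exists>x\<in>unit_ball X. dual_norm X f - d < norm (f x)"
    unfolding dual_norm_def using d zero_unit_ball
    by (subst less_cSUP_iff[symmetric]) (auto simp: dual_bdd[OF f])
  then obtain x where x: "x \<in> X" "norm x \<le> 1" "dual_norm X f - d < norm (f x)"
    by (auto simp: unit_ball_def)
  obtain \<theta> where "f (sc \<theta> x) = of_real (norm (f x))" "norm (sc \<theta> x) = norm x"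
    using rotate_dual[OF f x(1)] .
  then show ?thesis using that[of "sc \<theta> x"] x by auto
qed

lemma dual_plus [intro]:
  assumes "f \<in> dual sc X" "g \<in> dual sc X"
  shows "(\<lambda>x. f x + g x) \<in> dual sc X"
proof (rule dualI)
  fix x assume x: "x \<in> X"
  show "norm (f x + g x) \<le> (dual_norm X f + dual_norm X g) * norm x"
    using norm_triangle_ineq[of "f x" "g x"] norm_le_dual_norm[OF assms(1) x]
      norm_le_dual_norm[OF assms(2) x] by (simp add: algebra_simps)
qed (use assms in \<open>auto simp: dual_add dual_sc dual_outside algebra_simps\<close>)

lemma dual_cmult [intro]:
  assumes "f \<in> dual sc X"
  shows "(\<lambda>x. c * f x) \<in> dual sc X"
proof (rule dualI)
  fix x assume x: "x \<in> X"
  show "norm (c * f x) \<le> (norm c * dual_norm X f) * norm x"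
    using norm_le_dual_norm[OF assms x] by (simp add: norm_mult mult.assoc mult_left_mono)
qed (use assms in \<open>auto simp: dual_add dual_sc dual_outside algebra_simps\<close>)

lemma dual_minus [intro]:
  assumes "f \<in> dual sc X" "g \<in> dual sc X"
  shows "(\<lambda>x. f x - g x) \<in> dual sc X"
  using dual_plus[OF assms(1) dual_cmult[OF assms(2), of "-1"]] by simp

lemma dual_zero [intro]: "(\<lambda>x. 0) \<in> dual sc X"
  by (rule dualI[where C=0]) auto

lemma dual_sum [intro]:
  assumes "\<And>i. i \<in> I \<Longrightarrow> f i \<in> dual sc X"
  shows "(\<lambda>x. \<Sum>i\<in>I. f i x) \<in> dual sc X"
  using assms by (induction I rule: infinite_finite_induct) auto

lemma dual_norm_triangle:
  assumes "f \<in> dual sc X" "g \<in> dual sc X"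
  shows "dual_norm X (\<lambda>x. f x + g x) \<le> dual_norm X f + dual_norm X g"
  using assms
  by (intro dual_norm_le) (meson add_mono norm_le_dual_norm_ball norm_triangle_ineq order_trans)

lemma dual_norm_cmult:
  assumes f: "f \<in> dual sc X"
  shows "dual_norm X (\<lambda>x. c * f x) = norm c * dual_norm X f"
proof -
  have le: "dual_norm X (\<lambda>x. c * f x) \<le> norm c * dual_norm X f" if "f \<in> dual sc X" for c f
    using that
    by (intro dual_norm_le) (auto simp: norm_mult intro!: mult_left_mono norm_le_dual_norm_ball)
  show ?thesis
  proof (cases "c = 0")
    case True
    have "dual_norm X (\<lambda>x. 0::'k) = 0"
      using dual_norm_le[of "\<lambda>x. 0::'k" 0] dual_norm_nonneg[OF dual_zero] by simp
    then show ?thesis using True by simp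
  next
    case False
    have "dual_norm X f \<le> norm (inverse c) * dual_norm X (\<lambda>x. c * f x)"
      using le[OF dual_cmult[OF f, of c], of "inverse c"] False by (simp add: mult.assoc[symmetric])
    then show ?thesis
      using le[OF f, of c] False by (simp add: norm_divide inverse_eq_divide field_simps)
  qed
qed

lemma dual_norm_zero [simp]: "dual_norm X (\<lambda>x. 0::'k) = 0"
  using dual_norm_cmult[OF dual_zero, of 0] by simp

lemma dual_norm_eq_0D:
  assumes f: "f \<in> dual sc X" and "dual_norm X f = 0"
  shows "f = (\<lambda>x. 0)"
proof
  show "f x = 0" for x
    using norm_le_dual_norm[OF f, of x] assms by (cases "x \<in> X") (auto simp: dual_outside)
qed

lemma dual_eqI_re:
  assumes f: "f \<in> dual sc X" and g: "g \<in> dual sc X" and eq: "\<And>x. x \<in> X \<Longrightarrow> re (f x) = re (g x)"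
  shows "f = g"
proof -
  let ?h = "\<lambda>x. f x - g x"
  have "norm (?h x) \<le> 0 * norm x" if "x \<in> X" for x
    using f g that eq by (intro norm_le_if_re_le) auto
  then have "dual_norm X ?h \<le> 0" by (intro dual_norm_le_mult) auto
  then have "?h = (\<lambda>x. 0)"
    using f g dual_norm_nonneg[OF dual_minus[OF f g]] by (intro dual_norm_eq_0D) auto
  then show ?thesis by (auto simp: fun_eq_iff)
qed

text \<open>Over the complex field, \<open>f x = F x - i F (i x)\<close> is the complex linear functional with real
  part \<open>F\<close>.\<close>

lemma dual_of_real_functional:
  assumes add: "\<And>x y. x \<in> X \<Longrightarrow> y \<in> X \<Longrightarrow> F (x + y) = F x + F y"
    and scale: "\<And>r x. x \<in> X \<Longrightarrow> F (r *\<^sub>R x) = r * F x"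
    and bound: "\<And>x. x \<in> X \<Longrightarrow> F x \<le> M * norm x" and M: "0 \<le> M"
  obtains f where "f \<in> dual sc X" "\<And>x. x \<in> X \<Longrightarrow> re (f x) = F x" "dual_norm X f \<le> M"
proof -
  have abs_bound: "\<bar>F x\<bar> \<le> M * norm x" if "x \<in> X" for x
    using bound[OF that] bound[of "(-1) *\<^sub>R x"] scale[OF that, of "-1"] that by (auto simp: abs_le_iff)
  have "\<exists>f\<in>dual sc X. \<forall>x\<in>X. re (f x) = F x"
  proof (cases "range (to_complex :: 'k \<Rightarrow> complex) \<subseteq> \<real>")
    case True
    have re: "of_real (re c) = c" for c :: 'k
    proof -
      have "to_complex c \<in> \<real>" using True by auto
      then have "to_complex (of_real (re c) - c) = 0"
        by (simp add: to_complex_diff re_def of_real_Re)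
      then have "norm (of_real (re c) - c) = 0" by (metis norm_to_complex norm_zero)
      then show ?thesis by simp
    qed
    define f where "f x = (if x \<in> X then of_real (F x) else 0 :: 'k)" for x
    have "f \<in> dual sc X"
    proof (rule dualI)
      show "f (sc c x) = c * f x" if "x \<in> X" for c x
        using that sc_mem scale[OF that, of "re c"] re[of c] sc_of_real[of "re c" x]
        by (simp add: f_def) (metis of_real_mult re)
    qed (use abs_bound in \<open>auto simp: f_def add\<close>)
    then show ?thesis by (intro bexI[of _ f]) (auto simp: f_def)
  next
    case False
    then obtain \<iota> :: 'k where i: "\<iota> * \<iota> = -1" "to_complex \<iota> = \<i>"
      by (rule obtain_imaginary_unit)
    have c_eq: "c = of_real (Re (to_complex c)) + of_real (Im (to_complex c)) * \<iota>" (is "c = ?c")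
      for c :: 'k
    proof -
      have "to_complex (c - ?c) = 0"
        by (simp add: to_complex_diff to_complex_add to_complex_mult i complex_eq_iff)
      then have "norm (c - ?c) = 0" by (metis norm_to_complex norm_zero)
      then show ?thesis by simp
    qed
    define f where "f x = (if x \<in> X then of_real (F x) - \<iota> * of_real (F (sc \<iota> x)) else 0)" for x
    have f_add: "f (x + y) = f x + f y" if "x \<in> X" "y \<in> X" for x y
      using that add_mem sc_mem by (simp add: f_def vs.scale_right_distrib add algebra_simps)
    have f_real: "f (sc (of_real r) x) = of_real r * f x" if "x \<in> X" for r x
    proof -
      have "sc \<iota> (r *\<^sub>R x) = r *\<^sub>R sc \<iota> x"
        by (metis sc_of_real vs.scale_left_commute)
      then show ?thesis
        using that scaleR_mem sc_mem by (simp add: f_def sc_of_real scale algebra_simps)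
    qed
    have f_i: "f (sc \<iota> x) = \<iota> * f x" if x: "x \<in> X" for x
    proof -
      have "sc \<iota> (sc \<iota> x) = (-1) *\<^sub>R x"
        using i(1) sc_of_real[of "-1" x] by simp
      moreover have "F ((-1) *\<^sub>R x) = (-1) * F x" using x by (rule scale)
      moreover have "\<iota> * (\<iota> * b) = - b" for b using i(1) by (simp flip: mult.assoc)
      ultimately show ?thesis using x sc_mem by (simp add: f_def right_diff_distrib)
    qed
    have "f \<in> dual sc X"
    proof (rule dualI)
      fix c :: 'k and x assume x: "x \<in> X"
      let ?a = "of_real (Re (to_complex c)) :: 'k" and ?b = "of_real (Im (to_complex c)) :: 'k"
      have "sc c x = sc ?a x + sc ?b (sc \<iota> x)"
        by (subst c_eq) (simp add: vs.scale_left_distrib)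
      then have "f (sc c x) = ?a * f x + ?b * (\<iota> * f x)"
        using x sc_mem f_add f_real f_i by (simp del: vs.scale_scale)
      also have "\<dots> = c * f x"
        by (subst (3) c_eq) (simp add: algebra_simps)
      finally show "f (sc c x) = c * f x" .
    next
      fix x assume x: "x \<in> X"
      have "norm (f x) \<le> \<bar>F x\<bar> + norm \<iota> * \<bar>F (sc \<iota> x)\<bar>"
        using x norm_triangle_ineq4[of "of_real (F x)" "\<iota> * of_real (F (sc \<iota> x))"]
        by (simp add: f_def norm_mult)
      also have "norm \<iota> = 1" by (metis i(2) norm_ii norm_to_complex)
      finally show "norm (f x) \<le> (2 * M) * norm x"
        using abs_bound[OF x] abs_bound[OF sc_mem[OF x, of \<iota>]] \<open>norm \<iota> = 1\<close> by (simp add: norm_sc)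
    qed (auto simp: f_add, simp add: f_def)
    moreover have "re (f x) = F x" if "x \<in> X" for x
      using that by (simp add: f_def re_def to_complex_mult to_complex_diff i)
    ultimately show ?thesis by blast
  qed
  then obtain f where f: "f \<in> dual sc X" "\<And>x. x \<in> X \<Longrightarrow> re (f x) = F x" by blast
  have "norm (f x) \<le> M * norm x" if "x \<in> X" for x
    using f bound that by (intro norm_le_if_re_le) auto
  then have "dual_norm X f \<le> M" using M by (intro dual_norm_le_mult) auto
  with f show ?thesis using that by blast
qed

end

lemma real_functional_scalar:
  fixes F :: "'k::rc_scalar \<Rightarrow> real"
  assumes "linear F" "\<And>x. \<bar>F x\<bar> \<le> M * norm x" "0 \<le> M"
  obtains \<beta> where "\<And>x. F x = re (\<beta> * x)"
proof -
  have vs: "vector_space ((*) :: 'k \<Rightarrow> 'k \<Rightarrow> 'k)"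
    by standard (auto simp: algebra_simps)
  interpret normed_subspace "(*) :: 'k \<Rightarrow> 'k \<Rightarrow> 'k" UNIV
  proof
    show "normed_space_over ((*) :: 'k \<Rightarrow> 'k \<Rightarrow> 'k)"
      unfolding normed_space_over_def
      using vs by (simp add: scaleR_conv_of_real norm_mult)
    show "module.subspace ((*) :: 'k \<Rightarrow> 'k \<Rightarrow> 'k) UNIV"
      using vs by (simp add: module.subspace_UNIV module_iff_vector_space)
  qed
  obtain f where f: "f \<in> dual (*) UNIV" "\<And>x. re (f x) = F x"
  proof (rule dual_of_real_functional[of F M])
    show "F x \<le> M * norm x" for x using assms(2)[of x] by simp
  qed (use assms in \<open>auto simp: linear_add linear_scale\<close>)
  have "F x = re (f 1 * x)" for x
    using dual_sc[OF f(1), of 1 x] f(2)[of x] by (simp add: mult.commute)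
  then show ?thesis using that by blast
qed

section \<open>Approximating elements of the bidual\<close>

definition bidual_linear :: "('k::rc_scalar \<Rightarrow> 'v::real_normed_vector \<Rightarrow> 'v) \<Rightarrow> 'v set \<Rightarrow>
    (('v \<Rightarrow> 'k) \<Rightarrow> 'k) \<Rightarrow> bool" where
  "bidual_linear sc X \<omega> \<longleftrightarrow>
     (\<forall>f\<in>dual sc X. \<forall>g\<in>dual sc X. \<omega> (\<lambda>x. f x + g x) = \<omega> f + \<omega> g) \<and>
     (\<forall>c. \<forall>f\<in>dual sc X. \<omega> (\<lambda>x. c * f x) = c * \<omega> f)"

text \<open>By the Hahn-Banach theorem this says, for convex \<open>C\<close>, that \<open>\<omega>\<close> lies in the
  \<open>\<sigma>(X**, X*)\<close>-closure of \<open>C\<close>.\<close>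

definition adherent :: "('k::rc_scalar \<Rightarrow> 'v::real_normed_vector \<Rightarrow> 'v) \<Rightarrow> 'v set \<Rightarrow>
    'v set \<Rightarrow> (('v \<Rightarrow> 'k) \<Rightarrow> 'k) \<Rightarrow> bool" where
  "adherent sc X C \<omega> \<longleftrightarrow> C \<subseteq> X \<and> convex C \<and>
     (\<forall>h\<in>dual sc X. \<forall>d>0. \<exists>u\<in>C. re (\<omega> h) - d < re (h u))"

lemma adherentD:
  assumes "adherent sc X C \<omega>" "h \<in> dual sc X" "0 < d"
  obtains u where "u \<in> C" "re (\<omega> h) - d < re (h u)"
  using assms unfolding adherent_def by blast

context normed_subspace
begin

text \<open>In terms of adherence, Goldstine's theorem is just the definition of the dual norm.\<close>

lemma adherent_ball:
  assumes "\<And>h. h \<in> dual sc X \<Longrightarrow> norm (\<omega> h) \<le> r * dual_norm X h" "0 \<le> r"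
  shows "adherent sc X {u \<in> X. norm u \<le> r} \<omega>"
  unfolding adherent_def
proof (intro conjI ballI allI impI)
  have "{u \<in> X. norm u \<le> r} = X \<inter> cball 0 r" by auto
  then show "convex {u \<in> X. norm u \<le> r}" by (simp add: convex_Int convex_X)
  fix h and d :: real assume h: "h \<in> dual sc X" and d: "0 < d"
  have "0 < d / (r + 1)" using d assms(2) by simp
  then obtain u where u: "u \<in> X" "norm u \<le> 1" "dual_norm X h - d / (r + 1) < re (h u)"
    by (rule dual_norm_approx[OF h])
  have "re (\<omega> h) \<le> r * dual_norm X h" using assms(1)[OF h] re_le[of "\<omega> h"] by linarith
  also have "\<dots> \<le> r * (re (h u) + d / (r + 1))" using u assms(2) by (intro mult_left_mono) auto
  also have "\<dots> < r * re (h u) + d" using d assms(2) by (simp add: field_simps)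
  also have "r * re (h u) = re (h (r *\<^sub>R u))" using h u by (simp add: dual_scaleR)
  finally show "\<exists>u\<in>{u \<in> X. norm u \<le> r}. re (\<omega> h) - d < re (h u)"
    using u assms(2) mult_left_mono[of "norm u" 1 r] by (intro bexI[of _ "r *\<^sub>R u"]) auto
qed auto

text \<open>Approximating \<open>\<omega>\<close> at \<open>f\<close> and at a further functional \<open>h\<close> is a question about the convex subset
  \<open>{(f u, h u) | u \<in> C}\<close> of a plane; a functional on the plane that separates \<open>(\<omega> f, \<omega> h)\<close> from it is
  a linear combination of \<open>f\<close> and \<open>h\<close> that violates adherence. So finitely many values of \<open>\<omega>\<close> can
  be approximated one after the other.\<close>

lemma adherent_strip:
  assumes C: "adherent sc X C \<omega>" and \<omega>: "bidual_linear sc X \<omega>"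
    and f: "f \<in> dual sc X" and d: "0 < d"
  shows "adherent sc X {u \<in> C. norm (f u - \<omega> f) < d} \<omega>"
  unfolding adherent_def
proof (intro conjI ballI allI impI)
  have CX: "C \<subseteq> X" and conv: "convex C" using C by (auto simp: adherent_def)
  then show "{u \<in> C. norm (f u - \<omega> f) < d} \<subseteq> X" by auto
  have image_conv: "f (a *\<^sub>R u + b *\<^sub>R v) = a *\<^sub>R f u + b *\<^sub>R f v"
    if "f \<in> dual sc X" "u \<in> C" "v \<in> C" for f a b u v
    using that CX by (simp add: dual_add dual_scaleR scaleR_conv_of_real scaleR_mem subset_iff)
  show "convex {u \<in> C. norm (f u - \<omega> f) < d}"
  proof (rule convexI)
    fix u v and a b :: real
    assume uv: "u \<in> {u \<in> C. norm (f u - \<omega> f) < d}" "v \<in> {u \<in> C. norm (f u - \<omega> f) < d}"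
      and ab: "0 \<le> a" "0 \<le> b" "a + b = 1"
    have "f u \<in> ball (\<omega> f) d" "f v \<in> ball (\<omega> f) d"
      using uv by (auto simp: dist_norm norm_minus_commute)
    then have "a *\<^sub>R f u + b *\<^sub>R f v \<in> ball (\<omega> f) d"
      using ab by (intro convexD[OF convex_ball])
    then show "a *\<^sub>R u + b *\<^sub>R v \<in> {u \<in> C. norm (f u - \<omega> f) < d}"
      using uv ab f image_conv convexD[OF conv] by (auto simp: dist_norm norm_minus_commute)
  qed
  fix h and e :: real assume h: "h \<in> dual sc X" and e: "0 < e"
  let ?D = "(\<lambda>u. (f u, h u)) ` C"
  have "(\<omega> f, \<omega> h) \<in> closure ?D"
  proof (rule ccontr)
    assume "(\<omega> f, \<omega> h) \<notin> closure ?D"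
    moreover have "convex ?D"
    proof (rule convexI)
      fix p q and a b :: real
      assume "p \<in> ?D" "q \<in> ?D" "0 \<le> a" "0 \<le> b" "a + b = 1"
      then obtain u v where "u \<in> C" "v \<in> C" "p = (f u, h u)" "q = (f v, h v)"
        and ab: "0 \<le> a" "0 \<le> b" "a + b = 1" by auto
      then show "a *\<^sub>R p + b *\<^sub>R q \<in> ?D"
        using convexD[OF conv _ _ ab, of u v] f h
        by (intro image_eqI[of _ _ "a *\<^sub>R u + b *\<^sub>R v"]) (auto simp: image_conv)
    qed
    ultimately obtain F d' where F: "linear F" "\<And>x. \<bar>F x\<bar> \<le> norm x" "0 < d'"
      "\<And>c. c \<in> ?D \<Longrightarrow> F c + d' \<le> F (\<omega> f, \<omega> h)"
      using separation_from_convex[of ?D "(\<omega> f, \<omega> h)"] by blast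
    obtain \<beta> where \<beta>: "\<And>x. F (x, 0) = re (\<beta> * x)"
    proof (rule real_functional_scalar)
      show "linear (\<lambda>x. F (x, 0))"
        using linear_compose[OF _ F(1), of "\<lambda>x. (x, 0)"] by (simp add: linear_iff o_def)
      show "\<bar>F (x, 0)\<bar> \<le> 1 * norm x" for x using F(2)[of "(x, 0)"] by (simp add: norm_Pair)
    qed auto
    obtain \<gamma> where \<gamma>: "\<And>x. F (0, x) = re (\<gamma> * x)"
    proof (rule real_functional_scalar)
      show "linear (\<lambda>x. F (0, x))"
        using linear_compose[OF _ F(1), of "\<lambda>x. (0, x)"] by (simp add: linear_iff o_def)
      show "\<bar>F (0, x)\<bar> \<le> 1 * norm x" for x using F(2)[of "(0, x)"] by (simp add: norm_Pair)
    qed auto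
    have F_eq: "F (x, y) = re (\<beta> * x + \<gamma> * y)" for x y
      using linear_add[OF F(1), of "(x, 0)" "(0, y)"] by (simp add: \<beta> \<gamma>)
    let ?k = "\<lambda>x. \<beta> * f x + \<gamma> * h x"
    have k: "?k \<in> dual sc X" using f h by auto
    have "\<omega> ?k = \<beta> * \<omega> f + \<gamma> * \<omega> h"
      using \<omega> f h dual_cmult unfolding bidual_linear_def by simp
    moreover obtain u where "u \<in> C" "re (\<omega> ?k) - d' < re (?k u)"
      by (rule adherentD[OF C k F(3)])
    ultimately show False using F(4)[of "(f u, h u)"] by (auto simp: F_eq)
  qed
  then obtain u where u: "u \<in> C" "dist (f u, h u) (\<omega> f, \<omega> h) < min d e"
    using d e unfolding closure_approachable by (auto dest!: spec[of _ "min d e"])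
  have "dist (f u) (\<omega> f) < d" "dist (h u) (\<omega> h) < e"
    using u(2) dist_fst_le[of "(f u, h u)" "(\<omega> f, \<omega> h)"] dist_snd_le[of "(f u, h u)" "(\<omega> f, \<omega> h)"]
    by auto
  then show "\<exists>u\<in>{u \<in> C. norm (f u - \<omega> f) < d}. re (\<omega> h) - e < re (h u)"
    using u(1) abs_re_le[of "h u - \<omega> h"] by (intro bexI[of _ u]) (auto simp: dist_norm)
qed

text \<open>A weak form of the principle of local reflexivity: the distance of \<open>\<omega>\<close> to a point of \<open>X\<close>
  can be kept under control when \<open>\<omega>\<close> is approximated. If \<open>(x, \<omega> h)\<close> were separated from the
  convex set of all \<open>(u + v, h u)\<close> with \<open>u \<in> C\<close> and \<open>\<parallel>v\<parallel> \<le> r\<close> by a pair \<open>(k, \<beta>)\<close>, evaluating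
  \<open>\<omega>\<close> at \<open>k + \<beta> h\<close> would contradict adherence.\<close>

lemma adherent_near:
  assumes C: "adherent sc X C \<omega>" and \<omega>: "bidual_linear sc X \<omega>" and x: "x \<in> X"
    and r: "\<And>h. h \<in> dual sc X \<Longrightarrow> norm (\<omega> h - h x) \<le> r * dual_norm X h" "0 \<le> r"
    and d: "0 < d"
  shows "adherent sc X {u \<in> C. norm (u - x) \<le> r + d} \<omega>"
  unfolding adherent_def
proof (intro conjI ballI allI impI)
  have CX: "C \<subseteq> X" and conv: "convex C" using C by (auto simp: adherent_def)
  then show "{u \<in> C. norm (u - x) \<le> r + d} \<subseteq> X" by auto
  have "{u \<in> C. norm (u - x) \<le> r + d} = C \<inter> cball x (r + d)"
    by (auto simp: dist_norm norm_minus_commute)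
  then show "convex {u \<in> C. norm (u - x) \<le> r + d}" by (simp add: convex_Int conv)
  fix h and e :: real assume h: "h \<in> dual sc X" and e: "0 < e"
  let ?B = "{v \<in> X. norm v \<le> r}"
  have "?B = X \<inter> cball 0 r" by auto
  then have convB: "convex ?B" by (simp add: convex_Int convex_X)
  let ?D = "(\<lambda>(u, v). (u + v, h u)) ` (C \<times> ?B)"
  have "(x, \<omega> h) \<in> closure ?D"
  proof (rule ccontr)
    assume "(x, \<omega> h) \<notin> closure ?D"
    moreover have "convex ?D"
    proof (rule convexI)
      fix p q and a b :: real
      assume "p \<in> ?D" "q \<in> ?D" and ab: "0 \<le> a" "0 \<le> b" "a + b = 1"
      then obtain u u' v v' where uv: "u \<in> C" "u' \<in> C" "v \<in> ?B" "v' \<in> ?B"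
        and pq: "p = (u + v, h u)" "q = (u' + v', h u')" by auto
      have "a *\<^sub>R p + b *\<^sub>R q = (\<lambda>(u, v). (u + v, h u)) (a *\<^sub>R u + b *\<^sub>R u', a *\<^sub>R v + b *\<^sub>R v')"
        using uv CX h by (simp add: pq dual_add dual_scaleR scaleR_mem subset_iff
            scaleR_conv_of_real scaleR_add_right)
      moreover have "a *\<^sub>R u + b *\<^sub>R u' \<in> C" "a *\<^sub>R v + b *\<^sub>R v' \<in> ?B"
        using uv ab convexD[OF conv] convexD[OF convB] by blast+
      ultimately show "a *\<^sub>R p + b *\<^sub>R q \<in> ?D" by blast
    qed
    ultimately obtain F d' where F: "linear F" "\<And>x. \<bar>F x\<bar> \<le> norm x" "0 < d'"
      "\<And>c. c \<in> ?D \<Longrightarrow> F c + d' \<le> F (x, \<omega> h)"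
      using separation_from_convex[of ?D "(x, \<omega> h)"] by blast
    have lin: "linear (\<lambda>y. F (y, 0))"
      using linear_compose[OF _ F(1), of "\<lambda>x. (x, 0)"] by (simp add: linear_iff o_def)
    obtain k where k: "k \<in> dual sc X" "\<And>y. y \<in> X \<Longrightarrow> re (k y) = F (y, 0)"
    proof (rule dual_of_real_functional[of "\<lambda>y. F (y, 0)" 1])
      show "F (y, 0) \<le> 1 * norm y" for y using F(2)[of "(y, 0)"] by (simp add: norm_Pair)
      show "F (y + z, 0) = F (y, 0) + F (z, 0)" for y z
        using linear_add[OF lin] .
      show "F (a *\<^sub>R y, 0) = a * F (y, 0)" for a y
        using linear_scale[OF lin] by simp
    qed auto
    obtain \<beta> where \<beta>: "\<And>x. F (0, x) = re (\<beta> * x)"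
    proof (rule real_functional_scalar)
      show "linear (\<lambda>x. F (0, x))"
        using linear_compose[OF _ F(1), of "\<lambda>x. (0, x)"] by (simp add: linear_iff o_def)
      show "\<bar>F (0, x)\<bar> \<le> 1 * norm x" for x using F(2)[of "(0, x)"] by (simp add: norm_Pair)
    qed auto
    have F_eq: "F (y, b) = re (k y + \<beta> * b)" if "y \<in> X" for y b
      using linear_add[OF F(1), of "(y, 0)" "(0, b)"] that by (simp add: k \<beta>)
    let ?k = "\<lambda>x. k x + \<beta> * h x"
    have k': "?k \<in> dual sc X" using k h by auto
    have \<omega>k: "\<omega> ?k = \<omega> k + \<beta> * \<omega> h"
      using \<omega> k(1) h dual_cmult unfolding bidual_linear_def by simp
    have "0 < d' / 2" using F(3) by simp
    then obtain u where u: "u \<in> C" "re (\<omega> ?k) - d' / 2 < re (?k u)"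
      by (rule adherentD[OF C k'])
    define q where "q = d' / (2 * (r + 1))"
    have q: "0 < q" "r * q < d' / 2" using F(3) r(2) by (simp_all add: q_def field_simps)
    obtain v where v: "v \<in> X" "norm v \<le> 1" "dual_norm X k - q < re (k v)"
      by (rule dual_norm_approx[OF k(1) q(1)])
    have rv: "r *\<^sub>R v \<in> ?B" using v r(2) mult_left_mono[of "norm v" 1 r] by auto
    have "r * (dual_norm X k - q) \<le> r * re (k v)"
      using v(3) r(2) by (intro mult_left_mono) auto
    then have "r * dual_norm X k - r * q \<le> r * re (k v)" by (simp add: right_diff_distrib)
    moreover have "re (k (r *\<^sub>R v)) = r * re (k v)" using k v by (simp add: dual_scaleR)
    moreover have "re (k x) - re (\<omega> k) \<le> r * dual_norm X k"
      using r(1)[OF k(1)] abs_re_le[of "\<omega> k - k x"] by simp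
    moreover have "F (u + r *\<^sub>R v, h u) + d' \<le> F (x, \<omega> h)"
      using u rv by (intro F(4) image_eqI[of _ _ "(u, r *\<^sub>R v)"]) auto
    then have "re (k u) + re (k (r *\<^sub>R v)) + re (\<beta> * h u) + d' \<le> re (k x) + re (\<beta> * \<omega> h)"
      using u(1) CX v(1) x k(1) by (simp add: F_eq dual_add add_mem scaleR_mem subset_iff)
    ultimately show False using u(2) q(2) by (simp add: \<omega>k)
  qed
  then obtain p where "p \<in> ?D" "dist p (x, \<omega> h) < min d e"
    using d e unfolding closure_approachable by (meson min_less_iff_conj)
  then obtain u v where uv: "u \<in> C" "norm v \<le> r" "dist (u + v, h u) (x, \<omega> h) < min d e"
    by auto
  have 1: "dist (u + v) x < d" "dist (h u) (\<omega> h) < e"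
    using uv(3) dist_fst_le[of "(u + v, h u)" "(x, \<omega> h)"] dist_snd_le[of "(u + v, h u)" "(x, \<omega> h)"]
    by auto
  have "norm (u - x) \<le> norm (u + v - x) + norm v"
    using norm_triangle_ineq4[of "u + v - x" v] by simp
  then have "norm (u - x) \<le> r + d" using 1(1) uv(2) by (simp add: dist_norm)
  then show "\<exists>u\<in>{u \<in> C. norm (u - x) \<le> r + d}. re (\<omega> h) - e < re (h u)"
    using uv(1) 1(2) abs_re_le[of "h u - \<omega> h"] by (intro bexI[of _ u]) (auto simp: dist_norm)
qed

end

section \<open>Points normed by an L-summand of the dual\<close>

definition L_projection :: "('k::rc_scalar \<Rightarrow> 'v::real_normed_vector \<Rightarrow> 'v) \<Rightarrow> 'v set \<Rightarrow>
    (('v \<Rightarrow> 'k) \<Rightarrow> ('v \<Rightarrow> 'k)) \<Rightarrow> bool" where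
  "L_projection sc X P \<longleftrightarrow>
     (\<forall>f\<in>dual sc X. P f \<in> dual sc X \<and> P (P f) = P f) \<and>
     (\<forall>f\<in>dual sc X. \<forall>g\<in>dual sc X. P (\<lambda>x. f x + g x) = (\<lambda>x. P f x + P g x)) \<and>
     (\<forall>c. \<forall>f\<in>dual sc X. P (\<lambda>x. c * f x) = (\<lambda>x. c * P f x)) \<and>
     (\<forall>f\<in>dual sc X. dual_norm X f = dual_norm X (P f) + dual_norm X (\<lambda>x. f x - P f x))"

text \<open>The norm of \<open>x\<close> as a functional on the range of \<open>P\<close>.\<close>

definition summand_norm :: "('k::rc_scalar \<Rightarrow> 'v::real_normed_vector \<Rightarrow> 'v) \<Rightarrow> 'v set \<Rightarrow>
    (('v \<Rightarrow> 'k) \<Rightarrow> ('v \<Rightarrow> 'k)) \<Rightarrow> 'v \<Rightarrow> real" where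
  "summand_norm sc X P x = (SUP f\<in>{f \<in> dual sc X. P f = f \<and> dual_norm X f \<le> 1}. norm (f x))"

text \<open>With respect to the decomposition \<open>X** = L* \<oplus> M*\<close> dual to \<open>X* = L \<oplus> M\<close>, this is the element
  of the bidual that has the \<open>L*\<close>-component of \<open>w\<close> and the \<open>M*\<close>-component of \<open>z\<close>.\<close>

definition mixed :: "(('v \<Rightarrow> 'k::rc_scalar) \<Rightarrow> ('v \<Rightarrow> 'k)) \<Rightarrow> 'v \<Rightarrow> 'v \<Rightarrow> ('v \<Rightarrow> 'k) \<Rightarrow> 'k" where
  "mixed P w z f = P f w + (f z - P f z)"

locale rc_banach = normed_subspace +
  assumes complete: "complete X"

locale L_projected = rc_banach +
  fixes P
  assumes P: "L_projection sc X P"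
begin

lemma P_dual: "f \<in> dual sc X \<Longrightarrow> P f \<in> dual sc X"
  and P_idem: "f \<in> dual sc X \<Longrightarrow> P (P f) = P f"
  and P_add: "f \<in> dual sc X \<Longrightarrow> g \<in> dual sc X \<Longrightarrow> P (\<lambda>x. f x + g x) = (\<lambda>x. P f x + P g x)"
  and P_cmult: "f \<in> dual sc X \<Longrightarrow> P (\<lambda>x. c * f x) = (\<lambda>x. c * P f x)"
  and P_norm: "f \<in> dual sc X \<Longrightarrow>
      dual_norm X f = dual_norm X (P f) + dual_norm X (\<lambda>x. f x - P f x)"
  using P unfolding L_projection_def by blast+

abbreviation snorm where "snorm \<equiv> summand_norm sc X P"

lemma P_zero: "P (\<lambda>x. 0) = (\<lambda>x. 0)"
  using P_cmult[OF dual_zero, of 0] by simp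

lemma snorm_bdd:
  assumes "x \<in> X"
  shows "bdd_above ((\<lambda>f. norm (f x)) ` {f \<in> dual sc X. P f = f \<and> dual_norm X f \<le> 1})"
proof (rule bdd_aboveI2)
  fix f assume f: "f \<in> {f \<in> dual sc X. P f = f \<and> dual_norm X f \<le> 1}"
  then have "norm (f x) \<le> dual_norm X f * norm x" using assms by (intro norm_le_dual_norm) auto
  also have "\<dots> \<le> 1 * norm x" using f by (intro mult_right_mono) auto
  finally show "norm (f x) \<le> norm x" by simp
qed

lemma snorm_upper:
  "f \<in> dual sc X \<Longrightarrow> P f = f \<Longrightarrow> dual_norm X f \<le> 1 \<Longrightarrow> x \<in> X \<Longrightarrow> norm (f x) \<le> snorm x"
  unfolding summand_norm_def by (intro cSUP_upper snorm_bdd) auto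

lemma zero_in_summand: "(\<lambda>x. 0) \<in> {f \<in> dual sc X. P f = f \<and> dual_norm X f \<le> 1}"
  by (auto simp: P_zero)

lemma snorm_least:
  assumes "\<And>f. f \<in> dual sc X \<Longrightarrow> P f = f \<Longrightarrow> dual_norm X f \<le> 1 \<Longrightarrow> norm (f x) \<le> c"
  shows "snorm x \<le> c"
  unfolding summand_norm_def by (rule cSUP_least) (use zero_in_summand assms in auto)

lemma snorm_approx:
  assumes "x \<in> X" "0 < d"
  obtains f where "f \<in> dual sc X" "P f = f" "dual_norm X f \<le> 1" "snorm x - d < norm (f x)"
proof -
  have "\<exists>f\<in>{f \<in> dual sc X. P f = f \<and> dual_norm X f \<le> 1}. snorm x - d < norm (f x)"
    unfolding summand_norm_def
    by (subst less_cSUP_iff[symmetric]) (use assms zero_in_summand snorm_bdd in auto)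
  then show ?thesis using that by blast
qed

lemma snorm_nonneg: "x \<in> X \<Longrightarrow> 0 \<le> snorm x"
  using snorm_upper[of "\<lambda>x. 0" x] by (auto simp: P_zero)

lemma snorm_le_norm: "x \<in> X \<Longrightarrow> snorm x \<le> norm x"
proof (rule snorm_least)
  fix f assume "x \<in> X" "f \<in> dual sc X" "dual_norm X f \<le> 1"
  then show "norm (f x) \<le> norm x"
    using norm_le_dual_norm[of f x] mult_right_mono[of "dual_norm X f" 1 "norm x"] by simp
qed

lemma norm_le_snorm:
  assumes f: "f \<in> dual sc X" and Pf: "P f = f" and x: "x \<in> X"
  shows "norm (f x) \<le> dual_norm X f * snorm x"
proof (cases "dual_norm X f = 0")
  case True
  then show ?thesis using dual_norm_eq_0D[OF f] by simp
next
  case False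
  let ?c = "of_real (1 / dual_norm X f) :: 'a"
  have pos: "0 < dual_norm X f" using False dual_norm_nonneg[OF f] by simp
  have "norm (?c * f x) \<le> snorm x"
  proof (rule snorm_upper[of "\<lambda>x. ?c * f x"])
    show "P (\<lambda>x. ?c * f x) = (\<lambda>x. ?c * f x)" using P_cmult[OF f, of ?c] Pf by metis
    show "dual_norm X (\<lambda>x. ?c * f x) \<le> 1"
      unfolding dual_norm_cmult[OF f] using pos by (simp add: norm_divide)
    show "(\<lambda>x. ?c * f x) \<in> dual sc X" using f by (rule dual_cmult)
  qed (use x in auto)
  then show ?thesis using pos by (simp add: norm_mult norm_divide field_simps)
qed

lemma snorm_triangle:
  assumes "x \<in> X" "y \<in> X"
  shows "snorm (x + y) \<le> snorm x + snorm y"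
proof (rule snorm_least)
  fix f assume f: "f \<in> dual sc X" "P f = f" "dual_norm X f \<le> 1"
  have "norm (f (x + y)) \<le> norm (f x) + norm (f y)"
    using f assms by (simp add: dual_add norm_triangle_ineq)
  then show "norm (f (x + y)) \<le> snorm x + snorm y"
    using snorm_upper[OF f assms(1)] snorm_upper[OF f assms(2)] by linarith
qed

lemma snorm_scaleR:
  assumes x: "x \<in> X"
  shows "snorm (r *\<^sub>R x) = \<bar>r\<bar> * snorm x"
proof -
  have le: "snorm (r *\<^sub>R x) \<le> \<bar>r\<bar> * snorm x" if "x \<in> X" for r x
    using that by (intro snorm_least)
      (auto simp: dual_scaleR norm_mult intro!: mult_left_mono snorm_upper)
  show ?thesis
  proof (cases "r = 0")
    case True
    then show ?thesis using le[OF x, of 0] snorm_nonneg[of 0] by simp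
  next
    case False
    have "snorm x \<le> \<bar>1 / r\<bar> * snorm (r *\<^sub>R x)"
      using le[OF scaleR_mem[OF x, of r], of "1 / r"] False by simp
    then have "\<bar>r\<bar> * snorm x \<le> snorm (r *\<^sub>R x)" using False by (simp add: field_simps)
    then show ?thesis using le[OF x, of r] by simp
  qed
qed

lemma snorm_lipschitz:
  assumes "x \<in> X" "y \<in> X"
  shows "\<bar>snorm x - snorm y\<bar> \<le> norm (x - y)"
proof -
  have "snorm x \<le> snorm y + norm (x - y)" if "x \<in> X" "y \<in> X" for x y
    using snorm_triangle[of y "x - y"] snorm_le_norm[of "x - y"] that by (auto simp: diff_mem)
  from this[OF assms] this[OF assms(2,1)] show ?thesis
    by (simp add: norm_minus_commute abs_le_iff)
qed

lemma bidual_linear_mixed: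
  assumes "w \<in> X" "z \<in> X"
  shows "bidual_linear sc X (mixed P w z)"
  unfolding bidual_linear_def mixed_def by (auto simp: P_add P_cmult algebra_simps)

lemma norm_mixed_le:
  assumes w: "w \<in> X" "snorm w \<le> r" and z: "z \<in> X" "norm z \<le> r" and f: "f \<in> dual sc X"
  shows "norm (mixed P w z f) \<le> r * dual_norm X f"
proof -
  have "norm (P f w) \<le> dual_norm X (P f) * snorm w"
    using P_dual[OF f] P_idem[OF f] w by (intro norm_le_snorm)
  also have "\<dots> \<le> dual_norm X (P f) * r"
    using w by (intro mult_left_mono dual_norm_nonneg P_dual f)
  finally have 1: "norm (P f w) \<le> dual_norm X (P f) * r" .
  have d: "(\<lambda>x. f x - P f x) \<in> dual sc X" using f P_dual by blast
  have "norm (f z - P f z) \<le> dual_norm X (\<lambda>x. f x - P f x) * norm z"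
    using norm_le_dual_norm[OF d z(1)] .
  also have "\<dots> \<le> dual_norm X (\<lambda>x. f x - P f x) * r"
    using z by (intro mult_left_mono dual_norm_nonneg d)
  finally have "norm (mixed P w z f) \<le> dual_norm X (P f) * r + dual_norm X (\<lambda>x. f x - P f x) * r"
    using 1 norm_triangle_ineq[of "P f w" "f z - P f z"] by (simp add: mixed_def)
  then show ?thesis by (simp add: P_norm[OF f] algebra_simps)
qed

text \<open>Dividing by the summand norm costs little when that norm is almost 1; exactness of the summand
  norm is what the following two lemmas preserve.\<close>

lemma normalise_almost_normed:
  assumes u: "u \<in> X" "norm u \<le> 1 + e" and s: "1 - d < snorm u" "snorm u \<le> 1"
    and d: "0 < d" "d \<le> 1 / 2" and e: "0 \<le> e" "e \<le> 1"
  shows "snorm ((1 / snorm u) *\<^sub>R u) = 1" "norm ((1 / snorm u) *\<^sub>R u) \<le> (1 + e) * (1 + 2 * d)"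
    "norm ((1 / snorm u) *\<^sub>R u - u) \<le> 4 * d"
proof -
  have pos: "1 / 2 < snorm u" using s d by linarith
  then show "snorm ((1 / snorm u) *\<^sub>R u) = 1" using u by (simp add: snorm_scaleR)
  have "(1 - d) * (1 + 2 * d) = 1 + d * (1 - 2 * d)" by (simp add: algebra_simps)
  also have "\<dots> \<ge> 1" using d by simp
  finally have "1 \<le> (1 - d) * (1 + 2 * d)" .
  also have "\<dots> \<le> snorm u * (1 + 2 * d)" using s d by (intro mult_right_mono) auto
  finally have inv: "1 / snorm u \<le> 1 + 2 * d" using pos by (simp add: field_simps)
  have "(1 / snorm u) * norm u \<le> (1 + 2 * d) * (1 + e)"
    using inv u pos d by (intro mult_mono) auto
  then show "norm ((1 / snorm u) *\<^sub>R u) \<le> (1 + e) * (1 + 2 * d)"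
    using pos by (simp add: mult.commute)
  have "1 \<le> 1 / snorm u" using pos s by (simp add: field_simps)
  then have "\<bar>1 / snorm u - 1\<bar> \<le> 2 * d" using inv by simp
  then have "\<bar>1 / snorm u - 1\<bar> * norm u \<le> (2 * d) * 2" using u e d by (intro mult_mono) auto
  moreover have "(1 / snorm u) *\<^sub>R u - u = (1 / snorm u - 1) *\<^sub>R u"
    by (simp add: scaleR_left_diff_distrib)
  ultimately show "norm ((1 / snorm u) *\<^sub>R u - u) \<le> 4 * d" by simp
qed

text \<open>In the bidual, \<open>x\<close> is close to the element of norm at most 1 that agrees with \<open>x\<close> on the
  summand and with \<open>x / (1 + \<epsilon>)\<close> on the complement; local reflexivity brings it back to \<open>X\<close>.\<close>

lemma improve_normed_point:
  assumes x: "x \<in> X" "snorm x = 1" "norm x \<le> 1 + e" and e: "0 < e" "e \<le> 1"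
  obtains x' where "x' \<in> X" "snorm x' = 1" "norm x' \<le> 1 + e / 2" "norm (x' - x) \<le> 3 * e"
proof -
  define d where "d = e / 8"
  have d: "0 < d" "d \<le> 1 / 4" using e by (auto simp: d_def)
  define z where "z = (1 / (1 + e)) *\<^sub>R x"
  have z: "z \<in> X" "norm z \<le> 1" using x e by (auto simp: z_def field_simps)
  have xz: "norm (x - z) \<le> e"
  proof -
    have "x - z = (1 - 1 / (1 + e)) *\<^sub>R x" by (simp add: z_def scaleR_left_diff_distrib)
    also have "1 - 1 / (1 + e) = e / (1 + e)" using e by (simp add: field_simps)
    finally have "norm (x - z) = e / (1 + e) * norm x" using e by simp
    also have "\<dots> \<le> e / (1 + e) * (1 + e)" using x e by (intro mult_left_mono) auto
    finally show ?thesis using e by simp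
  qed
  let ?w = "mixed P x z"
  have "adherent sc X {u \<in> X. norm u \<le> 1} ?w"
    using x z by (intro adherent_ball norm_mixed_le) auto
  then have adh: "adherent sc X {u \<in> {u \<in> X. norm u \<le> 1}. norm (u - x) \<le> e + d} ?w"
  proof (rule adherent_near)
    fix h assume h: "h \<in> dual sc X"
    have dh: "(\<lambda>y. h y - P h y) \<in> dual sc X" using h P_dual by blast
    have "?w h - h x = - (h (x - z) - P h (x - z))"
      using h x z P_dual[OF h] by (simp add: mixed_def dual_diff)
    then have "norm (?w h - h x) \<le> dual_norm X (\<lambda>y. h y - P h y) * norm (x - z)"
      using norm_le_dual_norm[OF dh diff_mem[OF x(1) z(1)]] by (simp only: norm_minus_cancel)
    also have "\<dots> \<le> dual_norm X h * e"
      using xz P_norm[OF h] dual_norm_nonneg[OF P_dual[OF h]] dual_norm_nonneg[OF h]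
      by (intro mult_mono) auto
    finally show "norm (?w h - h x) \<le> e * dual_norm X h" by (simp add: mult.commute)
  qed (use x z d e bidual_linear_mixed in auto)
  obtain f where f: "f \<in> dual sc X" "P f = f" "dual_norm X f \<le> 1" "snorm x - d < norm (f x)"
    using snorm_approx[OF x(1) d(1)] .
  obtain \<theta> where \<theta>: "norm \<theta> = 1" "\<theta> * f x = of_real (norm (f x))" using obtain_rotation by blast
  let ?g = "\<lambda>y. \<theta> * f y"
  have g: "?g \<in> dual sc X" using f by blast
  have "?w ?g = \<theta> * f x" using f by (simp add: mixed_def P_cmult)
  moreover obtain u where u: "u \<in> X" "norm u \<le> 1" "norm (u - x) \<le> e + d" "re (?w ?g) - d < re (?g u)"
    using adherentD[OF adh g d(1)] by blast
  ultimately have "norm (f x) - d < norm (f u)"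
    using re_le[of "?g u"] \<theta> by (simp add: norm_mult)
  then have su: "1 - 2 * d < snorm u" "snorm u \<le> 1"
    using f(4) x(2) snorm_upper[OF f(1-3) u(1)] snorm_le_norm[OF u(1)] u(2) by linarith+
  let ?x = "(1 / snorm u) *\<^sub>R u"
  have "snorm ?x = 1" "norm ?x \<le> (1 + 0) * (1 + 2 * (2 * d))" "norm (?x - u) \<le> 4 * (2 * d)"
    using normalise_almost_normed[of u 0 "2 * d"] u su d by auto
  moreover have "norm (?x - x) \<le> norm (?x - u) + norm (u - x)"
    using norm_triangle_ineq[of "?x - u" "u - x"] by simp
  moreover have "norm (?x - u) + norm (u - x) \<le> 3 * e"
    using u(3) calculation(3) e(1) by (simp add: d_def)
  ultimately show ?thesis using that[of ?x] u by (auto simp: d_def)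
qed

text \<open>Iterating the previous lemma with errors \<open>e / 2\<^sup>n\<close> gives a Cauchy sequence.\<close>

lemma exact_normed_point:
  assumes x: "x \<in> X" "snorm x = 1" "norm x \<le> 1 + e" and e: "0 < e" "e \<le> 1"
  obtains x' where "x' \<in> X" "snorm x' = 1" "norm x' = 1" "norm (x' - x) \<le> 6 * e"
proof -
  define G where "G n y \<longleftrightarrow> y \<in> X \<and> snorm y = 1 \<and> norm y \<le> 1 + e / 2 ^ n" for n y
  have "\<exists>y. \<forall>n. (G n (y n) \<and> (n = 0 \<longrightarrow> y n = x)) \<and> norm (y (Suc n) - y n) \<le> 3 * (e / 2 ^ n)"
  proof (rule dependent_nat_choice)
    show "\<exists>y. G 0 y \<and> (0 = 0 \<longrightarrow> y = x)" using x by (auto simp: G_def)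
    fix y and n :: nat assume y: "G n y \<and> (n = 0 \<longrightarrow> y = x)"
    have "e / 2 ^ n \<le> e / 1" using e by (intro divide_left_mono) auto
    then have "0 < e / 2 ^ n" "e / 2 ^ n \<le> 1" using e by (simp, linarith)
    then obtain y' where "y' \<in> X" "snorm y' = 1" "norm y' \<le> 1 + (e / 2 ^ n) / 2"
      "norm (y' - y) \<le> 3 * (e / 2 ^ n)"
      using y improve_normed_point[of y "e / 2 ^ n"] unfolding G_def by blast
    then show "\<exists>y'. (G (Suc n) y' \<and> (Suc n = 0 \<longrightarrow> y' = x)) \<and> norm (y' - y) \<le> 3 * (e / 2 ^ n)"
      by (intro exI[of _ y']) (simp add: G_def field_simps)
  qed
  then obtain y where y: "\<And>n. G n (y n)" "y 0 = x"
    "\<And>n. norm (y (Suc n) - y n) \<le> 3 * (e / 2 ^ n)" by blast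
  have close: "norm (y (n + k) - y n) \<le> 6 * e / 2 ^ n * (1 - 1 / 2 ^ k)" for n k
  proof (induction k)
    case (Suc k)
    have "norm (y (n + Suc k) - y n) \<le> norm (y (Suc (n + k)) - y (n + k)) + norm (y (n + k) - y n)"
      using norm_triangle_ineq[of "y (Suc (n + k)) - y (n + k)" "y (n + k) - y n"] by simp
    also have "\<dots> \<le> 3 * (e / 2 ^ (n + k)) + 6 * e / 2 ^ n * (1 - 1 / 2 ^ k)"
      by (intro add_mono y Suc)
    also have "\<dots> = 6 * e / 2 ^ n * (1 - 1 / 2 ^ Suc k)"
      by (simp add: field_simps power_add)
    finally show ?case .
  qed simp
  have close': "norm (y (n + k) - y n) \<le> 6 * e / 2 ^ n" for n k
  proof -
    have "6 * e / 2 ^ n * (1 - 1 / 2 ^ k) \<le> 6 * e / 2 ^ n * 1"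
      using e by (intro mult_left_mono) auto
    then show ?thesis using close[of n k] by simp
  qed
  have lim0: "(\<lambda>n. c / 2 ^ n) \<longlonglongrightarrow> 0" for c :: real
    using tendsto_mult[OF tendsto_const[of c] LIMSEQ_power_zero[of "1 / 2 :: real"]]
    by (simp add: power_one_over field_simps)
  have "Cauchy y"
  proof (rule metric_CauchyI)
    fix d :: real assume d: "0 < d"
    have "\<forall>\<^sub>F n in sequentially. 6 * e / 2 ^ n < d / 2"
      using order_tendstoD(2)[OF lim0, of "d / 2" "6 * e"] d by simp
    then obtain N where N: "6 * e / 2 ^ N < d / 2" by (auto simp: eventually_sequentially)
    have "dist (y m) (y N) < d / 2" if "m \<ge> N" for m
      using close'[of N "m - N"] that N by (simp add: dist_norm)
    then show "\<exists>M. \<forall>m\<ge>M. \<forall>n\<ge>M. dist (y m) (y n) < d"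
      by (intro exI[of _ N]) (meson dist_triangle_half_l dist_commute)
  qed
  moreover have "\<forall>n. y n \<in> X" using y(1) by (simp add: G_def)
  ultimately obtain x' where x': "x' \<in> X" "y \<longlonglongrightarrow> x'" using complete unfolding complete_def by blast
  have "norm x' \<le> 1"
  proof (rule tendsto_le)
    show "(\<lambda>n. norm (y n)) \<longlonglongrightarrow> norm x'" using x'(2) by (rule tendsto_norm)
    show "(\<lambda>n. 1 + e / 2 ^ n) \<longlonglongrightarrow> 1" using tendsto_add[OF tendsto_const[of 1] lim0[of e]] by simp
    show "\<forall>\<^sub>F n in sequentially. norm (y n) \<le> 1 + e / 2 ^ n" using y(1) by (simp add: G_def)
  qed simp
  moreover have "snorm x' = 1"
  proof -
    have "\<bar>snorm x' - 1\<bar> \<le> 0"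
    proof (rule tendsto_lowerbound)
      show "(\<lambda>n. norm (x' - y n)) \<longlonglongrightarrow> 0"
        using tendsto_norm[OF tendsto_diff[OF tendsto_const[of x'] x'(2)]] by simp
      show "\<forall>\<^sub>F n in sequentially. \<bar>snorm x' - 1\<bar> \<le> norm (x' - y n)"
        using snorm_lipschitz[OF x'(1)] y(1) by (intro always_eventually) (metis G_def)
    qed simp
    then show ?thesis by simp
  qed
  moreover have "norm (x' - x) \<le> 6 * e"
  proof (rule tendsto_upperbound)
    show "(\<lambda>n. norm (y n - x)) \<longlonglongrightarrow> norm (x' - x)"
      by (intro tendsto_intros x')
    show "\<forall>\<^sub>F n in sequentially. norm (y n - x) \<le> 6 * e"
      using close'[of 0] y(2) by simp
  qed simp
  ultimately show ?thesis using that[of x'] x'(1) snorm_le_norm[OF x'(1)] by auto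
qed

text \<open>If \<open>h\<close> separates \<open>z \<in> B\<close> from the set in question, move \<open>z\<close> in the bidual, only on the
  summand, to a point of summand norm 1 at which \<open>h\<close> is not smaller, and approximate that point in
  \<open>X\<close>.\<close>

theorem ball_eq_hull_of_normed_points:
  assumes g: "g \<in> dual sc X" "P g \<noteq> (\<lambda>x. 0)"
  shows "unit_ball X \<subseteq> closure (convex hull {x \<in> X. norm x = 1 \<and> snorm x = 1})"
    (is "_ \<subseteq> closure (convex hull ?D)")
proof (rule subsetI, rule ccontr)
  fix z assume z: "z \<in> unit_ball X" and "z \<notin> closure (convex hull ?D)"
  then obtain F d where F: "linear F" "\<And>x. \<bar>F x\<bar> \<le> norm x" "0 < d"
    "\<And>c. c \<in> convex hull ?D \<Longrightarrow> F c + d \<le> F z"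
    using separation_from_convex[OF convex_convex_hull] by blast
  have zX: "z \<in> X" "norm z \<le> 1" using z by (auto simp: unit_ball_def)
  obtain h where h: "h \<in> dual sc X" "\<And>x. x \<in> X \<Longrightarrow> re (h x) = F x" "dual_norm X h \<le> 1"
  proof (rule dual_of_real_functional[of F 1])
    show "F x \<le> 1 * norm x" for x using F(2)[of x] by simp
  qed (use F(1) in \<open>auto simp: linear_add linear_scale\<close>)
  \<comment> \<open>the sign of \<open>y\<close> is chosen such that moving \<open>z\<close> in direction \<open>y\<close> on the summand does not
    decrease \<open>h\<close>\<close>
  obtain y where y: "y \<in> X" "0 < snorm y" "0 \<le> re (P h y)"
  proof -
    obtain y where "P g y \<noteq> 0" using g(2) by auto
    then have "y \<in> X" using dual_outside[OF P_dual[OF g(1)]] by blast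
    moreover have "snorm y \<noteq> 0"
      using norm_le_snorm[OF P_dual[OF g(1)] P_idem[OF g(1)] \<open>y \<in> X\<close>] \<open>P g y \<noteq> 0\<close> by auto
    ultimately have "0 < snorm y" using snorm_nonneg by force
    show ?thesis
    proof (cases "0 \<le> re (P h y)")
      case True
      with \<open>y \<in> X\<close> \<open>0 < snorm y\<close> show ?thesis using that by blast
    next
      case False
      have "snorm ((-1) *\<^sub>R y) = snorm y" "P h ((-1) *\<^sub>R y) = - P h y"
        using snorm_scaleR[OF \<open>y \<in> X\<close>, of "-1"] dual_scaleR[OF P_dual[OF h(1)] \<open>y \<in> X\<close>, of "-1"]
        by simp_all
      then show ?thesis
        using that[of "(-1) *\<^sub>R y"] False \<open>y \<in> X\<close> \<open>0 < snorm y\<close> scaleR_mem[of y "-1"] by simp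
    qed
  qed
  obtain t where t: "0 \<le> t" "snorm (z + t *\<^sub>R y) = 1"
  proof -
    define T where "T = 2 / snorm y"
    have "snorm (T *\<^sub>R y) \<le> snorm (z + T *\<^sub>R y) + snorm ((-1) *\<^sub>R z)"
      using snorm_triangle[of "z + T *\<^sub>R y" "(-1) *\<^sub>R z"] zX(1) y(1) by auto
    moreover have "snorm (T *\<^sub>R y) = 2" using y by (simp add: snorm_scaleR T_def)
    moreover have "snorm ((-1) *\<^sub>R z) \<le> 1"
      using snorm_le_norm[OF zX(1)] zX(2) by (simp only: snorm_scaleR[OF zX(1)])
    ultimately have "1 \<le> snorm (z + T *\<^sub>R y)" by linarith
    moreover have "snorm (z + 0 *\<^sub>R y) \<le> 1" using snorm_le_norm[OF zX(1)] zX(2) by simp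
    moreover have "0 \<le> T" using y by (simp add: T_def)
    moreover have "continuous_on {0..T} (\<lambda>t. snorm (z + t *\<^sub>R y))"
    proof (rule lipschitz_on_continuous_on, rule lipschitz_onI)
      fix s t :: real
      have "(z + s *\<^sub>R y) - (z + t *\<^sub>R y) = (s - t) *\<^sub>R y" by (simp add: algebra_simps)
      then have "norm ((z + s *\<^sub>R y) - (z + t *\<^sub>R y)) = norm y * dist s t"
        by (simp add: dist_real_def)
      then show "dist (snorm (z + s *\<^sub>R y)) (snorm (z + t *\<^sub>R y)) \<le> norm y * dist s t"
        using snorm_lipschitz[of "z + s *\<^sub>R y" "z + t *\<^sub>R y"] zX y
        by (simp add: dist_real_def add_mem scaleR_mem)
    qed simp
    ultimately obtain t where "0 \<le> t" "snorm (z + t *\<^sub>R y) = 1"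
      using IVT'[of "\<lambda>t. snorm (z + t *\<^sub>R y)" 0 1 T] by blast
    then show ?thesis using that by blast
  qed
  let ?w = "z + t *\<^sub>R y" let ?m = "mixed P ?w z"
  have w: "?w \<in> X" using zX y by auto
  define e where "e = min (1 / 4) (d / 100)"
  have e: "0 < e" "e \<le> 1 / 4" "e \<le> d / 100" using F(3) by (auto simp: e_def)
  obtain f where f: "f \<in> dual sc X" "P f = f" "dual_norm X f \<le> 1" "snorm ?w - e < norm (f ?w)"
    using snorm_approx[OF w e(1)] .
  have "adherent sc X {u \<in> X. norm u \<le> 1} ?m"
    using w t zX by (intro adherent_ball norm_mixed_le) auto
  then have "adherent sc X {u \<in> {u \<in> X. norm u \<le> 1}. norm (f u - ?m f) < e} ?m"
    using w zX f e by (intro adherent_strip bidual_linear_mixed)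
  then obtain u where u: "u \<in> X" "norm u \<le> 1" "norm (f u - ?m f) < e" "re (?m h) - e < re (h u)"
    using adherentD[OF _ h(1) e(1)] by blast
  have "?m f = f ?w" using f by (simp add: mixed_def)
  then have "norm (f ?w) - norm (f u) < e"
    using u(3) norm_triangle_ineq2[of "f ?w" "f u"] by (simp add: norm_minus_commute)
  then have su: "1 - 2 * e < snorm u" "snorm u \<le> 1"
    using f(4) t(2) snorm_upper[OF f(1-3) u(1)] snorm_le_norm[OF u(1)] u(2) by linarith+
  let ?x = "(1 / snorm u) *\<^sub>R u"
  have x: "snorm ?x = 1" "norm ?x \<le> 1 + 4 * e" "norm (?x - u) \<le> 8 * e"
    using normalise_almost_normed[of u 0 "2 * e"] u su e by auto
  obtain x' where x': "x' \<in> X" "snorm x' = 1" "norm x' = 1" "norm (x' - ?x) \<le> 6 * (4 * e)"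
    using exact_normed_point[of ?x "4 * e"] x u(1) e by auto
  have "re (?m h) = re (h z) + t * re (P h y)"
    using P_dual[OF h(1)] zX y by (simp add: mixed_def dual_add dual_scaleR scaleR_mem)
  then have "re (h z) \<le> re (?m h)" using t y by simp
  moreover have "re (h u) - re (h x') \<le> norm (u - x')"
  proof -
    have "re (h u) - re (h x') = F (u - x')" using h u x' F(1) by (simp add: linear_diff)
    then show ?thesis using F(2)[of "u - x'"] by simp
  qed
  moreover have "norm (u - x') \<le> norm (x' - ?x) + norm (?x - u)"
    using norm_triangle_ineq[of "x' - ?x" "?x - u"] by (simp add: norm_minus_commute)
  ultimately have "F z - F x' < 33 * e"
    using u(4) x(3) x'(4) h(2) zX x'(1) by auto
  moreover have "x' \<in> convex hull ?D" using x' by (intro hull_inc) auto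
  ultimately show False using F(4)[of x'] e F(3) by simp
qed

end

section \<open>Spaces with many one-dimensional L-summands\<close>

context normed_subspace
begin

lemma adherent_strips:
  assumes "finite F" and C: "adherent sc X C \<omega>" and \<omega>: "bidual_linear sc X \<omega>"
    and f: "\<And>s. s \<in> F \<Longrightarrow> f s \<in> dual sc X" and d: "0 < d"
  shows "adherent sc X {u \<in> C. \<forall>s\<in>F. norm (f s u - \<omega> (f s)) < d} \<omega>"
  using \<open>finite F\<close> f
proof (induction F rule: finite_induct)
  case empty
  then show ?case using C by simp
next
  case (insert s F)
  then have "adherent sc X {u \<in> C. \<forall>s\<in>F. norm (f s u - \<omega> (f s)) < d} \<omega>" by blast
  then have "adherent sc X {u \<in> {u \<in> C. \<forall>s\<in>F. norm (f s u - \<omega> (f s)) < d}.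
      norm (f s u - \<omega> (f s)) < d} \<omega>"
    using insert.prems d by (intro adherent_strip \<omega>) auto
  also have "{u \<in> {u \<in> C. \<forall>s\<in>F. norm (f s u - \<omega> (f s)) < d}. norm (f s u - \<omega> (f s)) < d} =
      {u \<in> C. \<forall>s\<in>insert s F. norm (f s u - \<omega> (f s)) < d}" by auto
  finally show ?case .
qed

end

locale nicely_embedded = rc_banach sc X
  for sc :: "'k::rc_scalar \<Rightarrow> 'v::real_normed_vector \<Rightarrow> 'v" and X +
  fixes S :: "'s::t2_space set" and J :: "'v \<Rightarrow> 's \<Rightarrow> 'k"
  assumes nice: "nice_embedding sc X S J"
    and indep: "pairwise_independent S (point_functional X J)"
begin

abbreviation p where "p \<equiv> point_functional X J"

lemma J_isometry: "linear_isometry_Cb sc X S J"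
  using nice by (simp add: nice_embedding_def)

lemma sup_norm_J: "x \<in> X \<Longrightarrow> sup_norm S (J x) = norm x"
  using J_isometry by (simp add: linear_isometry_Cb_def)

lemma bdd_J:
  assumes "x \<in> X"
  shows "bdd_above (insert 0 ((\<lambda>s. norm (J x s)) ` S))"
proof -
  have "bounded (J x ` S)"
    using J_isometry assms by (simp add: linear_isometry_Cb_def Cb_def)
  then obtain B where "\<And>s. s \<in> S \<Longrightarrow> norm (J x s) \<le> B" by (auto simp: bounded_iff)
  then have "bdd_above ((\<lambda>s. norm (J x s)) ` S)" by (rule bdd_aboveI2)
  then show ?thesis by simp
qed

lemma norm_p_le: 
  assumes "x \<in> X" "s \<in> S"
  shows "norm (p s x) \<le> norm x"
proof -
  have "norm (J x s) \<le> sup_norm S (J x)"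
    unfolding sup_norm_def using assms by (intro cSup_upper bdd_J) auto
  then show ?thesis using assms by (simp add: point_functional_def sup_norm_J)
qed

lemma p_norming:
  assumes "x \<in> X" "0 \<le> r" "r < norm x"
  obtains s where "s \<in> S" "r < norm (p s x)"
proof -
  have "r < Sup (insert 0 ((\<lambda>s. norm (J x s)) ` S))"
    using sup_norm_J[OF assms(1)] assms(3) by (simp add: sup_norm_def)
  then have "\<exists>y\<in>insert 0 ((\<lambda>s. norm (J x s)) ` S). r < y"
    by (subst (asm) less_cSup_iff) (use assms bdd_J in auto)
  then show ?thesis using that assms by (auto simp: point_functional_def)
qed

lemma p_dual: "s \<in> S \<Longrightarrow> p s \<in> dual sc X"
proof (rule dualI[where C=1])
  fix x assume "s \<in> S" "x \<in> X"
  then show "norm (p s x) \<le> 1 * norm x" using norm_p_le by simp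
qed (use J_isometry add_mem sc_mem in \<open>auto simp: point_functional_def linear_isometry_Cb_def\<close>)

lemma dual_norm_p: "s \<in> S \<Longrightarrow> dual_norm X (p s) = 1"
  using nice by (simp add: nice_embedding_def)

lemma dual_norm_cmult_p: "s \<in> S \<Longrightarrow> dual_norm X (\<lambda>x. a * p s x) = norm a"
  by (simp add: dual_norm_cmult p_dual dual_norm_p)

lemma p_multiple_inject:
  assumes s: "s \<in> S" and "(\<lambda>x. a * p s x) = (\<lambda>x. b * p s x)"
  shows "a = b"
proof -
  have "(\<lambda>x. (a - b) * p s x) = (\<lambda>x. 0)"
    using assms(2) by (auto simp: fun_eq_iff algebra_simps)
  then have "norm (a - b) = 0" using dual_norm_cmult_p[OF s, of "a - b"] by simp
  then show ?thesis by simp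
qed

text \<open>By assumption the line spanned by \<open>p s\<close> is the range of an L-projection; one is chosen here. Its
  value at \<open>f\<close> is \<open>coef s f\<close> times \<open>p s\<close>.\<close>

definition Pr where
  "Pr s = (SOME P. L_projection sc X P \<and> P ` dual sc X = range (\<lambda>c x. c * p s x))"

lemma Pr:
  assumes "s \<in> S"
  shows "L_projection sc X (Pr s)" "Pr s ` dual sc X = range (\<lambda>c x. c * p s x)"
proof -
  have "L_summand sc X (range (\<lambda>c x. c * p s x))"
    using nice assms by (simp add: nice_embedding_def)
  then have "\<exists>P. L_projection sc X P \<and> P ` dual sc X = range (\<lambda>c x. c * p s x)"
    unfolding L_summand_def L_projection_def by blast
  from someI_ex[OF this] show "L_projection sc X (Pr s)" "Pr s ` dual sc X = range (\<lambda>c x. c * p s x)"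
    by (auto simp: Pr_def)
qed

lemma L_projected_Pr: "s \<in> S \<Longrightarrow> L_projected sc X (Pr s)"
  by unfold_locales (rule Pr)

definition coef where "coef s f = (SOME c. Pr s f = (\<lambda>x. c * p s x))"

lemma Pr_eq_coef:
  assumes "s \<in> S" "f \<in> dual sc X"
  shows "Pr s f = (\<lambda>x. coef s f * p s x)"
proof -
  have "\<exists>c. Pr s f = (\<lambda>x. c * p s x)" using Pr(2)[OF assms(1)] assms(2) by blast
  from someI_ex[OF this] show ?thesis by (simp add: coef_def)
qed

lemma coef_eqI: "s \<in> S \<Longrightarrow> f \<in> dual sc X \<Longrightarrow> Pr s f = (\<lambda>x. c * p s x) \<Longrightarrow> coef s f = c"
  using p_multiple_inject Pr_eq_coef by metis

lemma coef_add:
  assumes s: "s \<in> S" and f: "f \<in> dual sc X" and g: "g \<in> dual sc X"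
  shows "coef s (\<lambda>x. f x + g x) = coef s f + coef s g"
proof -
  interpret L_projected sc X "Pr s" by (rule L_projected_Pr[OF s])
  show ?thesis
    using s f g by (intro coef_eqI) (auto simp: P_add Pr_eq_coef algebra_simps)
qed

lemma coef_cmult:
  assumes s: "s \<in> S" and f: "f \<in> dual sc X"
  shows "coef s (\<lambda>x. c * f x) = c * coef s f"
proof -
  interpret L_projected sc X "Pr s" by (rule L_projected_Pr[OF s])
  show ?thesis
    using s f by (intro coef_eqI) (auto simp: P_cmult Pr_eq_coef algebra_simps)
qed

lemma coef_zero: "s \<in> S \<Longrightarrow> coef s (\<lambda>x. 0) = 0"
  using coef_cmult[OF _ dual_zero, of s 0] by simp

lemma coef_diff:
  assumes s: "s \<in> S" and f: "f \<in> dual sc X" and g: "g \<in> dual sc X"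
  shows "coef s (\<lambda>x. f x - g x) = coef s f - coef s g"
  using coef_add[OF s f dual_cmult[OF g, of "-1"]] coef_cmult[OF s g, of "-1"] by simp

lemma coef_sum:
  assumes s: "s \<in> S" and f: "\<And>i. i \<in> I \<Longrightarrow> f i \<in> dual sc X"
  shows "coef s (\<lambda>x. \<Sum>i\<in>I. f i x) = (\<Sum>i\<in>I. coef s (f i))"
  using f
proof (induction I rule: infinite_finite_induct)
  case (insert i I)
  have "coef s (\<lambda>x. f i x + (\<Sum>i\<in>I. f i x)) = coef s (f i) + coef s (\<lambda>x. \<Sum>i\<in>I. f i x)"
    using insert.prems by (intro coef_add[OF s]) auto
  then show ?case using insert by simp
qed (auto simp: coef_zero[OF s])

lemma dual_cmult_p: "s \<in> S \<Longrightarrow> (\<lambda>x. c * p s x) \<in> dual sc X"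
  by (intro dual_cmult p_dual)

lemma coef_p:
  assumes s: "s \<in> S"
  shows "coef s (p s) = 1"
proof (rule coef_eqI[OF s p_dual[OF s]])
  interpret L_projected sc X "Pr s" by (rule L_projected_Pr[OF s])
  have "p s \<in> Pr s ` dual sc X"
    unfolding Pr(2)[OF s] by (rule range_eqI[of _ _ 1]) simp
  then have "Pr s (p s) = p s" using P_idem by auto
  then show "Pr s (p s) = (\<lambda>x. 1 * p s x)" by simp
qed

lemma coef_split:
  assumes s: "s \<in> S" and f: "f \<in> dual sc X"
  shows "dual_norm X f = norm (coef s f) + dual_norm X (\<lambda>x. f x - coef s f * p s x)"
proof -
  interpret L_projected sc X "Pr s" by (rule L_projected_Pr[OF s])
  show ?thesis using P_norm[OF f] by (simp add: Pr_eq_coef[OF s f] dual_norm_cmult_p[OF s])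
qed

lemma coef_le:
  assumes s: "s \<in> S" and f: "f \<in> dual sc X"
  shows "norm (coef s f) \<le> dual_norm X f"
  using coef_split[OF assms] dual_norm_nonneg[OF dual_minus[OF f dual_cmult_p[OF s]]] by auto

text \<open>Write \<open>p t = c p s + g\<close> and \<open>p s = b p t + k\<close>. Then \<open>\<parallel>g\<parallel> = 1 - |c|\<close>, but splitting \<open>g\<close> along
  \<open>p t\<close> gives \<open>\<parallel>g\<parallel> = |1 - c b| + |c| (1 - |b|)\<close>, which is larger unless \<open>c = 0\<close> or \<open>|b| = 1\<close>, and
  \<open>|b| = 1\<close> would make \<open>p s\<close> and \<open>p t\<close> dependent.\<close>

lemma coef_other:
  assumes s: "s \<in> S" and t: "t \<in> S" and st: "s \<noteq> t"
  shows "coef s (p t) = 0"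
proof (rule ccontr)
  assume c0: "coef s (p t) \<noteq> 0"
  define c where "c = coef s (p t)"
  define b where "b = coef t (p s)"
  have ps: "p s \<in> dual sc X" and pt: "p t \<in> dual sc X" using s t p_dual by auto
  let ?g = "\<lambda>x. p t x - c * p s x" and ?k = "\<lambda>x. p s x - b * p t x"
  have g: "?g \<in> dual sc X" and k: "?k \<in> dual sc X"
    using ps pt by (auto intro!: dual_minus dual_cmult)
  have ng: "dual_norm X ?g = 1 - norm c"
    using coef_split[OF s pt] dual_norm_p[OF t] by (simp add: c_def)
  have nk: "dual_norm X ?k = 1 - norm b"
    using coef_split[OF t ps] dual_norm_p[OF s] by (simp add: b_def)
  have cg: "coef t ?g = 1 - c * b"
    using coef_diff[OF t pt dual_cmult[OF ps]] coef_cmult[OF t ps] coef_p[OF t] by (simp add: b_def)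
  have "(\<lambda>x. ?g x - coef t ?g * p t x) = (\<lambda>x. (- c) * ?k x)"
    by (auto simp: cg algebra_simps)
  then have "dual_norm X ?g = norm (1 - c * b) + norm (- c) * (1 - norm b)"
    using coef_split[OF t g] cg dual_norm_cmult[OF k, of "- c"] nk by simp
  then have "norm (1 - c * b) + norm c * (1 - norm b) = 1 - norm c"
    using ng by simp
  moreover have "norm (1 - c * b) \<ge> 1 - norm c * norm b"
    using norm_triangle_ineq2[of 1 "c * b"] by (simp add: norm_mult)
  ultimately have "norm c * 1 \<le> norm c * norm b" by (simp add: algebra_simps)
  then have "1 \<le> norm b" using c0 by (simp add: c_def)
  then have "dual_norm X ?k \<le> 0" using nk by simp
  then have "?k = (\<lambda>x. 0)" using dual_norm_nonneg[OF k] by (intro dual_norm_eq_0D[OF k]) simp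
  then have "\<forall>x. 1 * p s x + (- b) * p t x = 0" by (auto simp: fun_eq_iff)
  moreover have "(\<forall>x. 1 * p s x + (- b) * p t x = 0) \<longrightarrow> (1::'k) = 0 \<and> - b = 0"
    using indep s t st unfolding pairwise_independent_def by blast
  ultimately show False by simp
qed

lemma coef_p_eq: "s \<in> S \<Longrightarrow> t \<in> S \<Longrightarrow> coef s (p t) = (if s = t then 1 else 0)"
  using coef_p coef_other by simp

definition partial where "partial F f x = (\<Sum>s\<in>F. coef s f * p s x)"

lemma partial_dual: "F \<subseteq> S \<Longrightarrow> (\<lambda>x. partial F f x) \<in> dual sc X"
  unfolding partial_def by (intro dual_sum dual_cmult_p) auto

lemma coef_partial:
  assumes F: "finite F" "F \<subseteq> S" and s: "s \<in> S" and f: "f \<in> dual sc X"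
  shows "coef s (partial F f) = (if s \<in> F then coef s f else 0)"
proof -
  have "coef s (partial F f) = (\<Sum>t\<in>F. coef s (\<lambda>x. coef t f * p t x))"
    unfolding partial_def using F by (intro coef_sum[OF s] dual_cmult_p) auto
  also have "\<dots> = (\<Sum>t\<in>F. if s = t then coef s f else 0)"
    using F s p_dual by (intro sum.cong) (auto simp: coef_cmult coef_p_eq subset_iff)
  finally show ?thesis using F by simp
qed

lemma coef_rest:
  assumes F: "finite F" "F \<subseteq> S" and s: "s \<in> S" and f: "f \<in> dual sc X"
  shows "coef s (\<lambda>x. f x - partial F f x) = (if s \<in> F then 0 else coef s f)"
  using coef_diff[OF s f partial_dual[OF F(2), of f]] coef_partial[OF F s f] by simp

lemma rest_dual: "F \<subseteq> S \<Longrightarrow> f \<in> dual sc X \<Longrightarrow> (\<lambda>x. f x - partial F f x) \<in> dual sc X"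
  using partial_dual by auto

text \<open>As the L-projections annihilate the other point functionals, splitting off \<open>p t\<close> from
  what remains after splitting off the \<open>p s\<close> with \<open>s \<in> F\<close> uses the coefficient of \<open>f\<close> itself.\<close>

lemma norm_eq_sum_coef:
  assumes "finite F" "F \<subseteq> S" and f: "f \<in> dual sc X"
  shows "dual_norm X f = (\<Sum>s\<in>F. norm (coef s f)) + dual_norm X (\<lambda>x. f x - partial F f x)"
  using assms(1,2)
proof (induction F rule: finite_induct)
  case empty
  then show ?case by (simp add: partial_def)
next
  case (insert t F)
  let ?r = "\<lambda>x. f x - partial F f x"
  have r: "?r \<in> dual sc X" using insert.prems f by (intro rest_dual) auto
  have "coef t ?r = coef t f" using insert f by (simp add: coef_rest)
  moreover have "(\<lambda>x. ?r x - coef t f * p t x) = (\<lambda>x. f x - partial (insert t F) f x)"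
    using insert.hyps by (auto simp: partial_def)
  ultimately have "dual_norm X ?r =
      norm (coef t f) + dual_norm X (\<lambda>x. f x - partial (insert t F) f x)"
    using coef_split[OF _ r, of t] insert.prems by (simp only: insert_subset)
  then show ?case using insert by simp
qed

lemma sum_coef_le:
  assumes "finite F" "F \<subseteq> S" "f \<in> dual sc X"
  shows "(\<Sum>s\<in>F. norm (coef s f)) \<le> dual_norm X f"
  using norm_eq_sum_coef[OF assms] dual_norm_nonneg[OF rest_dual[OF assms(2,3)]] by simp

lemma finite_large_coef:
  assumes f: "f \<in> dual sc X" and d: "0 < d"
  shows "finite {s \<in> S. d \<le> norm (coef s f)}"
proof (rule ccontr)
  assume "infinite {s \<in> S. d \<le> norm (coef s f)}"
  then obtain F where F: "F \<subseteq> {s \<in> S. d \<le> norm (coef s f)}" "finite F"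
    "card F = nat \<lceil>dual_norm X f / d\<rceil> + 1"
    using infinite_arbitrarily_large by blast
  have "d * real (card F) = (\<Sum>s\<in>F. d)" by simp
  also have "\<dots> \<le> (\<Sum>s\<in>F. norm (coef s f))" using F by (intro sum_mono) auto
  also have "\<dots> \<le> dual_norm X f" using F f by (intro sum_coef_le) auto
  finally have "real (card F) \<le> dual_norm X f / d" using d by (simp add: field_simps)
  then show False using F(3) by linarith
qed

text \<open>If \<open>|p s x|\<close> is close to 1 and \<open>f\<close> hardly charges \<open>p s\<close>, then replacing the value of \<open>x\<close> at
  \<open>p s\<close> by the opposite unimodular number gives an element of the bidual ball that \<open>f\<close> does not
  distinguish from \<open>x\<close> and whose distance from \<open>x\<close> is almost 2.\<close>

theorem Delta_pointI:
  assumes x: "x \<in> X" "norm x = 1"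
    and inf: "\<And>e. 0 < e \<Longrightarrow> infinite {s \<in> S. 1 - e < norm (p s x)}"
  shows "x \<in> Delta_points sc X"
  unfolding Delta_points_def
proof (intro CollectI conjI allI impI ballI)
  show "x \<in> unit_sphere X" using x by (simp add: unit_sphere_def)
  fix \<epsilon> :: real and f and \<alpha> :: real
  assume \<epsilon>: "0 < \<epsilon>" and f: "f \<in> dual sc X" and "0 < \<alpha>" and "x \<in> slice X f \<alpha>"
  define \<eta> where "\<eta> = re (f x) - ((SUP z\<in>unit_ball X. re (f z)) - \<alpha>)"
  have \<eta>: "0 < \<eta>" using \<open>x \<in> slice X f \<alpha>\<close> by (simp add: slice_def \<eta>_def)
  define d where "d = min (\<epsilon> / 4) (\<eta> / 4)"
  have d: "0 < d" "4 * d \<le> \<epsilon>" "4 * d \<le> \<eta>" using \<epsilon> \<eta> by (auto simp: d_def)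
  have "infinite ({s \<in> S. 1 - d < norm (p s x)} - {s \<in> S. d \<le> norm (coef s f)})"
    using inf[OF d(1)] finite_large_coef[OF f d(1)] by (rule Diff_infinite_finite[rotated])
  then have "{s \<in> S. 1 - d < norm (p s x)} - {s \<in> S. d \<le> norm (coef s f)} \<noteq> {}"
    by (rule infinite_imp_nonempty)
  then obtain s where "s \<in> {s \<in> S. 1 - d < norm (p s x)} - {s \<in> S. d \<le> norm (coef s f)}"
    by blast
  then have s: "s \<in> S" "1 - d < norm (p s x)" "norm (coef s f) < d" by auto
  obtain \<theta> where \<theta>: "norm \<theta> = 1" "\<theta> * p s x = of_real (norm (p s x))"
    using obtain_rotation by blast
  define \<kappa> where "\<kappa> = inverse \<theta>"
  have \<kappa>: "norm \<kappa> = 1" using \<theta>(1) by (simp add: \<kappa>_def norm_inverse)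
  have px: "p s x = \<kappa> * of_real (norm (p s x))"
    using \<theta> by (metis \<kappa>_def mult.assoc left_inverse mult.left_neutral norm_zero zero_neq_one)
  define \<omega> where "\<omega> k = (k x - coef s k * p s x) - coef s k * \<kappa>" for k
  have \<omega>_lin: "bidual_linear sc X \<omega>"
    unfolding bidual_linear_def \<omega>_def
    using s(1) by (auto simp: coef_add coef_cmult algebra_simps)
  have \<omega>_norm: "norm (\<omega> k) \<le> 1 * dual_norm X k" if k: "k \<in> dual sc X" for k
  proof -
    have "(\<lambda>y. k y - coef s k * p s y) \<in> dual sc X"
      by (rule dual_minus[OF k dual_cmult_p[OF s(1)]])
    from norm_le_dual_norm[OF this x(1)]
    have "norm (k x - coef s k * p s x) \<le> dual_norm X (\<lambda>y. k y - coef s k * p s y)" by (simp add: x)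
    then have "norm (\<omega> k) \<le> dual_norm X (\<lambda>y. k y - coef s k * p s y) + norm (coef s k)"
      using norm_triangle_ineq4[of "k x - coef s k * p s x" "coef s k * \<kappa>"] \<kappa>
      by (simp add: \<omega>_def norm_mult)
    then show ?thesis using coef_split[OF s(1) k] by simp
  qed
  have "adherent sc X {u \<in> X. norm u \<le> 1} \<omega>" using \<omega>_norm by (rule adherent_ball) auto
  then have "adherent sc X {u \<in> {u \<in> X. norm u \<le> 1}. norm (p s u - \<omega> (p s)) < d} \<omega>"
    using \<omega>_lin p_dual[OF s(1)] d(1) by (rule adherent_strip)
  then obtain y where y: "y \<in> X" "norm y \<le> 1" "norm (p s y - \<omega> (p s)) < d" "re (\<omega> f) - d < re (f y)"
    using adherentD[OF _ f d(1)] by blast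
  have "\<omega> (p s) = - \<kappa>" using s(1) by (simp add: \<omega>_def coef_p)
  have "re (f x) - re (\<omega> f) \<le> norm (coef s f * p s x) + norm (coef s f * \<kappa>)"
    using re_le[of "coef s f * p s x"] re_le[of "coef s f * \<kappa>"] by (simp add: \<omega>_def)
  also have "\<dots> \<le> norm (coef s f) * 1 + norm (coef s f) * 1"
    unfolding norm_mult using norm_p_le[OF x(1) s(1)] x(2) \<kappa>
    by (intro add_mono mult_left_mono) auto
  finally have "re (f x) - re (\<omega> f) \<le> 2 * d" using s(3) by simp
  then have "re (f x) - \<eta> < re (f y)" using y(4) d by linarith
  then have "y \<in> slice X f \<alpha>" using y by (simp add: slice_def unit_ball_def \<eta>_def)
  moreover have "2 - \<epsilon> < norm (x - y)"
  proof -
    have "p s x + \<kappa> = \<kappa> * of_real (norm (p s x) + 1)"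
      by (subst px) (simp add: distrib_left)
    then have "norm (p s x + \<kappa>) = norm (p s x) + 1" using \<kappa> by (simp add: norm_mult del: of_real_add)
    moreover have "norm (p s x + \<kappa>) \<le> norm (p s x - p s y) + norm (p s y + \<kappa>)"
      using norm_triangle_ineq[of "p s x - p s y" "p s y + \<kappa>"] by simp
    moreover have "p s x - p s y = p s (x - y)" using s(1) x(1) y(1) p_dual by (simp add: dual_diff)
    moreover have "norm (p s (x - y)) \<le> norm (x - y)" using x y s(1) by (intro norm_p_le) auto
    ultimately show ?thesis using y(3) s(2) d \<open>\<omega> (p s) = - \<kappa>\<close> by simp
  qed
  ultimately show "\<exists>y\<in>slice X f \<alpha>. 2 - \<epsilon> < norm (x - y)" by blast
qed

text \<open>All points whose summand norm is 1 are \<open>\<Delta>\<close>-points, and they are sufficiently many.\<close>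

theorem convex_DLD2P_criterion:
  assumes Q: "L_projection sc X Q" and g: "g \<in> dual sc X" "Q g \<noteq> (\<lambda>x. 0)"
    and inf: "\<And>x e. x \<in> X \<Longrightarrow> norm x = 1 \<Longrightarrow> summand_norm sc X Q x = 1 \<Longrightarrow> 0 < e \<Longrightarrow>
        infinite {s \<in> S. 1 - e < norm (p s x)}"
  shows "convex_DLD2P sc X"
proof -
  interpret L_projected sc X Q by unfold_locales (rule Q)
  have "{x \<in> X. norm x = 1 \<and> snorm x = 1} \<subseteq> Delta_points sc X"
    using inf by (auto intro!: Delta_pointI)
  then have "unit_ball X \<subseteq> closure (convex hull Delta_points sc X)"
    by (intro subset_trans[OF ball_eq_hull_of_normed_points[OF g]] closure_mono hull_mono)
  moreover have "closure (convex hull Delta_points sc X) \<subseteq> unit_ball X"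
  proof (intro closure_minimal hull_minimal)
    have eq: "unit_ball X = X \<inter> cball 0 1" by (auto simp: unit_ball_def)
    show "convex (unit_ball X)" by (simp add: eq convex_Int convex_X)
    show "closed (unit_ball X)" using complete by (simp add: eq closed_Int complete_imp_closed)
    show "Delta_points sc X \<subseteq> unit_ball X"
      by (auto simp: Delta_points_def unit_sphere_def unit_ball_def)
  qed
  ultimately show ?thesis by (simp add: convex_DLD2P_def)
qed

text \<open>For the summand spanned by \<open>p s\<close> the summand norm is \<open>x \<mapsto> |p s x|\<close>.\<close>

corollary convex_DLD2P_from_accumulation:
  assumes s: "s \<in> S"
    and inf: "\<And>x e. x \<in> X \<Longrightarrow> norm x = 1 \<Longrightarrow> norm (p s x) = 1 \<Longrightarrow> 0 < e \<Longrightarrow>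
        infinite {t \<in> S. 1 - e < norm (p t x)}"
  shows "convex_DLD2P sc X"
proof (rule convex_DLD2P_criterion[OF Pr(1)[OF s] p_dual[OF s]])
  interpret L_projected sc X "Pr s" by (rule L_projected_Pr[OF s])
  have "Pr s (p s) = p s" using Pr_eq_coef[OF s p_dual[OF s]] coef_p[OF s] by simp
  then show "Pr s (p s) \<noteq> (\<lambda>x. 0)"
    using dual_norm_p[OF s] dual_norm_zero by (metis zero_neq_one)
  fix x and e :: real assume x: "x \<in> X" "norm x = 1" "snorm x = 1" and e: "0 < e"
  have "snorm x \<le> norm (p s x)"
  proof (rule snorm_least)
    fix f assume f: "f \<in> dual sc X" "Pr s f = f" "dual_norm X f \<le> 1"
    have eq: "f x = coef s f * p s x" for x using Pr_eq_coef[OF s f(1)] f(2) by metis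
    have "norm (coef s f) * norm (p s x) \<le> 1 * norm (p s x)"
      using coef_le[OF s f(1)] f(3) by (intro mult_right_mono) auto
    then show "norm (f x) \<le> norm (p s x)" by (simp add: eq norm_mult)
  qed
  then have "norm (p s x) = 1" using x norm_p_le[OF x(1) s] by simp
  then show "infinite {t \<in> S. 1 - e < norm (p t x)}" using inf x e by blast
qed

end

context nicely_embedded
begin

section \<open>The part of the dual that no point functional charges\<close>

text \<open>Let \<open>\<rho>\<close> be the supremum of \<open>|g x|\<close> over the functionals \<open>g\<close> in question, and let \<open>u\<close> with
  \<open>\<parallel>u\<parallel> \<le> \<rho>\<close> approximate the element of the bidual that vanishes at \<open>p s\<close> for \<open>s \<in> F\<close> and agrees with
  \<open>x\<close> on these \<open>g\<close>. For large \<open>\<lambda>\<close> the norm of \<open>x + \<lambda> u\<close>, which is about \<open>(1 + \<lambda>) \<rho>\<close>, is not attained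
  in \<open>F\<close>; off \<open>F\<close> it is at most \<open>m + \<lambda> \<rho>\<close>. Hence \<open>\<rho> \<le> m\<close>.\<close>

lemma uncharging_functional_le:
  assumes F: "finite F" "F \<subseteq> S" and x: "x \<in> X" and m: "0 \<le> m"
    and off: "\<And>t. t \<in> S \<Longrightarrow> t \<notin> F \<Longrightarrow> norm (p t x) \<le> m"
    and g: "g \<in> dual sc X" "dual_norm X g \<le> 1" "\<And>s. s \<in> F \<Longrightarrow> coef s g = 0"
  shows "norm (g x) \<le> m"
proof -
  define G where "G = {g \<in> dual sc X. dual_norm X g \<le> 1 \<and> (\<forall>s\<in>F. coef s g = 0)}"
  define \<rho> where "\<rho> = (SUP g\<in>G. norm (g x))"
  have gG: "g \<in> G" using g by (simp add: G_def)
  have bdd: "bdd_above ((\<lambda>g. norm (g x)) ` G)"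
  proof (rule bdd_aboveI2)
    fix g assume g: "g \<in> G"
    have "norm (g x) \<le> dual_norm X g * norm x" using g x by (intro norm_le_dual_norm) (auto simp: G_def)
    also have "\<dots> \<le> 1 * norm x" using g by (intro mult_right_mono) (auto simp: G_def)
    finally show "norm (g x) \<le> norm x" by simp
  qed
  have up: "norm (k x) \<le> \<rho>" if "k \<in> G" for k
    unfolding \<rho>_def using that bdd by (rule cSUP_upper)
  have "\<rho> \<le> m"
  proof (rule ccontr)
    assume "\<not> \<rho> \<le> m"
    then have \<rho>: "0 < \<rho>" "m < \<rho>" using m by auto
    define l where "l = norm x / \<rho>"
    define c where "c = 1 + 3 * l"
    define d where "d = (\<rho> - m) / (2 * c)"
    have l: "0 \<le> l" "l * \<rho> = norm x" using \<rho> by (auto simp: l_def)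
    have "0 < c" using l by (simp add: c_def)
    then have d: "0 < d" "c * d = (\<rho> - m) / 2" using \<rho> by (simp_all add: d_def)
    define q where "q = l * d"
    have ld: "0 \<le> q" using l d by (simp add: q_def)
    have d': "2 * d + 6 * q = \<rho> - m" using d(2) by (simp add: c_def q_def field_simps)
    have "\<exists>k\<in>G. \<rho> - d < norm (k x)"
      unfolding \<rho>_def by (subst less_cSUP_iff[symmetric]) (use bdd gG d in auto)
    then obtain k where k: "k \<in> G" "\<rho> - d < norm (k x)" by blast
    obtain \<theta> where \<theta>: "norm \<theta> = 1" "\<theta> * k x = of_real (norm (k x))" using obtain_rotation by blast
    let ?h = "\<lambda>y. \<theta> * k y"
    have kd: "k \<in> dual sc X" and h: "?h \<in> dual sc X" using k by (auto simp: G_def)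
    have h1: "dual_norm X ?h \<le> 1" using k \<theta> by (simp add: dual_norm_cmult G_def)
    define \<omega> where "\<omega> f = f x - partial F f x" for f
    have \<omega>_lin: "bidual_linear sc X \<omega>"
      unfolding bidual_linear_def \<omega>_def partial_def using F(2)
      by (auto simp: coef_add coef_cmult subset_iff sum.distrib sum_distrib_left algebra_simps
          intro!: sum.cong)
    have \<omega>_norm: "norm (\<omega> f) \<le> \<rho> * dual_norm X f" if f: "f \<in> dual sc X" for f
    proof -
      let ?r = "\<lambda>y. f y - partial F f y"
      have r: "?r \<in> dual sc X" using F f by (intro rest_dual)
      have rf: "dual_norm X ?r \<le> dual_norm X f"
        using norm_eq_sum_coef[OF F f] by (simp add: sum_nonneg)
      have "norm (?r x) \<le> \<rho> * dual_norm X ?r"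
      proof (cases "dual_norm X ?r = 0")
        case True
        then show ?thesis using dual_norm_eq_0D[OF r] by (simp add: fun_eq_iff)
      next
        case False
        then have pos: "0 < dual_norm X ?r" using dual_norm_nonneg[OF r] by simp
        define c where "c = (of_real (1 / dual_norm X ?r) :: 'k)"
        have c: "norm c = 1 / dual_norm X ?r" using pos by (simp add: c_def norm_divide)
        have "(\<lambda>y. c * ?r y) \<in> G"
          unfolding G_def
        proof (intro CollectI conjI ballI)
          show "dual_norm X (\<lambda>y. c * ?r y) \<le> 1" 
            unfolding dual_norm_cmult[OF r] c using pos by simp
          fix s assume "s \<in> F"
          then show "coef s (\<lambda>y. c * ?r y) = 0"
            using F coef_rest[OF F _ f, of s] coef_cmult[OF _ r, of s c] by auto
        qed (intro dual_cmult r)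
        from up[OF this] have "norm c * norm (?r x) \<le> \<rho>" by (simp only: norm_mult)
        then show ?thesis using pos unfolding c by (simp add: pos_divide_le_eq)
      qed
      also have "\<dots> \<le> \<rho> * dual_norm X f" using rf \<rho> by (intro mult_left_mono) auto
      finally show ?thesis by (simp add: \<omega>_def)
    qed
    have ball: "adherent sc X {u \<in> X. norm u \<le> \<rho>} \<omega>"
      using \<omega>_norm \<rho> by (intro adherent_ball) auto
    have "adherent sc X {u \<in> {u \<in> X. norm u \<le> \<rho>}. \<forall>s\<in>F. norm (p s u - \<omega> (p s)) < d} \<omega>"
      using F p_dual by (intro adherent_strips[OF F(1) ball \<omega>_lin, of p d] d(1)) auto
    then obtain u where "u \<in> {u \<in> {u \<in> X. norm u \<le> \<rho>}. \<forall>s\<in>F. norm (p s u - \<omega> (p s)) < d}"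
      and u_h: "re (\<omega> ?h) - d < re (?h u)"
      by (rule adherentD[OF _ h d(1)])
    then have u: "u \<in> X" "norm u \<le> \<rho>" "\<And>s. s \<in> F \<Longrightarrow> norm (p s u - \<omega> (p s)) < d"
      "re (\<omega> ?h) - d < re (?h u)" by auto
    have "\<omega> (p s) = 0" if "s \<in> F" for s
    proof -
      have "partial F (p s) x = (\<Sum>t\<in>F. if t = s then p s x else 0)"
        unfolding partial_def using F that by (intro sum.cong) (auto simp: coef_p_eq subset_iff)
      then show ?thesis using F that by (simp add: \<omega>_def)
    qed
    then have pu: "norm (p s u) < d" if "s \<in> F" for s using u(3)[OF that] that by simp
    have "coef s ?h = 0" if "s \<in> F" for s
      using that F k coef_cmult[OF _ kd, of s \<theta>] by (auto simp: G_def)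
    then have "\<omega> ?h = ?h x" by (simp add: \<omega>_def partial_def)
    then have hu: "\<rho> - 2 * d < re (?h u)" using u(4) k(2) \<theta>(2) by simp
    let ?y = "x + l *\<^sub>R u"
    have y: "?y \<in> X" using x u by auto
    define N where "N = \<rho> - d + l * (\<rho> - 2 * d)"
    have "l * (\<rho> - 2 * d) \<le> l * re (?h u)" using hu l by (intro mult_left_mono) auto
    then have "N < re (?h x) + l * re (?h u)" using k(2) \<theta>(2) by (simp add: N_def)
    also have "\<dots> = re (?h ?y)" 
      using kd x u(1)
      by (simp add: dual_add dual_scaleR scaleR_mem distrib_left mult.left_commute[of \<theta>])
    also have "\<dots> \<le> norm (?h ?y)" by (rule re_le)
    also have "\<dots> \<le> dual_norm X ?h * norm ?y" using norm_le_dual_norm[OF h y] .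
    also have "\<dots> \<le> 1 * norm ?y" using h1 by (intro mult_right_mono) auto
    finally have "N < norm ?y" by simp
    moreover have N: "N = \<rho> + norm x - d - 2 * q"
      using l(2) by (simp add: N_def q_def algebra_simps)
    have "0 \<le> N" using d' ld \<rho> m norm_ge_zero[of x] unfolding N by linarith
    ultimately obtain t where t: "t \<in> S" "N < norm (p t ?y)" using p_norming[OF y] by blast
    have "p t ?y = p t x + of_real l * p t u"
      using t p_dual x u by (simp add: dual_add dual_scaleR scaleR_mem)
    then have le: "norm (p t ?y) \<le> norm (p t x) + l * norm (p t u)"
      using norm_triangle_ineq[of "p t x" "of_real l * p t u"] l by (simp add: norm_mult)
    show False
    proof (cases "t \<in> F")
      case True
      have "l * norm (p t u) \<le> q"
        unfolding q_def using pu[OF True] l by (intro mult_left_mono) auto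
      then have "N < norm x + q" using t le norm_p_le[OF x t(1)] by linarith
      then show False using d' \<rho> m unfolding N by linarith
    next
      case False
      have "l * norm (p t u) \<le> l * \<rho>" using norm_p_le[OF u(1) t(1)] u(2) l by (intro mult_left_mono) auto
      then have "N < m + norm x" using t le off[OF t(1) False] l by linarith
      then show False using d' d ld \<rho> unfolding N by linarith
    qed
  qed
  then show ?thesis using up[OF gG] by simp
qed

text \<open>If functionals are thought of as measures, \<open>charged f\<close> is the part of \<open>f\<close> that is carried by the
  atoms \<open>p s\<close>, \<open>charge f\<close> is its total variation, and the rest of \<open>f\<close> has no atoms among the
  \<open>p s\<close>.\<close>

definition charged where "charged f x = (\<Sum>\<^sub>\<infinity>s\<in>S. coef s f * p s x)"

definition charge where "charge f = (\<Sum>\<^sub>\<infinity>s\<in>S. norm (coef s f))"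

lemma charge_has_sum:
  assumes f: "f \<in> dual sc X"
  shows "((\<lambda>s. norm (coef s f)) has_sum charge f) S"
proof -
  have "(\<lambda>s. norm (coef s f)) summable_on S"
    using sum_coef_le[OF _ _ f]
    by (intro nonneg_bdd_above_summable_on bdd_aboveI2[where M="dual_norm X f"]) auto
  then show ?thesis unfolding charge_def by (rule has_sum_infsum)
qed

lemma sum_coef_le_charge:
  assumes f: "f \<in> dual sc X" and F: "finite F" "F \<subseteq> S"
  shows "(\<Sum>s\<in>F. norm (coef s f)) \<le> charge f"
  by (rule has_sum_mono_neutral[OF has_sum_finite[OF F(1)] charge_has_sum[OF f]]) (use F in auto)

lemma charged_has_sum:
  assumes f: "f \<in> dual sc X"
  shows "((\<lambda>s. coef s f * p s x) has_sum charged f x) S"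
proof (cases "x \<in> X")
  case True
  have "(\<lambda>s. norm (coef s f) * norm x) summable_on S"
    using charge_has_sum[OF f] by (intro summable_on_cmult_left) (auto simp: summable_on_def)
  then have "(\<lambda>s. norm (coef s f * p s x)) summable_on S"
  proof (rule summable_on_comparison_test)
    show "norm (coef s f * p s x) \<le> norm (coef s f) * norm x" if "s \<in> S" for s
      using norm_p_le[OF True that] by (simp add: norm_mult mult_left_mono)
  qed auto
  then have "(\<lambda>s. coef s f * p s x) summable_on S" by (rule abs_summable_summable)
  then show ?thesis unfolding charged_def by (rule has_sum_infsum)
qed (simp add: charged_def point_functional_def)

text \<open>Passing to the limit over the finite subsets \<open>G\<close> of \<open>S\<close> that contain \<open>F\<close>.\<close>

lemma charged_tail:
  assumes f: "f \<in> dual sc X" and x: "x \<in> X" and F: "finite F" "F \<subseteq> S"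
  shows "norm (charged f x - partial F f x) \<le> (charge f - (\<Sum>s\<in>F. norm (coef s f))) * norm x"
proof (rule tendsto_le)
  show "finite_subsets_at_top S \<noteq> bot" by simp
  show "((\<lambda>G. norm ((\<Sum>s\<in>G. coef s f * p s x) - partial F f x)) \<longlongrightarrow>
      norm (charged f x - partial F f x)) (finite_subsets_at_top S)"
    using charged_has_sum[OF f, of x] unfolding has_sum_def by (intro tendsto_intros)
  show "((\<lambda>G. ((\<Sum>s\<in>G. norm (coef s f)) - (\<Sum>s\<in>F. norm (coef s f))) * norm x) \<longlongrightarrow>
      (charge f - (\<Sum>s\<in>F. norm (coef s f))) * norm x) (finite_subsets_at_top S)"
    using charge_has_sum[OF f] unfolding has_sum_def by (intro tendsto_intros)
  show "\<forall>\<^sub>F G in finite_subsets_at_top S. norm ((\<Sum>s\<in>G. coef s f * p s x) - partial F f x)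
      \<le> ((\<Sum>s\<in>G. norm (coef s f)) - (\<Sum>s\<in>F. norm (coef s f))) * norm x"
    unfolding eventually_finite_subsets_at_top
  proof (intro exI[of _ F] conjI allI impI F)
    fix G assume G: "finite G \<and> F \<subseteq> G \<and> G \<subseteq> S"
    have "(\<Sum>s\<in>G. coef s f * p s x) - partial F f x = (\<Sum>s\<in>G - F. coef s f * p s x)"
      using G by (simp add: partial_def sum_diff)
    also have "norm \<dots> \<le> (\<Sum>s\<in>G - F. norm (coef s f) * norm x)"
      using G norm_p_le[OF x] by (intro sum_norm_le) (auto simp: norm_mult intro!: mult_left_mono)
    also have "\<dots> = ((\<Sum>s\<in>G. norm (coef s f)) - (\<Sum>s\<in>F. norm (coef s f))) * norm x"
      using G by (simp add: sum_diff flip: sum_distrib_right)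
    finally show "norm ((\<Sum>s\<in>G. coef s f * p s x) - partial F f x)
      \<le> ((\<Sum>s\<in>G. norm (coef s f)) - (\<Sum>s\<in>F. norm (coef s f))) * norm x" .
  qed
qed

lemma charged_le: "f \<in> dual sc X \<Longrightarrow> x \<in> X \<Longrightarrow> norm (charged f x) \<le> charge f * norm x"
  using charged_tail[of f x "{}"] by (simp add: partial_def)

lemma uncharged_le:
  assumes f: "f \<in> dual sc X" and x: "x \<in> X"
  shows "norm (f x - charged f x) \<le> (dual_norm X f - charge f) * norm x"
proof (rule tendsto_le)
  show "finite_subsets_at_top S \<noteq> bot" by simp
  show "((\<lambda>G. norm (f x - (\<Sum>s\<in>G. coef s f * p s x))) \<longlongrightarrow>
      norm (f x - charged f x)) (finite_subsets_at_top S)"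
    using charged_has_sum[OF f, of x] unfolding has_sum_def by (intro tendsto_intros)
  show "((\<lambda>G. (dual_norm X f - (\<Sum>s\<in>G. norm (coef s f))) * norm x) \<longlongrightarrow>
      (dual_norm X f - charge f) * norm x) (finite_subsets_at_top S)"
    using charge_has_sum[OF f] unfolding has_sum_def by (intro tendsto_intros)
  show "\<forall>\<^sub>F G in finite_subsets_at_top S. norm (f x - (\<Sum>s\<in>G. coef s f * p s x))
      \<le> (dual_norm X f - (\<Sum>s\<in>G. norm (coef s f))) * norm x"
    unfolding eventually_finite_subsets_at_top
  proof (intro exI[of _ "{}"] conjI allI impI)
    fix G assume G: "finite G \<and> {} \<subseteq> G \<and> G \<subseteq> S"
    then have "norm (f x - partial G f x) \<le> dual_norm X (\<lambda>x. f x - partial G f x) * norm x"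
      using f x by (intro norm_le_dual_norm rest_dual) auto
    then show "norm (f x - (\<Sum>s\<in>G. coef s f * p s x))
      \<le> (dual_norm X f - (\<Sum>s\<in>G. norm (coef s f))) * norm x"
      using norm_eq_sum_coef[of G f] G f by (simp add: partial_def)
  qed auto
qed

lemma charge_nonneg: "f \<in> dual sc X \<Longrightarrow> 0 \<le> charge f"
  using sum_coef_le_charge[of f "{}"] by simp

lemma charge_le: "f \<in> dual sc X \<Longrightarrow> charge f \<le> dual_norm X f"
  unfolding charge_def
  using charge_has_sum[of f] sum_coef_le[of _ f]
  by (intro infsum_le_finite_sums) (auto simp: summable_on_def)

lemma charged_add: "f \<in> dual sc X \<Longrightarrow> g \<in> dual sc X \<Longrightarrow>
    charged (\<lambda>x. f x + g x) x = charged f x + charged g x"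
  using has_sum_add[OF charged_has_sum[of f x] charged_has_sum[of g x]]
  by (simp add: charged_def coef_add distrib_right infsumI cong: infsum_cong)

lemma charged_cmult: "f \<in> dual sc X \<Longrightarrow> charged (\<lambda>x. c * f x) x = c * charged f x"
  using has_sum_cmult_right[OF charged_has_sum[of f x], of c]
  by (simp add: charged_def coef_cmult mult.assoc infsumI cong: infsum_cong)

lemma charged_dual:
  assumes f: "f \<in> dual sc X"
  shows "charged f \<in> dual sc X"
proof (rule dualI)
  fix x y assume xy: "x \<in> X" "y \<in> X"
  have "((\<lambda>s. coef s f * p s x + coef s f * p s y) has_sum (charged f x + charged f y)) S"
    by (intro has_sum_add charged_has_sum f)
  then have "((\<lambda>s. coef s f * p s (x + y)) has_sum (charged f x + charged f y)) S"
    using xy p_dual by (simp add: dual_add distrib_left cong: has_sum_cong)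
  then show "charged f (x + y) = charged f x + charged f y"
    using charged_has_sum[OF f] has_sum_unique by blast
next
  fix c x assume x: "x \<in> X"
  have "((\<lambda>s. c * (coef s f * p s x)) has_sum (c * charged f x)) S"
    by (intro has_sum_cmult_right charged_has_sum f)
  then have "((\<lambda>s. coef s f * p s (sc c x)) has_sum (c * charged f x)) S"
    using x p_dual by (simp add: dual_sc mult.left_commute cong: has_sum_cong)
  then show "charged f (sc c x) = c * charged f x"
    using charged_has_sum[OF f] has_sum_unique by blast
qed (use charged_le[OF f] in \<open>auto simp: charged_def point_functional_def\<close>)

definition uncharged where "uncharged f = (\<lambda>x. f x - charged f x)"

lemma uncharged_dual: "f \<in> dual sc X \<Longrightarrow> uncharged f \<in> dual sc X"
  unfolding uncharged_def by (intro dual_minus charged_dual)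

text \<open>For a large finite set \<open>F\<close> containing \<open>s\<close>, the functional differs by little from \<open>f\<close> minus its partial
  sum over \<open>F\<close>, and the latter has no part along \<open>p s\<close>.\<close>

lemma coef_uncharged:
  assumes f: "f \<in> dual sc X" and s: "s \<in> S"
  shows "coef s (uncharged f) = 0"
proof -
  have "norm (coef s (uncharged f)) \<le> e" if e: "0 < e" for e
  proof -
    have "\<forall>\<^sub>F G in finite_subsets_at_top S. charge f - e < (\<Sum>s\<in>G. norm (coef s f))"
      using order_tendstoD(1)[OF charge_has_sum[OF f, unfolded has_sum_def], of "charge f - e"] e
      by simp
    then have "\<exists>F0. finite F0 \<and> F0 \<subseteq> S \<and> (\<forall>G. finite G \<and> F0 \<subseteq> G \<and> G \<subseteq> S \<longrightarrow>
        charge f - e < (\<Sum>s\<in>G. norm (coef s f)))"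
      by (simp only: eventually_finite_subsets_at_top)
    then obtain F0 where F0: "finite F0" "F0 \<subseteq> S"
      "\<And>G. finite G \<Longrightarrow> F0 \<subseteq> G \<Longrightarrow> G \<subseteq> S \<Longrightarrow> charge f - e < (\<Sum>s\<in>G. norm (coef s f))"
      by metis
    define F where "F = insert s F0"
    have F: "finite F" "F \<subseteq> S" "s \<in> F" "charge f - e < (\<Sum>s\<in>F. norm (coef s f))"
      using F0(1,2) s by (auto simp: F_def intro!: F0(3))
    let ?t = "\<lambda>x. charged f x - partial F f x" and ?r = "\<lambda>x. f x - partial F f x"
    have t: "?t \<in> dual sc X" and r: "?r \<in> dual sc X"
      using F f by (auto intro!: dual_minus charged_dual partial_dual rest_dual)
    have "uncharged f = (\<lambda>x. ?r x - ?t x)" by (auto simp: uncharged_def)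
    then have "coef s (uncharged f) = - coef s ?t"
      using coef_diff[OF s r t] coef_rest[OF F(1,2) s f] F(3) by simp
    then have "norm (coef s (uncharged f)) \<le> dual_norm X ?t" using coef_le[OF s t] by simp
    also have "\<dots> \<le> charge f - (\<Sum>s\<in>F. norm (coef s f))"
      using charged_tail[OF f _ F(1,2)] sum_coef_le_charge[OF f F(1,2)]
      by (intro dual_norm_le_mult) auto
    finally show ?thesis using F(4) by simp
  qed
  then have "norm (coef s (uncharged f)) \<le> 0" by (rule field_le_epsilon[of _ 0, simplified])
  then show ?thesis by simp
qed

lemma uncharged_eq_self:
  assumes "\<And>s. s \<in> S \<Longrightarrow> coef s f = 0"
  shows "uncharged f = f"
  using assms by (simp add: uncharged_def charged_def cong: infsum_cong)

lemma L_projection_uncharged: "L_projection sc X uncharged"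
  unfolding L_projection_def
proof (intro conjI ballI allI)
  fix f assume f: "f \<in> dual sc X"
  show "uncharged f \<in> dual sc X" using f by (rule uncharged_dual)
  show "uncharged (uncharged f) = uncharged f"
    using coef_uncharged[OF f] by (rule uncharged_eq_self)
  show "uncharged (\<lambda>x. c * f x) = (\<lambda>x. c * uncharged f x)" for c
    by (simp add: uncharged_def charged_cmult[OF f] right_diff_distrib)
  have "dual_norm X (uncharged f) \<le> dual_norm X f - charge f"
    using uncharged_le[OF f] charge_le[OF f] by (intro dual_norm_le_mult) (auto simp: uncharged_def)
  moreover have "dual_norm X (charged f) \<le> charge f"
    using charged_le[OF f] charge_nonneg[OF f] by (intro dual_norm_le_mult)
  moreover have "(\<lambda>x. f x - uncharged f x) = charged f" by (auto simp: uncharged_def)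
  moreover have "dual_norm X f \<le> dual_norm X (uncharged f) + dual_norm X (charged f)"
    using dual_norm_triangle[OF uncharged_dual[OF f] charged_dual[OF f]] by (simp add: uncharged_def)
  ultimately show "dual_norm X f = dual_norm X (uncharged f) + dual_norm X (\<lambda>x. f x - uncharged f x)"
    by simp
next
  fix f g assume "f \<in> dual sc X" "g \<in> dual sc X"
  then show "uncharged (\<lambda>x. f x + g x) = (\<lambda>x. uncharged f x + uncharged g x)"
    by (simp add: uncharged_def charged_add fun_eq_iff)
qed

text \<open>If only finitely many \<open>|p s x|\<close> exceeded \<open>1 - d\<close>, no functional of norm 1 without atoms could
  exceed \<open>1 - d\<close> at \<open>x\<close>, by the lemma at the beginning of this section; so \<open>x\<close> would not have summand
  norm 1.\<close>

theorem convex_DLD2P_from_uncharged: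
  assumes f: "f \<in> dual sc X" "f \<noteq> (\<lambda>x. 0)" "\<And>s. s \<in> S \<Longrightarrow> coef s f = 0"
  shows "convex_DLD2P sc X"
proof (rule convex_DLD2P_criterion[OF L_projection_uncharged f(1)])
  interpret L_projected sc X uncharged by unfold_locales (rule L_projection_uncharged)
  show "uncharged f \<noteq> (\<lambda>x. 0)" using f uncharged_eq_self by simp
  fix x and e :: real assume x: "x \<in> X" "norm x = 1" "snorm x = 1" and e: "0 < e"
  define d where "d = min e 1"
  let ?F = "{s \<in> S. 1 - d < norm (p s x)}"
  have "infinite ?F"
  proof
    assume fin: "finite ?F"
    have "snorm x \<le> 1 - d"
    proof (rule snorm_least)
      fix g assume g: "g \<in> dual sc X" "uncharged g = g" "dual_norm X g \<le> 1"
      show "norm (g x) \<le> 1 - d"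
        using fin _ x(1)
      proof (rule uncharging_functional_le)
        show "coef s g = 0" if "s \<in> ?F" for s using coef_uncharged[OF g(1)] g(2) that by auto
      qed (use g in \<open>auto simp: d_def\<close>)
    qed
    then show False using x(3) e by (simp add: d_def min_def split: if_splits)
  qed
  then show "infinite {s \<in> S. 1 - e < norm (p s x)}"
    by (rule infinite_super[rotated]) (auto simp: d_def)
qed

end

section \<open>The three sufficient conditions\<close>

text \<open>A finite tail would have an upper bound in the tail, which would be a greatest element.\<close>

lemma infinite_tail:
  assumes I: "directed_set I le" and no_max: "\<not> (\<exists>m\<in>I. \<forall>a\<in>I. le a m)" and a: "a \<in> I"
  shows "infinite {b \<in> I. le a b}"
proof
  assume fin: "finite {b \<in> I. le a b}"
  have dir: "\<And>a b. a \<in> I \<Longrightarrow> b \<in> I \<Longrightarrow> \<exists>c\<in>I. le a c \<and> le b c"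
    and trans: "\<And>a b c. a \<in> I \<Longrightarrow> b \<in> I \<Longrightarrow> c \<in> I \<Longrightarrow> le a b \<Longrightarrow> le b c \<Longrightarrow> le a c"
    and refl: "\<And>a. a \<in> I \<Longrightarrow> le a a"
    using I unfolding directed_set_def by blast+
  have "\<exists>m\<in>I. le a m \<and> (\<forall>b\<in>T. le b m)" if "finite T" "T \<subseteq> {b \<in> I. le a b}" for T
    using that
  proof (induction T rule: finite_induct)
    case empty
    then show ?case using a refl by blast
  next
    case (insert b T)
    then obtain m where m: "m \<in> I" "le a m" "\<And>b. b \<in> T \<Longrightarrow> le b m" by auto
    have bI: "b \<in> I" using insert.prems by simp
    obtain m' where m': "m' \<in> I" "le m m'" "le b m'" using dir[OF m(1) bI] by (elim bexE conjE)
    have "le c m'" if "c \<in> insert b T" for c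
    proof (cases "c = b")
      case False
      then have "c \<in> T" using that by simp
      then show ?thesis using insert.prems by (intro trans[OF _ m(1) m'(1) m(3) m'(2)]) auto
    qed (simp add: m')
    moreover have "le a m'" by (rule trans[OF a m(1) m'(1) m(2) m'(2)])
    ultimately show ?case using m'(1) by (intro bexI[of _ m']) auto
  qed
  from this[OF fin subset_refl] obtain m where m: "m \<in> I" "\<And>b. b \<in> I \<Longrightarrow> le a b \<Longrightarrow> le b m"
    by auto
  have "le c m" if c: "c \<in> I" for c
  proof -
    obtain d where d: "d \<in> I" "le a d" "le c d" using dir[OF a c] by (elim bexE conjE)
    then show ?thesis by (intro trans[OF c d(1) m(1) d(3)] m(2))
  qed
  then show False using no_max m(1) by blast
qed

lemma (in normed_subspace) finitely_spanned_if_separated: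
  assumes "finite F" "vs.subspace Y" "Y \<subseteq> X" "\<And>s. s \<in> F \<Longrightarrow> f s \<in> dual sc X"
    and "\<And>y. y \<in> Y \<Longrightarrow> (\<And>s. s \<in> F \<Longrightarrow> f s y = 0) \<Longrightarrow> y = 0"
  shows "\<exists>B. finite B \<and> Y = vs.span B"
  using assms
proof (induction F arbitrary: Y rule: finite_induct)
  case empty
  then have "Y = {0}" using vs.subspace_0[OF empty.prems(1)] by auto
  then show ?case by (intro exI[of _ "{}"]) simp
next
  case (insert s F)
  note Y = insert.prems(1) and YX = insert.prems(2) and fs = insert.prems(3) and sep = insert.prems(4)
  show ?case
  proof (cases "\<forall>y\<in>Y. f s y = 0")
    case True
    show ?thesis
    proof (rule insert.IH[OF Y YX])
      show "f t \<in> dual sc X" if "t \<in> F" for t using fs that by blast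
      show "y = 0" if "y \<in> Y" "\<And>t. t \<in> F \<Longrightarrow> f t y = 0" for y
        using that True by (intro sep) auto
    qed
  next
    case False
    then obtain e where e: "e \<in> Y" "f s e \<noteq> 0" by blast
    have s: "f s \<in> dual sc X" using fs by blast
    let ?Y = "{y \<in> Y. f s y = 0}"
    have subspaceY: "vs.subspace ?Y"
      using Y YX s by (auto simp: vs.subspace_def dual_0 dual_add dual_sc subset_iff)
    have "\<exists>B. finite B \<and> ?Y = vs.span B"
    proof (rule insert.IH[OF subspaceY])
      show "f t \<in> dual sc X" if "t \<in> F" for t using fs that by blast
      show "y = 0" if "y \<in> ?Y" "\<And>t. t \<in> F \<Longrightarrow> f t y = 0" for y
        using that by (intro sep) auto
    qed (use YX in auto)
    then obtain B where B: "finite B" "?Y = vs.span B" by blast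
    have "Y = vs.span (insert e B)"
    proof
      show "vs.span (insert e B) \<subseteq> Y"
        using e B vs.span_superset[of B] Y by (intro vs.span_minimal) auto
      show "Y \<subseteq> vs.span (insert e B)"
      proof
        fix y assume y: "y \<in> Y"
        define c where "c = f s y / f s e"
        have "y - sc c e \<in> Y" using y e Y by (intro vs.subspace_diff vs.subspace_scale)
        moreover have "f s (y - sc c e) = 0"
          using y e YX s sc_mem by (simp add: dual_diff dual_sc subset_iff c_def)
        ultimately have "y - sc c e \<in> vs.span (insert e B)"
          using B vs.span_mono[of B "insert e B"] by blast
        moreover have "sc c e \<in> vs.span (insert e B)"
          by (intro vs.span_scale vs.span_base) simp
        ultimately have "y - sc c e + sc c e \<in> vs.span (insert e B)" by (rule vs.span_add)
        then show "y \<in> vs.span (insert e B)" by simp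
      qed
    qed
    then show ?thesis using B(1) by blast
  qed
qed

text \<open>The Banach-Alaoglu theorem.\<close>

lemma (in normed_subspace) compact_dual_ball:
  "compact {f. (\<forall>x\<in>X. \<forall>y\<in>X. f (x + y) = f x + f y) \<and> (\<forall>c. \<forall>x\<in>X. f (sc c x) = c * f x) \<and>
      (\<forall>x\<in>X. norm (f x) \<le> norm x) \<and> (\<forall>x. x \<notin> X \<longrightarrow> f x = 0)}" (is "compact ?D")
proof -
  have "?D = (\<Inter>x\<in>X. \<Inter>y\<in>X. {f. f (x + y) = f x + f y}) \<inter> (\<Inter>c. \<Inter>x\<in>X. {f. f (sc c x) = c * f x}) \<inter>
      (\<Inter>x\<in>X. {f. norm (f x) \<le> norm x}) \<inter> (\<Inter>x\<in>-X. {f. f x = 0})" by auto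
  also have "closed \<dots>"
    by (intro closed_Int closed_INT ballI closed_Collect_eq closed_Collect_le continuous_intros
        continuous_on_product_coordinates)
  finally have "closed ?D" .
  moreover have "compact (\<Pi>\<^sub>E x\<in>UNIV. cball (0::'k) (norm (x::'v)))"
  proof -
    have "compactin (product_topology (\<lambda>_. euclidean) UNIV) (\<Pi>\<^sub>E x\<in>UNIV. cball (0::'k) (norm (x::'v)))"
      by (simp add: compactin_PiE)
    then show ?thesis by (simp add: euclidean_product_topology)
  qed
  ultimately have "compact ((\<Pi>\<^sub>E x\<in>UNIV. cball 0 (norm x)) \<inter> ?D)" by (intro compact_Int_closed)
  moreover have "(\<Pi>\<^sub>E x\<in>UNIV. cball 0 (norm x)) \<inter> ?D = ?D"
  proof -
    have "norm (f x) \<le> norm x" if "f \<in> ?D" for f x using that by (cases "x \<in> X") auto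
    then show ?thesis by (auto simp: PiE_UNIV_domain)
  qed
  ultimately show ?thesis by (simp only:)
qed

context nicely_embedded
begin

lemma infinite_S:
  assumes "infinite_dimensional sc X"
  shows "infinite S"
proof
  assume fin: "finite S"
  have "\<exists>B. finite B \<and> X = vs.span B"
    using fin subspace subset_refl p_dual
  proof (rule finitely_spanned_if_separated)
    fix y assume y: "y \<in> X" "\<And>s. s \<in> S \<Longrightarrow> p s y = 0"
    show "y = 0"
    proof (rule ccontr)
      assume "y \<noteq> 0"
      then obtain s where "s \<in> S" "0 < norm (p s y)" using p_norming[of y 0] y(1) by auto
      then show False using y(2) by simp
    qed
  qed
  then show False using assms by (simp add: infinite_dimensional_def)
qed

text \<open>A neighbourhood of \<open>p s\<close> contains a tail of the net, and hence infinitely many of the functionals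
  \<open>p t\<close>.\<close>

theorem convex_DLD2P_if_convergent_net:
  assumes I: "directed_set I le" "\<not> (\<exists>m\<in>I. \<forall>a\<in>I. le a m)"
    and \<sigma>: "\<sigma> ` I \<subseteq> S" "inj_on (\<lambda>a. p (\<sigma> a)) I"
    and s: "s \<in> S" "net_converges (weak_star sc X) I le (\<lambda>a. p (\<sigma> a)) (p s)"
  shows "convex_DLD2P sc X"
proof (rule convex_DLD2P_from_accumulation[OF s(1)])
  fix x and e :: real assume x: "x \<in> X" "norm x = 1" "norm (p s x) = 1" and e: "0 < e"
  let ?U = "{f. 1 - e < norm (f x)}"
  have "open ?U"
    by (intro open_Collect_less continuous_intros continuous_on_product_coordinates)
  then have "openin (weak_star sc X) (dual sc X \<inter> ?U)"
    by (auto simp: weak_star_def openin_subtopology)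
  moreover have "p s \<in> dual sc X \<inter> ?U" using x e p_dual[OF s(1)] by simp
  ultimately obtain a where a: "a \<in> I" "\<And>b. b \<in> I \<Longrightarrow> le a b \<Longrightarrow> p (\<sigma> b) \<in> dual sc X \<inter> ?U"
    using s(2) unfolding net_converges_def by meson
  have "inj_on \<sigma> {b \<in> I. le a b}" using \<sigma>(2) unfolding inj_on_def by (metis (lifting) mem_Collect_eq)
  then have "infinite (\<sigma> ` {b \<in> I. le a b})"
    using infinite_tail[OF I a(1)] by (simp add: finite_image_iff)
  then show "infinite {t \<in> S. 1 - e < norm (p t x)}"
    by (rule infinite_super[rotated]) (use a \<sigma> in auto)
qed

text \<open>Otherwise every \<open>p s\<close> has a weak-star neighbourhood that contains only finitely many of the
  functionals \<open>p t\<close>, and compactness would make \<open>S\<close> finite.\<close>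

theorem convex_DLD2P_if_closed:
  assumes inf: "infinite_dimensional sc X" and closed: "closedin (weak_star sc X) (p ` S)"
  shows "convex_DLD2P sc X"
proof (rule ccontr)
  assume not: "\<not> convex_DLD2P sc X"
  have "\<forall>s\<in>S. \<exists>x e. norm (p s x) = 1 \<and> 0 < e \<and> finite {t \<in> S. 1 - e < norm (p t x)}"
  proof (rule ballI, rule ccontr)
    fix s assume s: "s \<in> S"
      and no: "\<nexists>x e. norm (p s x) = 1 \<and> 0 < e \<and> finite {t \<in> S. 1 - e < norm (p t x)}"
    have "convex_DLD2P sc X" by (rule convex_DLD2P_from_accumulation[OF s]) (use no in simp)
    then show False using not by simp
  qed
  from bchoice[OF this] obtain x where
    "\<forall>s\<in>S. \<exists>e. norm (p s (x s)) = 1 \<and> 0 < e \<and> finite {t \<in> S. 1 - e < norm (p t (x s))}" ..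
  from bchoice[OF this] obtain e where
    "\<forall>s\<in>S. norm (p s (x s)) = 1 \<and> 0 < e s \<and> finite {t \<in> S. 1 - e s < norm (p t (x s))}" ..
  then have xe: "\<And>s. s \<in> S \<Longrightarrow> norm (p s (x s)) = 1" "\<And>s. s \<in> S \<Longrightarrow> 0 < e s"
    "\<And>s. s \<in> S \<Longrightarrow> finite {t \<in> S. 1 - e s < norm (p t (x s))}" by simp_all
  let ?D = "{f. (\<forall>x\<in>X. \<forall>y\<in>X. f (x + y) = f x + f y) \<and> (\<forall>c. \<forall>x\<in>X. f (sc c x) = c * f x) \<and>
      (\<forall>x\<in>X. norm (f x) \<le> norm x) \<and> (\<forall>x. x \<notin> X \<longrightarrow> f x = 0)}"
  obtain T where T: "closed T" "p ` S = dual sc X \<inter> T"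
    using closed unfolding weak_star_def closedin_subtopology by (auto simp: Int_commute)
  have "p ` S \<subseteq> ?D"
    using p_dual norm_p_le by (auto simp: dual_add dual_sc dual_outside)
  moreover have "?D \<subseteq> dual sc X"
  proof (rule subsetI)
    fix f assume "f \<in> ?D"
    then show "f \<in> dual sc X" by (intro dualI[where C=1]) simp_all
  qed
  ultimately have "p ` S = ?D \<inter> T"
    unfolding T(2) by (intro equalityI Int_greatest Int_mono Int_lower2 subset_refl)
  then have "compact (p ` S)" using compact_dual_ball T(1) by (simp only: compact_Int_closed)
  moreover have "open {f. 1 - e s < norm (f (x s))}" for s
    by (intro open_Collect_less continuous_intros continuous_on_product_coordinates)
  moreover have "p ` S \<subseteq> (\<Union>s\<in>S. {f. 1 - e s < norm (f (x s))})"
    using xe(1,2) by force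
  ultimately obtain S' where S': "S' \<subseteq> S" "finite S'"
    "p ` S \<subseteq> (\<Union>s\<in>S'. {f. 1 - e s < norm (f (x s))})"
    by (rule compactE_image) auto
  then have "S \<subseteq> (\<Union>s\<in>S'. {t \<in> S. 1 - e s < norm (p t (x s))})" by auto
  moreover have "finite (\<Union>s\<in>S'. {t \<in> S. 1 - e s < norm (p t (x s))})"
    using S' xe(3) by (intro finite_UN_I) auto
  ultimately have "finite S" by (rule finite_subset)
  then show False using infinite_S[OF inf] by simp
qed

text \<open>The unique norming functional \<open>f\<close> of \<open>x0\<close> is an extreme point of the dual ball; so it is
  either annihilated by all L-projections onto the lines \<open>K p s\<close>, or a multiple of some \<open>p s\<close>. In the
  second case suppose that \<open>|p t x| > 1 - e\<close> only for finitely many \<open>t\<close>, where \<open>|p s x| = 1\<close>, and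
  normalise \<open>f x = 1\<close>. The \<open>\<Delta>\<close>-point \<open>x0\<close> is almost normed by some further \<open>p t\<close>, so that
  \<open>\<parallel>\<tau> x0 + (x0 - x)\<parallel> \<ge> \<tau> + e\<close> for all \<open>\<tau> \<ge> 0\<close>; by the Hahn-Banach theorem some norming functional of
  \<open>x0\<close> is at least \<open>e\<close> at \<open>x0 - x\<close>, whereas \<open>f (x0 - x) = 0\<close>.\<close>

theorem convex_DLD2P_if_smooth_Delta_point:
  assumes x0: "x0 \<in> Delta_points sc X" and smooth: "smooth_at sc X x0"
  shows "convex_DLD2P sc X"
proof -
  have x0X: "x0 \<in> X" "norm x0 = 1" using x0 by (auto simp: Delta_points_def unit_sphere_def)
  obtain f where f: "f \<in> dual sc X" "dual_norm X f = 1" "f x0 = 1"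
    and "\<And>g. g \<in> dual sc X \<and> dual_norm X g = 1 \<and> g x0 = 1 \<Longrightarrow> g = f"
    using smooth unfolding smooth_at_def by blast
  then have uniq: "g = f" if "g \<in> dual sc X" "dual_norm X g \<le> 1" "g x0 = 1" for g
    using norm_le_dual_norm[OF that(1) x0X(1)] that x0X(2) by auto
  show ?thesis
  proof (cases "\<forall>s\<in>S. coef s f = 0")
    case True
    then show ?thesis using f by (intro convex_DLD2P_from_uncharged[OF f(1)]) auto
  next
    case False
    then obtain s where s: "s \<in> S" "coef s f \<noteq> 0" by blast
    define c where "c = coef s f"
    define \<theta> where "\<theta> = c / of_real (norm c)"
    have c: "0 < norm c" using s by (simp add: c_def)
    have \<theta>: "norm \<theta> = 1" using c by (simp add: \<theta>_def norm_divide)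
    have "norm (f x0 - c * p s x0) \<le> dual_norm X (\<lambda>x. f x - c * p s x) * norm x0"
      by (rule norm_le_dual_norm[OF dual_minus[OF f(1) dual_cmult_p[OF s(1)]] x0X(1)])
    then have "norm (f x0 - c * p s x0) \<le> 1 - norm c"
      using coef_split[OF s(1) f(1)] f(2) x0X(2) by (simp add: c_def)
    then have re_ge: "norm c \<le> re (c * p s x0)" using re_le[of "f x0 - c * p s x0"] f(3) by simp
    moreover have n_le: "norm (c * p s x0) \<le> norm c"
      using norm_p_le[OF x0X(1) s(1)] x0X(2) c by (simp add: norm_mult mult_le_cancel_left1)
    ultimately have "c * p s x0 = of_real (norm (c * p s x0))"
      by (intro eq_norm_if_re_ge_norm) simp
    moreover have "norm (c * p s x0) = norm c" using re_ge n_le re_le[of "c * p s x0"] by linarith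
    ultimately have "\<theta> * p s x0 = 1" using c by (simp add: \<theta>_def)
    then have f_eq: "(\<lambda>x. \<theta> * p s x) = f"
      using dual_norm_cmult_p[OF s(1)] \<theta> by (intro uniq dual_cmult_p s(1)) auto
    have norm_f: "norm (f x) = norm (p s x)" for x using \<theta> by (simp add: norm_mult flip: f_eq)
    have other: "norm (p t x0) < 1" if t: "t \<in> S" "t \<noteq> s" for t
    proof (rule ccontr)
      assume "\<not> norm (p t x0) < 1"
      then have n1: "norm (p t x0) = 1" using norm_p_le[OF x0X(1) t(1)] x0X(2) by simp
      then have "p t x0 \<noteq> 0" by auto
      then have "(\<lambda>x. inverse (p t x0) * p t x) = f"
        using n1 dual_norm_cmult_p[OF t(1)]
        by (intro uniq dual_cmult_p t(1)) (auto simp: norm_inverse)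
      then have "inverse (p t x0) * p t x = \<theta> * p s x" for x using f_eq by metis
      then have "\<forall>x. inverse (p t x0) * p t x + (- \<theta>) * p s x = 0" by simp
      then have "- \<theta> = 0" using indep t s(1) unfolding pairwise_independent_def by blast
      then show False using \<theta> by simp
    qed
    \<comment> \<open>points of a thin slice given by \<open>f\<close> are close to \<open>x0\<close> at \<open>p s\<close>; hence a point of the slice that
      is far from \<open>x0\<close> differs from it at some other \<open>p t\<close>\<close>
    have far: "\<exists>t\<in>S. t \<noteq> s \<and> 1 - d < norm (p t x0)" if d: "0 < d" for d
    proof -
      define \<epsilon> where "\<epsilon> = min d (1 / 2)"
      have \<epsilon>: "0 < \<epsilon>" "\<epsilon> \<le> d" "\<epsilon> \<le> 1 / 2" using d by (auto simp: \<epsilon>_def)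
      have re1: "re (f z) \<le> 1" if "z \<in> unit_ball X" for z
        using norm_le_dual_norm_ball[OF f(1), of z] that re_le[of "f z"] f(2)
        by (auto simp: unit_ball_def)
      have x0b: "x0 \<in> unit_ball X" using x0X by (simp add: unit_ball_def)
      have "(SUP z\<in>unit_ball X. re (f z)) = 1"
      proof (rule antisym)
        show "(SUP z\<in>unit_ball X. re (f z)) \<le> 1" using re1 x0b by (intro cSUP_least) auto
        have "re (f x0) \<le> (SUP z\<in>unit_ball X. re (f z))"
          by (rule cSUP_upper[OF x0b]) (use re1 in \<open>auto intro!: bdd_aboveI2\<close>)
        then show "1 \<le> (SUP z\<in>unit_ball X. re (f z))" using f(3) by simp
      qed
      then have slice: "slice X f (1 / 4) = {y \<in> unit_ball X. 3 / 4 < re (f y)}"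
        by (simp add: slice_def)
      then have "x0 \<in> slice X f (1 / 4)" using x0b f(3) by simp
      moreover have "\<forall>\<alpha>>0. x0 \<in> slice X f \<alpha> \<longrightarrow> (\<exists>y\<in>slice X f \<alpha>. 2 - \<epsilon> < norm (x0 - y))"
        using x0 f(1) \<epsilon>(1) unfolding Delta_points_def by blast
      ultimately have "\<exists>y\<in>slice X f (1 / 4). 2 - \<epsilon> < norm (x0 - y)" by simp
      then obtain y where "y \<in> slice X f (1 / 4)" "2 - \<epsilon> < norm (x0 - y)" by (elim bexE)
      then have y: "y \<in> X" "norm y \<le> 1" "3 / 4 < re (f y)" "2 - \<epsilon> < norm (x0 - y)"
        by (auto simp: slice unit_ball_def)
      obtain t where t: "t \<in> S" "2 - \<epsilon> < norm (p t (x0 - y))"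
        using p_norming[of "x0 - y" "2 - \<epsilon>"] y x0X \<epsilon> by auto
      have "norm (p t (x0 - y)) \<le> norm (p t x0) + norm (p t y)"
        using t(1) p_dual x0X y by (simp add: dual_diff norm_triangle_ineq4)
      then have "1 - d < norm (p t x0)" using t norm_p_le[OF y(1) t(1)] y(2) \<epsilon> by simp
      moreover have "t \<noteq> s"
      proof
        assume "t = s"
        then have "3 / 2 < norm (1 - f y)"
          using t(2) \<epsilon> f x0X y by (simp add: norm_f[symmetric] dual_diff)
        then have "(3 / 2)\<^sup>2 < (norm (1 - f y))\<^sup>2" by (intro power_strict_mono) auto
        moreover have "(norm (f y))\<^sup>2 \<le> 1"
          using norm_le_dual_norm_ball[OF f(1) y(1,2)] f(2) by (simp add: power_le_one)
        ultimately show False using y(3) unfolding norm_1_diff_sq by (simp add: power_divide)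
      qed
      ultimately show ?thesis using t(1) by blast
    qed
    show ?thesis
    proof (rule convex_DLD2P_from_accumulation[OF s(1)], rule notI)
      fix x and e :: real
      assume x: "x \<in> X" "norm x = 1" "norm (p s x) = 1" and e: "0 < e"
        and fin: "finite {t \<in> S. 1 - e < norm (p t x)}"
      define x' where "x' = sc (inverse (f x)) x"
      have n1: "norm (f x) = 1" using x by (simp add: norm_f)
      then have "f x \<noteq> 0" by auto
      then have x': "x' \<in> X" "f x' = 1" "\<And>t. t \<in> S \<Longrightarrow> norm (p t x') = norm (p t x)"
        using x f n1 p_dual by (auto simp: x'_def dual_sc norm_mult norm_inverse)
      let ?F = "{t \<in> S. 1 - e < norm (p t x)} - {s}"
      obtain e2 where e2: "0 < e2" "\<And>t. t \<in> ?F \<Longrightarrow> norm (p t x0) \<le> 1 - e2"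
      proof (cases "?F = {}")
        case True
        then show ?thesis using that[of 1] by auto
      next
        case False
        define M where "M = Max ((\<lambda>t. norm (p t x0)) ` ?F)"
        have finF: "finite ?F" using fin by simp
        have "M \<in> (\<lambda>t. norm (p t x0)) ` ?F" unfolding M_def using False finF by (intro Max_in) auto
        then have "M < 1" using other by auto
        moreover have "norm (p t x0) \<le> M" if "t \<in> ?F" for t
          unfolding M_def using that finF by (intro Max_ge) auto
        ultimately show ?thesis using that[of "1 - M"] by auto
      qed
      let ?v = "x0 - x'"
      have v: "?v \<in> X" using x0X x' by blast
      have "e \<le> tilt norm x0 ?v"
      proof (rule tilt_ge[OF sublinear_norm], rule field_le_epsilon)
        fix \<tau> \<delta> :: real assume \<tau>: "0 \<le> \<tau>" and \<delta>: "0 < \<delta>"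
        define d where "d = min e2 (\<delta> / (1 + \<tau>))"
        have d: "0 < d" "d \<le> e2" "d \<le> \<delta> / (1 + \<tau>)" using e2(1) \<tau> \<delta> by (auto simp: d_def)
        have d_le: "(1 + \<tau>) * d \<le> \<delta>" using d(3) \<tau> by (simp add: pos_le_divide_eq mult.commute)
        obtain t where t: "t \<in> S" "t \<noteq> s" "1 - d < norm (p t x0)" using far[OF d(1)] by blast
        have "t \<notin> ?F" using e2(2)[of t] t(3) d(2) by auto
        then have tx: "norm (p t x') \<le> 1 - e" using t x'(3) by auto
        have eq: "?v + \<tau> *\<^sub>R x0 = (1 + \<tau>) *\<^sub>R x0 - x'" by (simp add: scaleR_left_distrib)
        have "p t (?v + \<tau> *\<^sub>R x0) = of_real (1 + \<tau>) * p t x0 - p t x'"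
          unfolding eq using p_dual[OF t(1)] x0X(1) x'(1)
          by (simp add: dual_diff dual_scaleR scaleR_mem del: of_real_add)
        then have "norm (of_real (1 + \<tau>) * p t x0) - norm (p t x') \<le> norm (p t (?v + \<tau> *\<^sub>R x0))"
          by (simp add: norm_triangle_ineq2)
        also have "\<dots> \<le> norm (?v + \<tau> *\<^sub>R x0)" using v x0X t(1) by (intro norm_p_le) auto
        finally have "(1 + \<tau>) * norm (p t x0) - norm (p t x') \<le> norm (?v + \<tau> *\<^sub>R x0)"
          using \<tau> by (simp add: norm_mult del: of_real_add)
        moreover have "(1 + \<tau>) * (1 - d) \<le> (1 + \<tau>) * norm (p t x0)"
          using t(3) \<tau> by (intro mult_left_mono) auto
        ultimately show "e \<le> norm (?v + \<tau> *\<^sub>R x0) - \<tau> * norm x0 + \<delta>"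
          using d_le tx x0X(2) by (simp add: algebra_simps)
      qed
      obtain F where F: "linear F" "\<And>x. F x \<le> tilt norm x0 x" "F ?v = tilt norm x0 ?v"
        using Hahn_Banach_sublinear_at[OF sublinear_tilt[OF sublinear_norm]] by blast
      have F_le: "F y \<le> norm y" for y
        using F(2)[of y] tilt_le_self[OF sublinear_norm, of x0 y] by linarith
      obtain g where g: "g \<in> dual sc X" "\<And>y. y \<in> X \<Longrightarrow> re (g y) = F y" "dual_norm X g \<le> 1"
      proof (rule dual_of_real_functional[of F 1])
        show "F y \<le> 1 * norm y" for y using F_le[of y] by simp
      qed (use F(1) in \<open>auto simp: linear_add linear_scale\<close>)
      have "F (- x0) \<le> - norm x0"
        using F(2)[of "- x0"] tilt_neg[OF sublinear_norm, of x0] by linarith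
      then have re1: "1 \<le> re (g x0)" using g(2)[OF x0X(1)] F(1) x0X(2) by (simp add: linear_neg)
      moreover have "norm (g x0) \<le> 1"
        using norm_le_dual_norm_ball[OF g(1) x0X(1)] x0X(2) g(3) by simp
      ultimately have "g x0 = of_real (norm (g x0))" "norm (g x0) = 1"
        using re_le[of "g x0"] by (auto intro: eq_norm_if_re_ge_norm)
      then have "g = f" using g by (intro uniq) auto
      then have "F ?v = 0" using g(2)[OF v] f x0X x' by (simp add: dual_diff)
      then show False using F(3) \<open>e \<le> tilt norm x0 ?v\<close> e by simp
    qed
  qed
qed

end

section \<open>Representing functionals and the Choquet boundary\<close>

context normed_subspace
begin

lemma subspace_UNIV: "normed_subspace sc UNIV"
  by unfold_locales (simp_all add: normed)

text \<open>The Hahn-Banach extension theorem, from the bounds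
  \<open>N \<parallel>v - x\<parallel> + re (f x)\<close> with \<open>x \<in> X\<close> for the value at \<open>v\<close>, where \<open>N\<close> is the norm of \<open>f\<close>.\<close>

theorem norm_preserving_extension:
  assumes f: "f \<in> dual sc X"
  obtains \<Phi> where "\<Phi> \<in> dual sc UNIV" "\<And>x. x \<in> X \<Longrightarrow> \<Phi> x = f x"
    "dual_norm UNIV \<Phi> \<le> dual_norm X f"
proof -
  interpret U: normed_subspace sc UNIV by (rule subspace_UNIV)
  define N where "N = dual_norm X f"
  have N: "0 \<le> N" using dual_norm_nonneg[OF f] by (simp add: N_def)
  have re_f: "re (f x) \<le> N * norm x" if "x \<in> X" for x
    using norm_le_dual_norm[OF f that] re_le[of "f x"] by (simp add: N_def)
  define R where "R = {(v, r). \<exists>x\<in>X. N * norm (v - x) + re (f x) \<le> r}"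
  have RI: "(v, N * norm (v - x) + re (f x)) \<in> R" if "x \<in> X" for v x
    using that by (auto simp: R_def)
  have R: "bound_cone R"
  proof (rule bound_coneI)
    show "(0, 0) \<in> R" using RI[OF zero_mem, of 0] f by (simp add: dual_0)
    show "(v + w, r + s) \<in> R" if vr: "(v, r) \<in> R" and ws: "(w, s) \<in> R" for v r w s
    proof -
      obtain x y where xy: "x \<in> X" "y \<in> X" "N * norm (v - x) + re (f x) \<le> r"
        "N * norm (w - y) + re (f y) \<le> s" using vr ws by (auto simp: R_def)
      have "N * norm ((v + w) - (x + y)) \<le> N * (norm (v - x) + norm (w - y))"
        using norm_triangle_ineq[of "v - x" "w - y"] N by (intro mult_left_mono) (simp add: algebra_simps)
      then have "N * norm ((v + w) - (x + y)) + re (f (x + y)) \<le> r + s"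
        using xy f by (simp add: dual_add algebra_simps)
      then show ?thesis unfolding R_def using add_mem[OF xy(1,2)] by blast
    qed
    show "(t *\<^sub>R v, t * r) \<in> R" if vr: "(v, r) \<in> R" and t: "0 < t" for v r t
    proof -
      obtain x where x: "x \<in> X" "N * norm (v - x) + re (f x) \<le> r" using vr by (auto simp: R_def)
      have "norm (t *\<^sub>R v - t *\<^sub>R x) = t * norm (v - x)" using t by (simp flip: scaleR_diff_right)
      then have "N * norm (t *\<^sub>R v - t *\<^sub>R x) + re (f (t *\<^sub>R x)) = t * (N * norm (v - x) + re (f x))"
        using f x(1) by (simp add: dual_scaleR algebra_simps)
      also have "\<dots> \<le> t * r" using x(2) t by (intro mult_left_mono) auto
      finally show ?thesis unfolding R_def using scaleR_mem[OF x(1)] by blast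
    qed
    show "0 \<le> r" if "(0, r) \<in> R" for r
    proof -
      obtain x where x: "x \<in> X" "N * norm x + re (f x) \<le> r" using \<open>(0, r) \<in> R\<close> by (auto simp: R_def)
      then show ?thesis
        using re_f[OF scaleR_mem[OF x(1), of "-1"]] dual_scaleR[OF f x(1), of "-1"] by simp
    qed
    show "\<exists>r. (v, r) \<in> R" for v using RI[OF zero_mem] by blast
  qed
  obtain F r where "linear F" "\<forall>v r. (v, r) \<in> R \<longrightarrow> F v \<le> r" "(0, r) \<in> R" "r < F 0 + 1"
    by (rule Hahn_Banach_cone[OF R zero_less_one])
  then have F: "linear F" "\<And>x v. x \<in> X \<Longrightarrow> F v \<le> N * norm (v - x) + re (f x)"
    using RI by auto
  obtain \<Phi> where \<Phi>: "\<Phi> \<in> dual sc UNIV" "\<And>v. re (\<Phi> v) = F v" "dual_norm UNIV \<Phi> \<le> N"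
  proof (rule U.dual_of_real_functional[of F N])
    show "F v \<le> N * norm v" for v using F(2)[OF zero_mem, of v] f by (simp add: dual_0)
  qed (use F(1) N in \<open>auto simp: linear_add linear_scale\<close>)
  define g where "g x = (if x \<in> X then \<Phi> x else 0)" for x
  have g: "g \<in> dual sc X"
  proof (rule dualI)
    show "norm (g x) \<le> N * norm x" if "x \<in> X" for x
      using U.norm_le_dual_norm[OF \<Phi>(1), of x] mult_right_mono[OF \<Phi>(3), of "norm x"] that
      by (simp add: g_def)
  qed (use \<Phi>(1) add_mem sc_mem in \<open>auto simp: g_def U.dual_add U.dual_sc\<close>)
  have F_le: "F x \<le> re (f x)" if "x \<in> X" for x
    using F(2)[OF that, of x] by simp
  have "g = f"
  proof (rule dual_eqI_re[OF g f])
    fix x assume x: "x \<in> X"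
    have "F (- x) = - F x" using F(1) by (rule linear_neg)
    moreover have "f (- x) = - f x" using dual_scaleR[OF f x, of "-1"] by simp
    ultimately have "F x = re (f x)" using F_le[OF x] F_le[OF neg_mem[OF x]] by simp
    then show "re (g x) = re (f x)" using x by (simp add: g_def \<Phi>)
  qed
  then have "\<Phi> x = f x" if "x \<in> X" for x using that by (metis g_def)
  then show ?thesis using that \<Phi> by (simp add: N_def)
qed

end

definition positive :: "(('c::t2_space \<Rightarrow>\<^sub>C real) \<Rightarrow> real) \<Rightarrow> bool" where
  "positive \<Lambda> \<longleftrightarrow> linear \<Lambda> \<and> (\<forall>h. (\<forall>l. 0 \<le> apply_bcontfun h l) \<longrightarrow> 0 \<le> \<Lambda> h)"

text \<open>The support of the measure that represents \<open>\<Lambda>\<close>.\<close>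

definition supp :: "(('c::t2_space \<Rightarrow>\<^sub>C real) \<Rightarrow> real) \<Rightarrow> 'c set" where
  "supp \<Lambda> = {l. \<forall>h. (\<forall>m. 0 \<le> apply_bcontfun h m) \<longrightarrow> \<Lambda> h = 0 \<longrightarrow> apply_bcontfun h l = 0}"

definition re_fun :: "('c::t2_space \<Rightarrow>\<^sub>C 'k::rc_scalar) \<Rightarrow> 'c \<Rightarrow>\<^sub>C real" where
  "re_fun a = Bcontfun (\<lambda>l. re (a l))"

definition mult_fun :: "('c::t2_space \<Rightarrow>\<^sub>C real) \<Rightarrow> ('c \<Rightarrow>\<^sub>C 'k::real_normed_vector) \<Rightarrow> 'c \<Rightarrow>\<^sub>C 'k" where
  "mult_fun \<phi> g = Bcontfun (\<lambda>l. \<phi> l *\<^sub>R g l)"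

lemma apply_re_fun [simp]: "re_fun a l = re (a l)"
proof -
  have "(\<lambda>l. re (a l)) \<in> bcontfun"
    by (rule bcontfun_normI[where b="norm a"])
      (auto intro!: continuous_intros intro: order_trans[OF abs_re_le norm_bounded])
  then show ?thesis by (simp add: re_fun_def Bcontfun_inverse)
qed

lemma apply_mult_fun [simp]: "mult_fun \<phi> g l = \<phi> l *\<^sub>R g l"
proof -
  have "(\<lambda>l. \<phi> l *\<^sub>R g l) \<in> bcontfun"
    by (rule bcontfun_normI[where b="norm \<phi> * norm g"])
      (auto intro!: continuous_intros mult_mono order_trans[OF _ norm_bounded])
  then show ?thesis by (simp add: mult_fun_def Bcontfun_inverse)
qed

lemma apply_sum_bcontfun: "(\<Sum>i\<in>I. f i) l = (\<Sum>i\<in>I. f i l)" for f :: "'i \<Rightarrow> 'c::t2_space \<Rightarrow>\<^sub>C real"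
  by (induction I rule: infinite_finite_induct) auto

lemma le_norm_bcontfun: "h l \<le> norm h" for h :: "'c::t2_space \<Rightarrow>\<^sub>C real"
  using norm_bounded[of h l] by simp

lemma obtain_bcontfun:
  fixes f :: "'c::t2_space \<Rightarrow> 'b::real_normed_vector"
  assumes "compact (UNIV :: 'c set)" "continuous_on UNIV f"
  obtains g :: "'c \<Rightarrow>\<^sub>C 'b" where "apply_bcontfun g = f"
proof -
  have "bounded (range f)"
    using compact_continuous_image[OF assms(2,1)] by (rule compact_imp_bounded)
  then have "f \<in> bcontfun" using assms(2) by (simp add: bcontfun_def)
  then show ?thesis using that[of "Bcontfun f"] by (simp add: Bcontfun_inverse)
qed

lemma positive_mono:
  assumes "positive \<Lambda>" "\<And>l. apply_bcontfun h l \<le> apply_bcontfun h' l"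
  shows "\<Lambda> h \<le> \<Lambda> h'"
proof -
  have "0 \<le> \<Lambda> (h' - h)" using assms by (simp add: positive_def)
  then show ?thesis using assms(1) by (simp add: positive_def linear_diff)
qed

text \<open>The set where \<open>h \<ge> \<epsilon>\<close> is covered by finitely many sets on which functions with integral 0 are
  positive; so \<open>h\<close> is at most \<open>\<epsilon>\<close> plus a function with integral 0.\<close>

lemma positive_vanishes_off_supp:
  fixes \<Lambda> :: "('c::t2_space \<Rightarrow>\<^sub>C real) \<Rightarrow> real"
  assumes K: "compact (UNIV :: 'c set)" and \<Lambda>: "positive \<Lambda>"
    and h: "\<And>l. 0 \<le> apply_bcontfun h l" "\<And>l. l \<in> supp \<Lambda> \<Longrightarrow> h l = 0"
  shows "\<Lambda> h = 0"
proof -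
  have lin: "linear \<Lambda>" using \<Lambda> by (simp add: positive_def)
  let ?one = "const_bcontfun 1 :: 'c \<Rightarrow>\<^sub>C real"
  have one: "0 \<le> \<Lambda> ?one" using \<Lambda> by (simp add: positive_def)
  have "\<Lambda> h \<le> e * \<Lambda> ?one" if e: "0 < e" for e
  proof -
    define T where "T = {l. e \<le> h l}"
    have "closed T" unfolding T_def by (intro closed_Collect_le continuous_intros) auto
    then have T: "compact T" using compact_Int_closed[OF K] by simp
    have "\<exists>g. (\<forall>m. 0 \<le> apply_bcontfun g m) \<and> \<Lambda> g = 0 \<and> 0 < g l" if "l \<in> T" for l
    proof -
      have "l \<notin> supp \<Lambda>" using h(2)[of l] that e by (auto simp: T_def)
      then obtain g where "\<forall>m. 0 \<le> apply_bcontfun g m" "\<Lambda> g = 0" "g l \<noteq> 0"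
        by (auto simp: supp_def)
      then show ?thesis by (intro exI[of _ g]) (auto simp: less_le)
    qed
    then have "\<forall>l\<in>T. \<exists>g. (\<forall>m. 0 \<le> apply_bcontfun g m) \<and> \<Lambda> g = 0 \<and> 0 < g l" by blast
    from bchoice[OF this] obtain g where
      g: "\<forall>l\<in>T. (\<forall>m. 0 \<le> apply_bcontfun (g l) m) \<and> \<Lambda> (g l) = 0 \<and> 0 < g l l" ..
    have "open {m. 0 < g l m}" for l by (intro open_Collect_less continuous_intros) auto
    moreover have "T \<subseteq> (\<Union>l\<in>T. {m. 0 < g l m})" using g by auto
    ultimately obtain T' where T': "T' \<subseteq> T" "finite T'" "T \<subseteq> (\<Union>l\<in>T'. {m. 0 < g l m})"
      using compactE_image[OF T, of T "\<lambda>l. {m. 0 < g l m}"] by metis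
    define G where "G = (\<Sum>l\<in>T'. g l)"
    have \<Lambda>G: "\<Lambda> G = 0" unfolding G_def using g T' by (simp add: linear_sum[OF lin] subset_iff)
    have G0: "0 \<le> G m" for m
      unfolding G_def apply_sum_bcontfun using g T' by (intro sum_nonneg) auto
    have Gpos: "0 < G m" if m: "m \<in> T" for m
    proof -
      obtain l where l: "l \<in> T'" "0 < g l m" using T'(3) m by auto
      then show ?thesis
        unfolding G_def apply_sum_bcontfun using g T' by (intro sum_pos2[of T' l]) auto
    qed
    obtain c where c: "0 < c" "\<And>m. m \<in> T \<Longrightarrow> c \<le> G m"
    proof (cases "T = {}")
      case True
      then show ?thesis using that[of 1] by simp
    next
      case False
      have "continuous_on T (apply_bcontfun G)" by auto
      then obtain l where "l \<in> T" "\<And>m. m \<in> T \<Longrightarrow> G l \<le> G m"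
        using continuous_attains_inf[OF T False] by blast
      then show ?thesis using that[of "G l"] Gpos by blast
    qed
    have "h m \<le> (e *\<^sub>R ?one + (norm h / c) *\<^sub>R G) m" for m
    proof (cases "m \<in> T")
      case True
      have "norm h = (norm h / c) * c" using c(1) by simp
      also have "\<dots> \<le> (norm h / c) * G m" using c True by (intro mult_left_mono) auto
      finally show ?thesis using le_norm_bcontfun[of h m] e by simp
    next
      case False
      moreover have "0 \<le> (norm h / c) * G m" using G0[of m] c(1) by simp
      ultimately show ?thesis by (simp add: T_def)
    qed
    then have "\<Lambda> h \<le> \<Lambda> (e *\<^sub>R ?one + (norm h / c) *\<^sub>R G)" by (rule positive_mono[OF \<Lambda>])
    then show ?thesis using \<Lambda>G by (simp add: linear_add[OF lin] linear_scale[OF lin])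
  qed
  have "\<Lambda> h \<le> 0"
  proof (rule field_le_epsilon)
    fix e :: real assume e: "0 < e"
    have "\<Lambda> h \<le> (e / (\<Lambda> ?one + 1)) * \<Lambda> ?one"
      using e one by (intro \<open>\<And>e. 0 < e \<Longrightarrow> \<Lambda> h \<le> e * \<Lambda> ?one\<close>) simp
    also have "\<dots> \<le> e" using e one by (simp add: field_simps)
    finally show "\<Lambda> h \<le> 0 + e" by simp
  qed
  moreover have "0 \<le> \<Lambda> h" using \<Lambda> h(1) by (simp add: positive_def)
  ultimately show ?thesis by simp
qed

lemma zero_on_supp:
  fixes \<Lambda> :: "('c::t2_space \<Rightarrow>\<^sub>C real) \<Rightarrow> real"
  assumes K: "compact (UNIV :: 'c set)" and \<Lambda>: "positive \<Lambda>"
    and \<phi>: "\<And>l. l \<in> supp \<Lambda> \<Longrightarrow> 0 \<le> apply_bcontfun \<phi> l" "\<Lambda> \<phi> = 0" and l: "l \<in> supp \<Lambda>"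
  shows "\<phi> l = 0"
proof -
  have lin: "linear \<Lambda>" using \<Lambda> by (simp add: positive_def)
  have "continuous_on UNIV (\<lambda>l. max 0 (\<phi> l))" by (intro continuous_intros) auto
  then obtain u where u: "apply_bcontfun u = (\<lambda>l. max 0 (\<phi> l))" by (rule obtain_bcontfun[OF K])
  have "\<Lambda> (u - \<phi>) = 0"
    by (rule positive_vanishes_off_supp[OF K \<Lambda>]) (use u \<phi> in auto)
  then have "\<Lambda> u = 0" using \<phi>(2) by (simp add: linear_diff[OF lin])
  moreover have "\<forall>m. 0 \<le> u m" by (simp add: u)
  ultimately have "u l = 0" using l unfolding supp_def by blast
  then show ?thesis using \<phi>(1)[OF l] by (simp add: u)
qed

lemma positive_eq_evaluation:
  fixes \<Lambda> :: "('c::t2_space \<Rightarrow>\<^sub>C real) \<Rightarrow> real"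
  assumes K: "compact (UNIV :: 'c set)" and \<Lambda>: "positive \<Lambda>" "\<Lambda> (const_bcontfun 1) = 1"
    and supp: "supp \<Lambda> \<subseteq> {k}"
  shows "\<Lambda> h = h k"
proof -
  have lin: "linear \<Lambda>" using \<Lambda> by (simp add: positive_def)
  let ?c = "h k *\<^sub>R const_bcontfun 1 :: 'c \<Rightarrow>\<^sub>C real"
  have "continuous_on UNIV (\<lambda>l. \<bar>h l - h k\<bar>)" by (intro continuous_intros) auto
  then obtain u where u: "apply_bcontfun u = (\<lambda>l. \<bar>h l - h k\<bar>)" by (rule obtain_bcontfun[OF K])
  have "\<Lambda> u = 0" by (rule positive_vanishes_off_supp[OF K \<Lambda>(1)]) (use u supp in auto)
  moreover have "\<Lambda> (h - ?c) \<le> \<Lambda> u" by (rule positive_mono[OF \<Lambda>(1)]) (simp add: u)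
  moreover have "\<Lambda> (?c - h) \<le> \<Lambda> u" by (rule positive_mono[OF \<Lambda>(1)]) (simp add: u)
  ultimately show ?thesis
    using \<Lambda>(2) by (simp add: linear_diff[OF lin] linear_scale[OF lin])
qed

locale fun_alg =
  fixes A :: "('c::t2_space \<Rightarrow>\<^sub>C 'k::rc_scalar) set"
  assumes fun_alg: "function_algebra A"
begin

lemma K: "compact (UNIV :: 'c set)"
  and closed_A: "closed A"
  and subspace_A: "module.subspace scale_bcontfun A"
  and mult_A: "f \<in> A \<Longrightarrow> g \<in> A \<Longrightarrow> \<exists>h\<in>A. \<forall>k. h k = f k * g k"
  and separates_A: "k \<noteq> l \<Longrightarrow> \<exists>f\<in>A. f k \<noteq> f l"
  and const_A: "const_bcontfun c \<in> A"
  using fun_alg unfolding function_algebra_def by blast+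

sublocale normed_subspace scale_bcontfun A
  by unfold_locales (rule normed_space_over_scale_bcontfun, rule subspace_A)

abbreviation pe where "pe \<equiv> point_functional A apply_bcontfun"

lemma pe: "a \<in> A \<Longrightarrow> pe k a = a k"
  by (simp add: point_functional_def)

lemma pe_dual: "pe k \<in> dual scale_bcontfun A"
proof (rule dualI[where C=1])
  show "norm (pe k x) \<le> 1 * norm x" if "x \<in> A" for x using that by (simp add: pe norm_bounded)
qed (auto simp: point_functional_def)

lemma norm_one: "norm (const_bcontfun 1 :: 'c \<Rightarrow>\<^sub>C 'k) \<le> 1"
  by (rule norm_bound) simp

lemma dual_norm_pe: "dual_norm A (pe k) = 1"
proof (rule antisym)
  show "dual_norm A (pe k) \<le> 1"
    by (rule dual_norm_le_mult) (auto simp: pe norm_bounded)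
  show "1 \<le> dual_norm A (pe k)"
    using norm_le_dual_norm_ball[OF pe_dual const_A norm_one, of k] by (simp add: pe const_A)
qed

lemma separates_re:
  assumes "k \<noteq> l"
  obtains a where "a \<in> A" "re (a k) \<noteq> re (a l)"
proof -
  obtain f where f: "f \<in> A" "f k \<noteq> f l" using separates_A[OF assms] by blast
  let ?\<beta> = "inverse (f k - f l)"
  have "re (scale_bcontfun ?\<beta> f k) - re (scale_bcontfun ?\<beta> f l) = re (?\<beta> * (f k - f l))"
    by (simp add: right_diff_distrib)
  then have "re (scale_bcontfun ?\<beta> f k) \<noteq> re (scale_bcontfun ?\<beta> f l)" using f by simp
  then show ?thesis using that[OF sc_mem[OF f(1)]] by blast
qed

definition represents where
  "represents g \<Lambda> \<longleftrightarrow> positive \<Lambda> \<and> (\<forall>a\<in>A. \<Lambda> (re_fun a) = re (g a))"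

lemma re_fun_one: "re_fun (const_bcontfun 1 :: 'c \<Rightarrow>\<^sub>C 'k) = const_bcontfun 1"
  by (rule bcontfun_eqI) simp

lemma represents_one: "represents g \<Lambda> \<Longrightarrow> \<Lambda> (const_bcontfun 1) = re (g (const_bcontfun 1))"
  using const_A[of 1] re_fun_one unfolding represents_def by metis

lemma represents_pe_one: "represents (pe k) \<Lambda> \<Longrightarrow> \<Lambda> (const_bcontfun 1) = 1"
  by (simp add: represents_one pe const_A)

text \<open>A functional of norm at most 1 with \<open>g 1 = 1\<close> is positive on real parts: if \<open>re a \<ge> 0\<close>, then
  \<open>\<parallel>1 - t a\<parallel>\<^sup>2 \<le> 1 + t\<^sup>2 \<parallel>a\<parallel>\<^sup>2\<close> for \<open>t > 0\<close>, and letting \<open>t \<rightarrow> 0\<close> gives \<open>re (g a) \<ge> 0\<close>.\<close>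

lemma state_nonneg:
  assumes g: "g \<in> dual scale_bcontfun A" "dual_norm A g \<le> 1" "g (const_bcontfun 1) = 1"
    and a: "a \<in> A" "\<And>l. 0 \<le> re (a l)"
  shows "0 \<le> re (g a)"
proof (rule ccontr)
  assume neg: "\<not> 0 \<le> re (g a)"
  define B where "B = (norm a)\<^sup>2 + 1"
  have B: "0 < B" unfolding B_def by (simp add: add_nonneg_pos)
  define t where "t = - re (g a) / B"
  have t: "0 < t" "t * B = - re (g a)" using neg B by (auto simp: t_def divide_neg_pos)
  let ?b = "const_bcontfun 1 - t *\<^sub>R a"
  have b: "?b \<in> A" using const_A a by auto
  have "(norm (?b l))\<^sup>2 \<le> 1 + t\<^sup>2 * B" for l
  proof -
    have "(norm (a l))\<^sup>2 \<le> (norm a)\<^sup>2" by (intro power_mono norm_bounded) simp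
    then have nB: "(norm (a l))\<^sup>2 \<le> B" unfolding B_def by linarith
    have "(norm (?b l))\<^sup>2 = 1 + (norm (t *\<^sub>R a l))\<^sup>2 - 2 * re (t *\<^sub>R a l)"
      using norm_1_diff_sq[of "t *\<^sub>R a l"] by simp
    also have "\<dots> \<le> 1 + t\<^sup>2 * (norm (a l))\<^sup>2" using a(2)[of l] t by (simp add: power_mult_distrib)
    also have "\<dots> \<le> 1 + t\<^sup>2 * B" using nB by (intro add_left_mono mult_left_mono) auto
    finally show ?thesis .
  qed
  then have "norm ?b \<le> sqrt (1 + t\<^sup>2 * B)" by (intro norm_bound real_le_rsqrt) auto
  moreover have "1 - t * re (g a) \<le> norm ?b"
  proof -
    have "g ?b = 1 - of_real t * g a" using g a const_A by (simp add: dual_diff dual_scaleR scaleR_mem)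
    then have "1 - t * re (g a) \<le> norm (g ?b)" using re_le[of "g ?b"] by simp
    also have "\<dots> \<le> dual_norm A g * norm ?b" using norm_le_dual_norm[OF g(1) b] .
    also have "\<dots> \<le> 1 * norm ?b" using g(2) by (intro mult_right_mono) auto
    finally show ?thesis by simp
  qed
  ultimately have "1 - t * re (g a) \<le> sqrt (1 + t\<^sup>2 * B)" by simp
  moreover have "0 \<le> 1 - t * re (g a)" using mult_nonneg_nonpos[of t "re (g a)"] t neg by simp
  ultimately have "(1 - t * re (g a))\<^sup>2 \<le> (sqrt (1 + t\<^sup>2 * B))\<^sup>2" by (intro power_mono)
  also have "\<dots> = 1 + t\<^sup>2 * B" using B by (simp add: add_nonneg_nonneg)
  also have "re (g a) = - (t * B)" using t(2) by simp
  finally have le: "(1 - t * - (t * B))\<^sup>2 \<le> 1 + t\<^sup>2 * B" .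
  define s where "s = t\<^sup>2 * B"
  have "1 - t * - (t * B) = 1 + s" by (simp add: s_def power2_eq_square)
  then have "(1 + s)\<^sup>2 \<le> 1 + s" using le by (simp only: s_def)
  then have "s + s * s \<le> 0" by (simp add: power2_eq_square algebra_simps)
  moreover have "0 < s" using t B by (simp add: s_def)
  then have "0 < s + s * s" by (intro add_pos_pos mult_pos_pos)
  ultimately show False by linarith
qed

text \<open>Both the existence of representing functionals and the lower envelope formula used below come
  from the bounds \<open>re (g a)\<close> with \<open>a \<in> A\<close> and \<open>re a \<ge> h\<close> for the value at \<open>h\<close>.\<close>

lemma representing_functional:
  assumes g: "g \<in> dual scale_bcontfun A" "dual_norm A g \<le> 1" "g (const_bcontfun 1) = 1"
    and e: "0 < e"
  obtains \<Lambda> a where "represents g \<Lambda>" "a \<in> A" "\<And>l. apply_bcontfun h l \<le> re (a l)" "re (g a) < \<Lambda> h + e"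
proof -
  define R where "R = {(h :: 'c \<Rightarrow>\<^sub>C real, r). \<exists>a\<in>A. (\<forall>l. h l \<le> re (apply_bcontfun a l)) \<and> re (g a) \<le> r}"
  have RI: "(h, re (g a)) \<in> R" if "a \<in> A" "\<And>l. apply_bcontfun h l \<le> re (a l)" for h a
    using that unfolding R_def by blast
  have R: "bound_cone R"
  proof (rule bound_coneI)
    show "(0, 0) \<in> R" using RI[OF zero_mem, of 0] g by (simp add: dual_0)
    show "(h + h', r + s) \<in> R" if hr: "(h, r) \<in> R" and hs: "(h', s) \<in> R" for h r h' s
    proof -
      obtain a b where ab: "a \<in> A" "b \<in> A" "\<And>l. h l \<le> re (a l)" "\<And>l. h' l \<le> re (b l)"
        "re (g a) \<le> r" "re (g b) \<le> s" using hr hs by (auto simp: R_def)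
      then have "\<forall>l. (h + h') l \<le> re ((a + b) l)" "re (g (a + b)) \<le> r + s"
        using g by (auto simp: dual_add intro: add_mono)
      then show ?thesis unfolding R_def using add_mem[OF ab(1,2)] by blast
    qed
    show "(t *\<^sub>R h, t * r) \<in> R" if hr: "(h, r) \<in> R" and t: "0 < t" for h r t
    proof -
      obtain a where a: "a \<in> A" "\<And>l. h l \<le> re (a l)" "re (g a) \<le> r" using hr by (auto simp: R_def)
      then have "\<forall>l. (t *\<^sub>R h) l \<le> re ((t *\<^sub>R a) l)" "re (g (t *\<^sub>R a)) \<le> t * r"
        using g t by (auto simp: dual_scaleR intro: mult_left_mono)
      then show ?thesis unfolding R_def using scaleR_mem[OF a(1)] by blast
    qed
    show "0 \<le> r" if "(0, r) \<in> R" for r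
      using that state_nonneg[OF g] unfolding R_def by (auto intro: order_trans)
    show "\<exists>r. (h, r) \<in> R" for h
      by (rule exI, rule RI[of "const_bcontfun (of_real (norm h))"]) (simp_all add: const_A le_norm_bcontfun)
  qed
  obtain \<Lambda> r where \<Lambda>': "linear \<Lambda>" "\<forall>h r. (h, r) \<in> R \<longrightarrow> \<Lambda> h \<le> r" "(h, r) \<in> R" "r < \<Lambda> h + e"
    by (rule Hahn_Banach_cone[OF R e])
  then have \<Lambda>: "linear \<Lambda>" "\<And>a h. a \<in> A \<Longrightarrow> (\<And>l. apply_bcontfun h l \<le> re (a l)) \<Longrightarrow> \<Lambda> h \<le> re (g a)"
    using RI by auto
  have "represents g \<Lambda>"
    unfolding represents_def positive_def
  proof (intro conjI allI impI ballI \<Lambda>(1))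
    fix h :: "'c \<Rightarrow>\<^sub>C real" assume "\<forall>l. 0 \<le> h l"
    then have "\<Lambda> (- h) \<le> 0" using \<Lambda>(2)[OF zero_mem, of "- h"] g by (simp add: dual_0)
    then show "0 \<le> \<Lambda> h" by (simp add: linear_neg[OF \<Lambda>(1)])
  next
    fix a assume a: "a \<in> A"
    have 1: "\<Lambda> (re_fun a) \<le> re (g a)" if "a \<in> A" for a
      using that by (intro \<Lambda>(2)) auto
    have "re_fun (- a) = - re_fun a" by (rule bcontfun_eqI) simp
    moreover have "g (- a) = - g a" using dual_scaleR[OF g(1) a, of "-1"] by simp
    ultimately have "re (g a) \<le> \<Lambda> (re_fun a)"
      using 1[OF neg_mem[OF a]] by (simp add: linear_neg[OF \<Lambda>(1)])
    with 1[OF a] show "\<Lambda> (re_fun a) = re (g a)" by simp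
  qed
  moreover obtain a where "a \<in> A" "\<And>l. h l \<le> re (a l)" "re (g a) \<le> r"
    using \<Lambda>'(3) by (auto simp: R_def)
  ultimately show ?thesis using \<Lambda>'(4) that by (meson le_less_trans)
qed

text \<open>For \<open>0 \<le> \<phi> \<le> 1\<close>, the functionals \<open>a \<mapsto> \<Lambda> (\<phi> a)\<close> and \<open>a \<mapsto> \<Lambda> ((1 - \<phi>) a)\<close> have norms at most
  \<open>\<Lambda> \<phi>\<close> and \<open>1 - \<Lambda> \<phi>\<close> and add up to the evaluation at \<open>k\<close>; by extremality both are multiples of
  it.\<close>

lemma represents_extreme_mult:
  assumes k: "k \<in> choquet_boundary A" and \<Lambda>: "represents (pe k) \<Lambda>"
    and \<phi>: "\<And>l. 0 \<le> apply_bcontfun \<phi> l" "\<And>l. \<phi> l \<le> 1" and a: "a \<in> A"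
  shows "\<Lambda> (mult_fun \<phi> (re_fun a)) = \<Lambda> \<phi> * re (a k)"
proof -
  have pos: "positive \<Lambda>" and lin: "linear \<Lambda>" using \<Lambda> by (auto simp: represents_def positive_def)
  have rep: "\<Lambda> (re_fun a) = re (a k)" if "a \<in> A" for a using \<Lambda> that by (simp add: represents_def pe)
  have part: "\<exists>G\<in>dual scale_bcontfun A. (\<forall>a\<in>A. re (G a) = \<Lambda> (mult_fun \<psi> (re_fun a))) \<and>
      dual_norm A G \<le> \<Lambda> \<psi>" if \<psi>: "\<And>l. 0 \<le> \<psi> l" for \<psi> :: "'c \<Rightarrow>\<^sub>C real"
  proof -
    have "mult_fun \<psi> (re_fun (a + b)) = mult_fun \<psi> (re_fun a) + mult_fun \<psi> (re_fun b)"
      "mult_fun \<psi> (re_fun (r *\<^sub>R a)) = r *\<^sub>R mult_fun \<psi> (re_fun a)" for a b :: "'c \<Rightarrow>\<^sub>C 'k" and r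
      by (rule bcontfun_eqI; simp add: algebra_simps)+
    note mult = this
    have bound: "\<Lambda> (mult_fun \<psi> (re_fun a)) \<le> \<Lambda> \<psi> * norm a" for a
    proof -
      have "\<Lambda> (mult_fun \<psi> (re_fun a)) \<le> \<Lambda> (norm a *\<^sub>R \<psi>)"
      proof (rule positive_mono[OF pos])
        fix l
        have "re (a l) \<le> norm a" using re_le[of "a l"] norm_bounded[of a l] by linarith
        then show "mult_fun \<psi> (re_fun a) l \<le> (norm a *\<^sub>R \<psi>) l"
          using mult_left_mono[OF _ \<psi>[of l], of "re (a l)" "norm a"] by (simp add: mult.commute)
      qed
      then show ?thesis by (simp add: linear_scale[OF lin] mult.commute)
    qed
    have "0 \<le> \<Lambda> \<psi>" using pos \<psi> by (simp add: positive_def)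
    then obtain G where "G \<in> dual scale_bcontfun A"
      "\<And>a. a \<in> A \<Longrightarrow> re (G a) = \<Lambda> (mult_fun \<psi> (re_fun a))" "dual_norm A G \<le> \<Lambda> \<psi>"
      using dual_of_real_functional[of "\<lambda>a. \<Lambda> (mult_fun \<psi> (re_fun a))" "\<Lambda> \<psi>"] bound
      by (auto simp: mult linear_add[OF lin] linear_scale[OF lin])
    then show ?thesis by blast
  qed
  define \<tau> where "\<tau> = \<Lambda> \<phi>"
  let ?\<phi>' = "const_bcontfun 1 - \<phi>"
  have \<tau>': "\<Lambda> ?\<phi>' = 1 - \<tau>"
    using represents_pe_one[OF \<Lambda>] by (simp add: linear_diff[OF lin] \<tau>_def)
  obtain G where G: "G \<in> dual scale_bcontfun A"
    "\<And>a. a \<in> A \<Longrightarrow> re (G a) = \<Lambda> (mult_fun \<phi> (re_fun a))" "dual_norm A G \<le> \<tau>"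
    using part[of \<phi>] \<phi>(1) unfolding \<tau>_def by blast
  obtain H where H: "H \<in> dual scale_bcontfun A"
    "\<And>a. a \<in> A \<Longrightarrow> re (H a) = \<Lambda> (mult_fun ?\<phi>' (re_fun a))" "dual_norm A H \<le> 1 - \<tau>"
    using part[of ?\<phi>'] \<phi>(2) unfolding \<tau>' by auto
  have GH: "(\<lambda>x. G x + H x) = pe k"
  proof (rule dual_eqI_re[OF dual_plus[OF G(1) H(1)] pe_dual])
    fix a assume a: "a \<in> A"
    have "mult_fun \<phi> (re_fun a) + mult_fun ?\<phi>' (re_fun a) = re_fun a"
      by (rule bcontfun_eqI) (simp add: algebra_simps)
    then show "re (G a + H a) = re (pe k a)"
      using a by (simp add: G H rep pe flip: linear_add[OF lin])
  qed
  have \<tau>: "0 \<le> \<tau>" "\<tau> \<le> 1"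
    using dual_norm_nonneg[OF G(1)] G(3) dual_norm_nonneg[OF H(1)] H(3) by auto
  have "G = (\<lambda>x. of_real \<tau> * pe k x)"
  proof (cases "\<tau> = 0 \<or> \<tau> = 1")
    case True
    then show ?thesis
    proof
      assume "\<tau> = 0"
      then show ?thesis using dual_norm_eq_0D[OF G(1)] G(3) dual_norm_nonneg[OF G(1)] by simp
    next
      assume "\<tau> = 1"
      then have "H = (\<lambda>x. 0)" using dual_norm_eq_0D[OF H(1)] H(3) dual_norm_nonneg[OF H(1)] by simp
      then show ?thesis using GH \<open>\<tau> = 1\<close> by (auto simp: fun_eq_iff)
    qed
  next
    case False
    then have t: "0 < \<tau>" "\<tau> < 1" using \<tau> by auto
    let ?G = "\<lambda>x. of_real (1 / \<tau>) * G x" and ?H = "\<lambda>x. of_real (1 / (1 - \<tau>)) * H x"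
    have "norm (of_real (1 / \<tau>) :: 'k) * dual_norm A G \<le> 1"
      "norm (of_real (1 / (1 - \<tau>)) :: 'k) * dual_norm A H \<le> 1"
      using t G(3) H(3) unfolding norm_of_real by (auto simp: field_simps)
    then have in_ball: "?G \<in> dual_ball scale_bcontfun A" "?H \<in> dual_ball scale_bcontfun A"
      using G(1) H(1) unfolding dual_ball_def
      by (simp_all only: dual_norm_cmult mem_Collect_eq dual_cmult simp_thms)
    have comb: "pe k = (\<lambda>x. (1 - (1 - \<tau>)) *\<^sub>R ?G x + (1 - \<tau>) *\<^sub>R ?H x)"
      using t GH by (auto simp: scaleR_conv_of_real simp flip: mult.assoc of_real_mult)
    have "extreme_functional (pe k) (dual_ball scale_bcontfun A)"
      using k by (simp add: choquet_boundary_def)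
    then have "?G \<noteq> ?H \<longrightarrow> \<not> (\<exists>t. 0 < t \<and> t < 1 \<and> pe k = (\<lambda>x. (1 - t) *\<^sub>R ?G x + t *\<^sub>R ?H x))"
      using in_ball unfolding extreme_functional_def by (elim conjE ballE) auto
    moreover have "0 < 1 - \<tau>" "1 - \<tau> < 1" using t by auto
    ultimately have "?G = ?H" using comb by blast
    then have eq: "?G x = ?H x" for x by metis
    have convex: "of_real \<tau> * y + of_real (1 - \<tau>) * y = y" for y :: 'k
      by (simp add: left_diff_distrib)
    have "of_real \<tau> * pe k x = G x" for x
    proof -
      have "pe k x = of_real \<tau> * ?G x + of_real (1 - \<tau>) * ?H x"
        using t fun_cong[OF GH, of x] by (auto simp flip: mult.assoc of_real_mult)
      also have "\<dots> = of_real \<tau> * ?G x + of_real (1 - \<tau>) * ?G x" by (simp only: eq)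
      also have "\<dots> = ?G x" by (rule convex)
      finally have "of_real \<tau> * pe k x = of_real \<tau> * ?G x" by (simp only:)
      then show ?thesis using t by (simp flip: mult.assoc of_real_mult)
    qed
    then show ?thesis by (simp add: fun_eq_iff)
  qed
  then show ?thesis using G(2)[OF a] a by (simp add: pe \<tau>_def)
qed

text \<open>By linearity \<open>\<Lambda> (\<psi> re a) = \<Lambda> \<psi> re a(k)\<close> for all real \<open>\<psi>\<close>; with \<open>\<psi> = re a - re a(k)\<close> this says
  that \<open>\<Lambda> \<psi>\<^sup>2 = 0\<close>.\<close>

lemma supp_represents_extreme:
  assumes k: "k \<in> choquet_boundary A" and \<Lambda>: "represents (pe k) \<Lambda>"
  shows "supp \<Lambda> \<subseteq> {k}"
proof (rule subsetI, rule ccontr)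
  fix l assume l: "l \<in> supp \<Lambda>" "l \<notin> {k}"
  have lin: "linear \<Lambda>" using \<Lambda> by (auto simp: represents_def positive_def)
  obtain a where a: "a \<in> A" "re (a l) \<noteq> re (a k)" using separates_re[of l k] l(2) by blast
  have \<Lambda>a: "\<Lambda> (re_fun a) = re (a k)" using \<Lambda> a(1) by (simp add: represents_def pe)
  let ?one = "const_bcontfun 1 :: 'c \<Rightarrow>\<^sub>C real"
  define \<psi> where "\<psi> = re_fun a - re (a k) *\<^sub>R ?one"
  define N where "N = norm \<psi> + 1"
  have N: "0 < N" "norm \<psi> \<le> N" unfolding N_def by (simp_all add: add_nonneg_pos)
  define \<phi> where "\<phi> = (1 / (2 * N)) *\<^sub>R (\<psi> + N *\<^sub>R ?one)"
  have \<phi>01: "0 \<le> \<phi> m" "\<phi> m \<le> 1" for m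
  proof -
    have "\<bar>\<psi> m\<bar> \<le> N" using norm_bounded[of \<psi> m] N(2) by simp
    then have "0 \<le> \<psi> m + N" "\<psi> m + N \<le> 2 * N" by linarith+
    then show "0 \<le> \<phi> m" "\<phi> m \<le> 1" using N(1) by (simp_all add: \<phi>_def)
  qed
  have \<Lambda>\<psi>: "\<Lambda> \<psi> = 0"
    using represents_pe_one[OF \<Lambda>] by (simp add: \<psi>_def linear_diff[OF lin] linear_scale[OF lin] \<Lambda>a)
  have "\<Lambda> (mult_fun \<phi> (re_fun a)) = \<Lambda> \<phi> * re (a k)"
    using k \<Lambda> \<phi>01 a(1) by (rule represents_extreme_mult)
  moreover have "mult_fun \<phi> (re_fun a) = (1 / (2 * N)) *\<^sub>R (mult_fun \<psi> (re_fun a) + N *\<^sub>R re_fun a)"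
    by (rule bcontfun_eqI) (simp add: \<phi>_def algebra_simps)
  moreover have "\<Lambda> \<phi> = (1 / (2 * N)) * N"
    using represents_pe_one[OF \<Lambda>]
    by (simp add: \<phi>_def linear_add[OF lin] linear_scale[OF lin] \<Lambda>\<psi>)
  ultimately have "\<Lambda> (mult_fun \<psi> (re_fun a)) = 0"
    using N(1) by (simp add: linear_add[OF lin] linear_scale[OF lin] \<Lambda>a field_simps)
  moreover have "mult_fun \<psi> \<psi> = mult_fun \<psi> (re_fun a) - re (a k) *\<^sub>R \<psi>"
    by (rule bcontfun_eqI) (simp add: \<psi>_def algebra_simps)
  ultimately have "\<Lambda> (mult_fun \<psi> \<psi>) = 0"
    by (simp add: linear_diff[OF lin] linear_scale[OF lin] \<Lambda>\<psi>)
  moreover have "\<forall>m. 0 \<le> mult_fun \<psi> \<psi> m" by simp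
  ultimately have "mult_fun \<psi> \<psi> l = 0" using l(1) unfolding supp_def by blast
  then show False using a(2) by (simp add: \<psi>_def)
qed

lemma positive_pe_state:
  shows "pe k \<in> dual scale_bcontfun A" "dual_norm A (pe k) \<le> 1" "pe k (const_bcontfun 1) = 1"
  using pe_dual dual_norm_pe by (simp_all add: pe const_A)

text \<open>If \<open>\<delta>\<^sub>k = (1 - t) g + t h\<close> on \<open>A\<close>, measures that represent \<open>g\<close> and \<open>h\<close> combine to one that
  represents \<open>\<delta>\<^sub>k\<close>; if the latter is carried by \<open>{k}\<close>, so are the former.\<close>

lemma choquet_boundaryI:
  assumes supp: "\<And>\<Lambda>. represents (pe k) \<Lambda> \<Longrightarrow> supp \<Lambda> \<subseteq> {k}"
  shows "k \<in> choquet_boundary A"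
  unfolding choquet_boundary_def extreme_functional_def
proof (intro CollectI conjI ballI impI notI)
  show "pe k \<in> dual_ball scale_bcontfun A" using pe_dual dual_norm_pe by (simp add: dual_ball_def)
  fix g h assume gh: "g \<in> dual_ball scale_bcontfun A" "h \<in> dual_ball scale_bcontfun A" "g \<noteq> h"
    and "\<exists>t. 0 < t \<and> t < 1 \<and> pe k = (\<lambda>x. (1 - t) *\<^sub>R g x + t *\<^sub>R h x)"
  then obtain t where t: "0 < t" "t < 1" "pe k = (\<lambda>x. (1 - t) *\<^sub>R g x + t *\<^sub>R h x)" by blast
  let ?one = "const_bcontfun 1 :: 'c \<Rightarrow>\<^sub>C 'k"
  have g: "g \<in> dual scale_bcontfun A" "dual_norm A g \<le> 1"
    and h: "h \<in> dual scale_bcontfun A" "dual_norm A h \<le> 1" using gh by (auto simp: dual_ball_def)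
  have n1: "norm (g ?one) \<le> 1" "norm (h ?one) \<le> 1"
    using norm_le_dual_norm_ball[OF g(1) const_A norm_one] g(2)
      norm_le_dual_norm_ball[OF h(1) const_A norm_one] h(2) by auto
  have "(1 - t) *\<^sub>R g ?one + t *\<^sub>R h ?one = 1"
    using fun_cong[OF t(3), of ?one] by (simp add: pe const_A)
  from arg_cong[OF this, of re] have re1: "(1 - t) * re (g ?one) + t * re (h ?one) = 1" by simp
  have le1: "re (g ?one) \<le> 1" "re (h ?one) \<le> 1"
    using n1 re_le[of "g ?one"] re_le[of "h ?one"] by auto
  have "re (g ?one) = 1"
  proof (rule ccontr)
    assume "re (g ?one) \<noteq> 1"
    then have "(1 - t) * re (g ?one) < (1 - t) * 1" using t le1 by (intro mult_strict_left_mono) auto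
    moreover have "t * re (h ?one) \<le> t * 1" using t le1 by (intro mult_left_mono) auto
    ultimately show False using re1 by simp
  qed
  moreover have "re (h ?one) = 1"
    using re1 t by (simp add: calculation)
  ultimately have g1: "g ?one = 1" and h1: "h ?one = 1"
    using n1 re_le[of "g ?one"] re_le[of "h ?one"] eq_norm_if_re_ge_norm[of "g ?one"]
      eq_norm_if_re_ge_norm[of "h ?one"] by (metis of_real_1 order_antisym)+
  obtain \<Lambda>g where \<Lambda>g: "represents g \<Lambda>g"
    using representing_functional[OF g g1, of 1 0] by auto
  obtain \<Lambda>h where \<Lambda>h: "represents h \<Lambda>h"
    using representing_functional[OF h h1, of 1 0] by auto
  define \<Lambda> where "\<Lambda> \<phi> = (1 - t) * \<Lambda>g \<phi> + t * \<Lambda>h \<phi>" for \<phi>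
  have posg: "positive \<Lambda>g" and posh: "positive \<Lambda>h" using \<Lambda>g \<Lambda>h by (auto simp: represents_def)
  have "linear \<Lambda>"
    using posg posh unfolding \<Lambda>_def positive_def
    by (intro linearI) (auto simp: linear_add linear_scale algebra_simps)
  moreover have nn: "0 \<le> \<Lambda>g \<phi>" "0 \<le> \<Lambda>h \<phi>" if "\<forall>l. 0 \<le> apply_bcontfun \<phi> l" for \<phi>
    using posg posh that by (auto simp: positive_def)
  moreover have "\<Lambda> (re_fun a) = re (pe k a)" if "a \<in> A" for a
    using \<Lambda>g \<Lambda>h that t(3) by (simp add: \<Lambda>_def represents_def)
  ultimately have "represents (pe k) \<Lambda>"
    using t unfolding represents_def positive_def \<Lambda>_def by auto
  then have "supp \<Lambda> \<subseteq> {k}" by (rule supp)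
  have "\<Lambda>g \<phi> = 0 \<and> \<Lambda>h \<phi> = 0" if "\<forall>l. 0 \<le> apply_bcontfun \<phi> l" "\<Lambda> \<phi> = 0" for \<phi>
  proof -
    have "0 \<le> (1 - t) * \<Lambda>g \<phi>" "0 \<le> t * \<Lambda>h \<phi>" using nn[OF that(1)] t by auto
    then have "(1 - t) * \<Lambda>g \<phi> = 0" "t * \<Lambda>h \<phi> = 0"
      using that(2) unfolding \<Lambda>_def by (simp_all add: add_nonneg_eq_0_iff)
    then show ?thesis using t by auto
  qed
  then have "supp \<Lambda>g \<subseteq> supp \<Lambda>" "supp \<Lambda>h \<subseteq> supp \<Lambda>" unfolding supp_def by blast+
  then have "supp \<Lambda>g \<subseteq> {k}" "supp \<Lambda>h \<subseteq> {k}" using \<open>supp \<Lambda> \<subseteq> {k}\<close> by auto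
  then have "\<Lambda>g (re_fun a) = re (a k)" "\<Lambda>h (re_fun a) = re (a k)" for a :: "'c \<Rightarrow>\<^sub>C 'k"
    using positive_eq_evaluation[OF K posg] positive_eq_evaluation[OF K posh]
      represents_one[OF \<Lambda>g] represents_one[OF \<Lambda>h] g1 h1 by auto
  then have "g = h"
    using \<Lambda>g \<Lambda>h unfolding represents_def by (intro dual_eqI_re[OF g(1) h(1)]) metis
  then show False using gh by simp
qed

end

context fun_alg
begin

lemma re_fun_continuous: "continuous_on T (\<lambda>l. re (a l))" for a :: "'c \<Rightarrow>\<^sub>C 'k"
  by (intro continuous_intros) auto

text \<open>The measure-theoretic analogue of the closed faces in the proof of the Krein-Milman theorem
  (Bauer's maximum principle).\<close>

definition stable :: "'c set \<Rightarrow> bool" where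
  "stable E \<longleftrightarrow> closed E \<and> E \<noteq> {} \<and> (\<forall>k\<in>E. \<forall>\<Lambda>. represents (pe k) \<Lambda> \<longrightarrow> supp \<Lambda> \<subseteq> E)"

text \<open>If \<open>re a(k)\<close> is the maximum of \<open>re a\<close> on \<open>E\<close> and a measure on \<open>E\<close> represents \<open>k\<close>, then \<open>re a\<close>
  equals its maximum almost everywhere.\<close>

lemma stable_max_set:
  assumes E: "stable E" and a: "a \<in> A"
  shows "stable {l \<in> E. \<forall>m\<in>E. re (a m) \<le> re (a l)}" (is "stable ?M")
proof -
  have closed: "closed E" and ne: "E \<noteq> {}"
    and E_supp: "\<And>k \<Lambda>. k \<in> E \<Longrightarrow> represents (pe k) \<Lambda> \<Longrightarrow> supp \<Lambda> \<subseteq> E"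
    using E by (auto simp: stable_def)
  have "compact E" using compact_Int_closed[OF K closed] by simp
  then obtain k0 where k0: "k0 \<in> E" "\<And>m. m \<in> E \<Longrightarrow> re (a m) \<le> re (a k0)"
    using continuous_attains_sup[OF _ ne re_fun_continuous[of E a]] by blast
  have M_eq: "?M = E \<inter> {l. re (a l) = re (a k0)}"
    using k0 by (auto intro: antisym)
  show ?thesis
    unfolding stable_def
  proof (intro conjI ballI allI impI)
    show "closed ?M"
      unfolding M_eq by (intro closed_Int closed closed_Collect_eq re_fun_continuous continuous_intros)
    show "?M \<noteq> {}" using k0 by auto
    fix k \<Lambda> assume k: "k \<in> ?M" and \<Lambda>: "represents (pe k) \<Lambda>"
    have pos: "positive \<Lambda>" and lin: "linear \<Lambda>" using \<Lambda> by (auto simp: represents_def positive_def)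
    have sE: "supp \<Lambda> \<subseteq> E" using E_supp k \<Lambda> by blast
    let ?\<phi> = "re (a k0) *\<^sub>R const_bcontfun 1 - re_fun a"
    have rk: "re (a k) = re (a k0)" using k M_eq by blast
    have "\<Lambda> ?\<phi> = 0"
      using represents_pe_one[OF \<Lambda>] \<Lambda> a rk
      by (simp add: linear_diff[OF lin] linear_scale[OF lin] represents_def pe)
    then have "?\<phi> l = 0" if "l \<in> supp \<Lambda>" for l
      using sE k0(2) that by (intro zero_on_supp[OF K pos]) auto
    then show "supp \<Lambda> \<subseteq> ?M" unfolding M_eq using sE by auto
  qed
qed

text \<open>A minimal stable subset is a single point by the previous lemma, as the real parts of
  functions in \<open>A\<close> separate points.\<close>

lemma stable_meets_choquet_boundary:
  assumes E: "stable E"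
  obtains k where "k \<in> E" "k \<in> choquet_boundary A"
proof -
  \<comment> \<open>reverse inclusion, for minimal sets\<close>
  define P where "P = (\<lambda>M N :: 'c set. N \<subseteq> M)"
  let ?\<S> = "{M. stable M \<and> M \<subseteq> E}"
  have "\<exists>M\<in>?\<S>. \<forall>N\<in>?\<S>. P M N \<longrightarrow> N = M"
  proof (rule predicate_Zorn)
    show "partial_order_on ?\<S> (relation_of P ?\<S>)"
      unfolding P_def by (rule partial_order_on_relation_ofI) auto
    fix C assume C: "C \<in> Chains (relation_of P ?\<S>)"
    have CS: "stable M" "M \<subseteq> E" if "M \<in> C" for M
      using C that by (auto simp: Chains_def relation_of_def)
    have chain: "M \<subseteq> N \<or> N \<subseteq> M" if "M \<in> C" "N \<in> C" for M N
      using C that by (auto simp: Chains_def relation_of_def P_def)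
    show "\<exists>U\<in>?\<S>. \<forall>M\<in>C. P M U"
    proof (cases "C = {}")
      case True
      then show ?thesis using E by auto
    next
      case False
      have "UNIV \<inter> \<Inter>C \<noteq> {}"
      proof (rule compact_imp_fip[OF K])
        show "closed M" if "M \<in> C" for M using CS[OF that] by (simp add: stable_def)
        fix F' assume F': "finite F'" "F' \<subseteq> C"
        show "UNIV \<inter> \<Inter>F' \<noteq> {}"
        proof (cases "F' = {}")
          case False
          have "\<exists>M\<in>F'. \<forall>N\<in>F'. M \<subseteq> N"
            using F'(1) False F'(2)
          proof (induction F' rule: finite_ne_induct)
            case (insert M F)
            then obtain N where N: "N \<in> F" "\<forall>N'\<in>F. N \<subseteq> N'" by auto
            have "M \<subseteq> N \<or> N \<subseteq> M" using insert.prems N(1) by (intro chain) auto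
            then show ?case
            proof
              assume "M \<subseteq> N"
              then show ?thesis using N(2) by (intro bexI[of _ M]) auto
            next
              assume "N \<subseteq> M"
              then show ?thesis using N by (intro bexI[of _ N]) auto
            qed
          qed simp
          then obtain M where M: "M \<in> F'" "M \<subseteq> \<Inter>F'" by blast
          then have "M \<noteq> {}" using CS(1)[of M] F' by (auto simp: stable_def)
          then show ?thesis using M by blast
        qed simp
      qed
      then have "stable (\<Inter>C)"
        using CS(1) unfolding stable_def by (auto intro!: closed_Inter)
      moreover have "\<Inter>C \<subseteq> E" using False CS(2) by blast
      ultimately show ?thesis unfolding P_def by (intro bexI[of _ "\<Inter>C"]) auto
    qed
  qed
  then obtain M where M: "stable M" "M \<subseteq> E" and min: "\<And>N. stable N \<Longrightarrow> N \<subseteq> M \<Longrightarrow> N = M"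
    by (auto simp: P_def)
  obtain k where k: "k \<in> M" using M(1) by (auto simp: stable_def)
  have "l = k" if l: "l \<in> M" for l
  proof (rule ccontr)
    assume "l \<noteq> k"
    then obtain a where a: "a \<in> A" "re (a l) \<noteq> re (a k)" by (rule separates_re)
    have "{l \<in> M. \<forall>m\<in>M. re (a m) \<le> re (a l)} = M"
      using stable_max_set[OF M(1) a(1)] by (intro min) auto
    then have "re (a k) \<le> re (a l)" "re (a l) \<le> re (a k)" using l k by blast+
    then show False using a(2) by simp
  qed
  then have "M = {k}" using k by blast
  then have "k \<in> choquet_boundary A"
    using M(1) by (intro choquet_boundaryI) (auto simp: stable_def)
  then show ?thesis using that M(2) k by blast
qed

text \<open>After multiplication with a unimodular scalar, the maximum of \<open>re f\<close> is \<open>\<parallel>f\<parallel>\<close>, and the set where it is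
  attained is stable.\<close>

lemma norm_attained_on_choquet_boundary:
  assumes f: "f \<in> A"
  obtains k where "k \<in> choquet_boundary A" "norm (f k) = norm f"
proof -
  have "continuous_on UNIV (\<lambda>l. norm (f l))" by (intro continuous_intros) auto
  then obtain k0 where k0: "\<And>l. norm (f l) \<le> norm (f k0)"
    using continuous_attains_sup[OF K] by blast
  have nf: "norm (f k0) = norm f" by (intro antisym norm_bounded norm_bound k0)
  obtain \<theta> where \<theta>: "norm \<theta> = 1" "\<theta> * f k0 = of_real (norm (f k0))" using obtain_rotation by blast
  let ?g = "scale_bcontfun \<theta> f"
  have g: "?g \<in> A" using f by blast
  have gn: "norm (?g l) \<le> norm f" for l using \<theta> norm_bounded[of f l] by (simp add: norm_mult)
  have "stable UNIV" by (auto simp: stable_def)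
  from stable_max_set[OF this g] obtain k where
    k: "k \<in> {l \<in> UNIV. \<forall>m\<in>UNIV. re (?g m) \<le> re (?g l)}" "k \<in> choquet_boundary A"
    by (rule stable_meets_choquet_boundary)
  then have "norm f \<le> re (?g k)" using \<theta>(2) nf by (auto dest!: bspec[of _ _ k0] spec[of _ k0])
  also have "\<dots> \<le> norm (?g k)" by (rule re_le)
  finally have "norm (f k) = norm f" using \<theta>(1) norm_bounded[of f k] by (simp add: norm_mult)
  then show ?thesis using that k(2) by blast
qed

lemma power_A: "b \<in> A \<Longrightarrow> \<exists>u\<in>A. \<forall>l. u l = (b l) ^ n"
proof (induction n)
  case 0
  show ?case using const_A[of 1] by (intro bexI[of _ "const_bcontfun 1"]) auto
next
  case (Suc n)
  then obtain u where u: "u \<in> A" "\<forall>l. apply_bcontfun u l = (b l) ^ n" by blast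
  obtain v where "v \<in> A" "\<forall>l. apply_bcontfun v l = b l * u l" using mult_A[OF Suc.prems u(1)] by blast
  then show ?case using u(2) by auto
qed

lemma bump:
  assumes U: "open U" "k \<in> U"
  obtains \<phi> :: "'c \<Rightarrow>\<^sub>C real" and V where "open V" "k \<in> V" "V \<subseteq> U" "\<forall>l\<in>V. \<phi> l = 1"
    "\<forall>l. l \<notin> U \<longrightarrow> \<phi> l = 0" "\<forall>l. 0 \<le> \<phi> l \<and> \<phi> l \<le> 1"
proof -
  have "normal_space (euclidean :: 'c topology)"
    by (rule compact_Hausdorff_or_regular_imp_normal_space)
      (use K in \<open>auto simp: compact_space_def Hausdorff_space_def separation_t2 disjnt_def\<close>)
  moreover have "closedin euclidean {k}" "closedin euclidean (- U)" "disjnt {k} (- U)"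
    using U by (auto simp: disjnt_def)
  ultimately obtain f :: "'c \<Rightarrow> real" where f: "continuous_map euclidean euclideanreal f"
    "f ` {k} \<subseteq> {2}" "f ` (- U) \<subseteq> {0}"
    by (rule Urysohn_lemma_alt)
  have cont: "continuous_on UNIV f" using f(1) by simp
  have "continuous_on UNIV (\<lambda>l. min 1 (max 0 (f l)))" by (intro continuous_intros cont)
  then obtain \<phi> :: "'c \<Rightarrow>\<^sub>C real" where \<phi>: "apply_bcontfun \<phi> = (\<lambda>l. min 1 (max 0 (f l)))"
    by (rule obtain_bcontfun[OF K])
  have fk: "f k = 2" and fU: "\<And>l. l \<notin> U \<Longrightarrow> f l = 0" using f(2,3) by auto
  show ?thesis
  proof (rule that)
    show "open {l. 1 < f l}" by (intro open_Collect_less continuous_intros cont)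
    show "k \<in> {l. 1 < f l}" by (simp add: fk)
    show "{l. 1 < f l} \<subseteq> U" using fU by force
    show "\<forall>l\<in>{l. 1 < f l}. \<phi> l = 1" by (simp add: \<phi>)
    show "\<forall>l. l \<notin> U \<longrightarrow> \<phi> l = 0" using fU by (simp add: \<phi>)
    show "\<forall>l. 0 \<le> \<phi> l \<and> \<phi> l \<le> 1" by (simp add: \<phi>)
  qed
qed

text \<open>There is \<open>a\<close> in \<open>A\<close> with \<open>re a \<ge> 0\<close>, with \<open>re a\<close> large off \<open>U\<close> and \<open>re a(k)\<close> small. The function
  wanted is an approximation of \<open>exp (-a)\<close>, namely \<open>(1 - a/n)\<^sup>n\<close> with \<open>n \<ge> \<parallel>a\<parallel>\<^sup>2\<close>.\<close>

lemma peaking_function: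
  assumes k: "k \<in> choquet_boundary A" and U: "open U" "k \<in> U" and e: "0 < e"
  obtains u where "u \<in> A" "\<And>l. norm (u l) \<le> 2" "1 / 2 \<le> norm (u k)" "\<And>l. l \<notin> U \<Longrightarrow> norm (u l) \<le> e"
proof -
  obtain \<phi> :: "'c \<Rightarrow>\<^sub>C real" and V where \<phi>: "open V" "k \<in> V" "V \<subseteq> U" "\<forall>l\<in>V. \<phi> l = 1"
    "\<forall>l. l \<notin> U \<longrightarrow> \<phi> l = 0" "\<forall>l. 0 \<le> \<phi> l \<and> \<phi> l \<le> 1"
    by (rule bump[OF U])
  then have \<phi>_V: "\<And>l. l \<in> V \<Longrightarrow> \<phi> l = 1" and \<phi>_U: "\<And>l. l \<notin> U \<Longrightarrow> \<phi> l = 0"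
    and \<phi>_01: "\<And>l. 0 \<le> \<phi> l" "\<And>l. \<phi> l \<le> 1" by auto
  define M where "M = max 0 (1 / 2 - ln e)"
  let ?h = "M *\<^sub>R (const_bcontfun 1 - \<phi>)"
  obtain \<Lambda> a where \<Lambda>: "represents (pe k) \<Lambda>" and a: "a \<in> A" "\<And>l. ?h l \<le> re (a l)"
    "re (pe k a) < \<Lambda> ?h + 1 / 2"
    using representing_functional[OF positive_pe_state, of "1 / 2" k ?h] by auto
  have "\<Lambda> ?h = ?h k"
  proof (rule positive_eq_evaluation[OF K])
    show "positive \<Lambda>" using \<Lambda> by (simp add: represents_def)
    show "supp \<Lambda> \<subseteq> {k}" using k \<Lambda> by (rule supp_represents_extreme)
  qed (rule represents_pe_one[OF \<Lambda>])
  then have ak: "re (a k) < 1 / 2" using a(1,3) \<phi>(2) \<phi>_V by (simp add: pe)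
  have a0: "0 \<le> re (a l)" for l
  proof -
    have "0 \<le> ?h l" using \<phi>_01(2)[of l] by (simp add: M_def)
    then show ?thesis using a(2)[of l] by linarith
  qed
  have aU: "M \<le> re (a l)" if "l \<notin> U" for l using a(2)[of l] \<phi>_U[OF that] by simp
  obtain n :: nat where n: "(norm a)\<^sup>2 + 1 < real n" using reals_Archimedean2 by blast
  then have n0: "0 < real n" using zero_le_power2[of "norm a"] by linarith
  let ?b = "const_bcontfun 1 - (1 / real n) *\<^sub>R a"
  have "?b \<in> A" using a const_A by auto
  then obtain u where u: "u \<in> A" "\<And>l. u l = (?b l) ^ n" using power_A by blast
  have u_sq: "(norm (u l))\<^sup>2 \<le> exp (1 - 2 * re (a l))" for l
  proof -
    define y where "y = (1 - 2 * re (a l)) / real n"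
    have "(norm (?b l))\<^sup>2 = 1 + (norm ((1 / real n) *\<^sub>R a l))\<^sup>2 - 2 * re ((1 / real n) *\<^sub>R a l)"
      using norm_1_diff_sq[of "(1 / real n) *\<^sub>R a l"] by simp
    also have "\<dots> = 1 + ((norm (a l))\<^sup>2 / real n - 2 * re (a l)) / real n"
      using n0 by (simp add: power2_eq_square field_simps)
    also have "\<dots> \<le> 1 + y"
    proof -
      have "(norm (a l))\<^sup>2 \<le> (norm a)\<^sup>2" by (intro power_mono norm_bounded) simp
      then have "(norm (a l))\<^sup>2 \<le> real n" using n by linarith
      then have "(norm (a l))\<^sup>2 / real n \<le> 1" using n0 by simp
      then show ?thesis unfolding y_def using n0 by (intro add_left_mono divide_right_mono) auto
    qed
    also have "\<dots> \<le> exp y" by (rule exp_ge_add_one_self)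
    finally have "((norm (?b l))\<^sup>2) ^ n \<le> exp y ^ n" by (intro power_mono) auto
    also have "exp y ^ n = exp (1 - 2 * re (a l))"
      using n0 by (simp add: y_def flip: exp_of_nat_mult)
    finally show ?thesis by (simp add: u(2) norm_power power_mult[symmetric] mult.commute)
  qed
  have "norm (u l) \<le> 2" for l
  proof -
    have "(norm (u l))\<^sup>2 \<le> exp 1" using u_sq[of l] a0[of l] by (auto intro: order_trans)
    also have "\<dots> \<le> 2\<^sup>2" using exp_le by simp
    finally show ?thesis by (rule power2_le_imp_le) simp
  qed
  moreover have "norm (u l) \<le> e" if "l \<notin> U" for l
  proof -
    have "1 - 2 * re (a l) \<le> 2 * ln e" using aU[OF that] by (simp add: M_def)
    then have "(norm (u l))\<^sup>2 \<le> exp (2 * ln e)" using u_sq[of l] by (meson exp_le_cancel_iff order_trans)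
    also have "\<dots> = e\<^sup>2" using e by (simp add: exp_double)
    finally show ?thesis using e by (rule power2_le_imp_le[OF _ less_imp_le])
  qed
  moreover have "1 / 2 \<le> norm (u k)"
  proof -
    define x where "x = re (a k) / real n"
    have x: "0 \<le> x" "x \<le> 1"
    proof -
      have "1 \<le> real n" using n zero_le_power2[of "norm a"] by linarith
      then show "0 \<le> x" "x \<le> 1" using a0[of k] ak by (simp_all add: x_def field_simps)
    qed
    have "1 - x \<le> re (?b k)" by (simp add: x_def)
    also have "\<dots> \<le> norm (?b k)" by (rule re_le)
    finally have "(1 - x) ^ n \<le> norm (?b k) ^ n" using x by (intro power_mono) auto
    moreover have "1 + real n * (- x) \<le> (1 + (- x)) ^ n" using x by (intro Bernoulli_inequality) simp
    moreover have "real n * x = re (a k)" using n0 by (simp add: x_def)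
    ultimately show ?thesis using ak by (simp add: u(2) norm_power)
  qed
  ultimately show ?thesis using that u(1) by blast
qed

end

section \<open>Atoms of functionals on \<open>C(K)\<close>\<close>

text \<open>For the measure \<open>\<mu>\<close> representing \<open>\<Phi>\<close> this says that \<open>\<mu> {k} = c\<close>.\<close>

definition atom :: "(('c::t2_space \<Rightarrow>\<^sub>C 'k::rc_scalar) \<Rightarrow> 'k) \<Rightarrow> 'c \<Rightarrow> 'k \<Rightarrow> bool" where
  "atom \<Phi> k c \<longleftrightarrow> (\<forall>e>0. \<exists>U. open U \<and> k \<in> U \<and>
     (\<forall>g. norm g \<le> 1 \<longrightarrow> (\<forall>l. l \<notin> U \<longrightarrow> apply_bcontfun g l = 0) \<longrightarrow> norm (\<Phi> g - c * g k) \<le> e))"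

context fun_alg
begin

sublocale CK: normed_subspace "scale_bcontfun :: 'k \<Rightarrow> ('c \<Rightarrow>\<^sub>C 'k) \<Rightarrow> _" UNIV
  by (rule subspace_UNIV)

abbreviation CKdual where "CKdual \<equiv> dual scale_bcontfun (UNIV :: ('c \<Rightarrow>\<^sub>C 'k) set)"

text \<open>Otherwise one could choose, successively, arbitrarily many functions \<open>g\<close> with pairwise disjoint
  supports, norm at most 1 and, after a rotation, \<open>re (\<Phi> g) > e / 2\<close>; their sums would have norm at
  most 1.\<close>

lemma small_near_point:
  assumes \<Phi>: "\<Phi> \<in> CKdual" and e: "0 < e"
  obtains U where "open U" "k \<in> U"
    "\<And>g. norm g \<le> 1 \<Longrightarrow> (\<And>l. l \<notin> U \<Longrightarrow> apply_bcontfun g l = 0) \<Longrightarrow> g k = 0 \<Longrightarrow> norm (\<Phi> g) \<le> e"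
proof (rule ccontr)
  assume no: "\<not> thesis"
  note thesisI = that
  have ex: "\<exists>g. norm g \<le> 1 \<and> (\<forall>l. l \<notin> U \<longrightarrow> apply_bcontfun g l = 0) \<and> g k = 0 \<and> e < norm (\<Phi> g)"
    if U: "open U" "k \<in> U" for U
  proof (rule ccontr)
    assume "\<not> ?thesis"
    then have "norm (\<Phi> g) \<le> e"
      if "norm g \<le> 1" "\<And>l. l \<notin> U \<Longrightarrow> apply_bcontfun g l = 0" "g k = 0" for g
      using that not_le by blast
    then show False using no thesisI[OF U] by blast
  qed
  define N where "N = dual_norm UNIV \<Phi>"
  have N: "0 \<le> N" "\<And>g. norm (\<Phi> g) \<le> N * norm g"
    using CK.dual_norm_nonneg[OF \<Phi>] CK.norm_le_dual_norm[OF \<Phi>] by (auto simp: N_def)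
  have step: "\<exists>g V'. norm g \<le> 1 \<and> (\<forall>l. l \<notin> V \<longrightarrow> apply_bcontfun g l = 0) \<and> open V' \<and> k \<in> V' \<and>
      (\<forall>l\<in>V'. g l = 0) \<and> e / 2 < norm (\<Phi> g)" if V: "open V" "k \<in> V" for V
  proof -
    obtain g where g: "norm g \<le> 1" "\<And>l. l \<notin> V \<Longrightarrow> apply_bcontfun g l = 0" "g k = 0" "e < norm (\<Phi> g)"
      using ex[OF V] by blast
    define \<eta> where "\<eta> = e / (2 * (N + 1))"
    have \<eta>: "0 < \<eta>" "N * \<eta> < e / 2" using e N(1) by (simp_all add: \<eta>_def field_simps)
    let ?W = "{l. norm (g l) < \<eta>}"
    have "open ?W" by (intro open_Collect_less continuous_intros) auto
    moreover have "k \<in> ?W" using g(3) \<eta> by simp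
    ultimately have W: "open ?W" "k \<in> ?W" by auto
    obtain \<phi> :: "'c \<Rightarrow>\<^sub>C real" and V' where \<phi>: "open V'" "k \<in> V'" "V' \<subseteq> ?W"
      "\<forall>l\<in>V'. \<phi> l = 1" "\<forall>l. l \<notin> ?W \<longrightarrow> \<phi> l = 0" "\<forall>l. 0 \<le> \<phi> l \<and> \<phi> l \<le> 1"
      by (rule bump[OF W])
    then have \<phi>_V: "\<And>l. l \<in> V' \<Longrightarrow> \<phi> l = 1" and \<phi>_U: "\<And>l. l \<notin> ?W \<Longrightarrow> \<phi> l = 0"
      and \<phi>_01: "\<And>l. 0 \<le> \<phi> l" "\<And>l. \<phi> l \<le> 1" by auto
    let ?g = "g - mult_fun \<phi> g"
    have g_eq: "?g l = (1 - \<phi> l) *\<^sub>R g l" for l by (simp add: scaleR_left_diff_distrib)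
    have "norm ?g \<le> 1"
    proof (rule norm_bound)
      fix l
      have "norm (?g l) = (1 - \<phi> l) * norm (g l)" unfolding g_eq using \<phi>_01(2)[of l] by simp
      also have "\<dots> \<le> 1 * 1"
        using \<phi>_01[of l] norm_bounded[of g l] g(1) by (intro mult_mono) auto
      finally show "norm (?g l) \<le> 1" by simp
    qed
    moreover have "norm (mult_fun \<phi> g) \<le> \<eta>"
    proof (rule norm_bound)
      fix l
      show "norm (mult_fun \<phi> g l) \<le> \<eta>"
      proof (cases "l \<in> ?W")
        case True
        have "\<phi> l * norm (g l) \<le> 1 * \<eta>" using True \<phi>_01[of l] by (intro mult_mono) auto
        then show ?thesis using \<phi>_01(1)[of l] by simp
      next
        case False
        then show ?thesis using \<phi>_U[OF False] \<eta> by simp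
      qed
    qed
    then have "N * norm (mult_fun \<phi> g) \<le> N * \<eta>" using N(1) by (intro mult_left_mono)
    then have "norm (\<Phi> (mult_fun \<phi> g)) < e / 2" using N(2)[of "mult_fun \<phi> g"] \<eta>(2) by linarith
    moreover have "\<Phi> ?g = \<Phi> g - \<Phi> (mult_fun \<phi> g)" using \<Phi> by (simp add: CK.dual_diff)
    ultimately have "e / 2 < norm (\<Phi> ?g)"
      using g(4) norm_triangle_ineq2[of "\<Phi> g" "\<Phi> (mult_fun \<phi> g)"] by simp
    then show ?thesis
      using \<open>norm ?g \<le> 1\<close> g(2) \<phi>(1,2) \<phi>_V by (intro exI[of _ ?g] exI[of _ V']) auto
  qed
  have many: "\<exists>g V. norm g \<le> 1 \<and> open V \<and> k \<in> V \<and> (\<forall>l\<in>V. apply_bcontfun g l = 0) \<and>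
      real n * (e / 2) \<le> re (\<Phi> g)" for n :: nat
  proof (induction n)
    case 0
    show ?case
      using \<Phi> by (intro exI[of _ 0] exI[of _ UNIV]) (auto simp: CK.dual_0)
  next
    case (Suc n)
    then obtain g V where g: "norm g \<le> 1" "open V" "k \<in> V" "\<And>l. l \<in> V \<Longrightarrow> apply_bcontfun g l = 0"
      "real n * (e / 2) \<le> re (\<Phi> g)" by blast
    obtain g' V' where g': "norm g' \<le> 1" "\<And>l. l \<notin> V \<Longrightarrow> apply_bcontfun g' l = 0" "open V'" "k \<in> V'"
      "\<And>l. l \<in> V' \<Longrightarrow> g' l = 0" "e / 2 < norm (\<Phi> g')" using step[OF g(2,3)] by blast
    obtain \<theta> where \<theta>: "norm \<theta> = 1" "\<Phi> (scale_bcontfun \<theta> g') = of_real (norm (\<Phi> g'))"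
      using CK.rotate_dual[OF \<Phi>, of g'] by blast
    let ?g = "g + scale_bcontfun \<theta> g'"
    have "norm ?g \<le> 1"
    proof (rule norm_bound)
      fix l
      show "norm (?g l) \<le> 1"
      proof (cases "l \<in> V")
        case True
        then show ?thesis using g(4)[OF True] g'(1) \<theta>(1) norm_bounded[of g' l] by (simp add: norm_mult)
      next
        case False
        then show ?thesis using g'(2)[OF False] g(1) norm_bounded[of g l] by simp
      qed
    qed
    moreover have "real (Suc n) * (e / 2) \<le> re (\<Phi> ?g)"
      using \<Phi> \<theta>(2) g(5) g'(6) by (simp add: CK.dual_add distrib_right)
    moreover have "\<forall>l\<in>V \<inter> V'. ?g l = 0" using g(4) g'(5) by simp
    ultimately show ?case using g(2,3) g'(3,4) by (intro exI[of _ ?g] exI[of _ "V \<inter> V'"]) auto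
  qed
  obtain n :: nat where "N / (e / 2) < real n" using reals_Archimedean2 by blast
  then have n: "N < real n * (e / 2)" using e by (simp add: field_simps)
  obtain g where g: "norm g \<le> 1" "real n * (e / 2) \<le> re (\<Phi> g)" using many[of n] by blast
  have "re (\<Phi> g) \<le> N * norm g" using re_le[of "\<Phi> g"] N(2)[of g] by linarith
  also have "\<dots> \<le> N * 1" using g(1) N(1) by (intro mult_left_mono)
  finally show False using g(2) n by simp
qed

text \<open>The mass at \<open>k\<close> is the limit of \<open>\<Phi> (\<phi> n)\<close> for bump functions \<open>\<phi> n\<close> with \<open>\<phi> n k = 1\<close> whose
  supports shrink fast enough: differences of such functions vanish at \<open>k\<close>, so that the previous
  lemma applies to them.\<close>

lemma atom_exists:
  assumes \<Phi>: "\<Phi> \<in> CKdual"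
  obtains c where "atom \<Phi> k c"
proof -
  have "\<exists>U. open U \<and> k \<in> U \<and>
      (\<forall>g. norm g \<le> 1 \<longrightarrow> (\<forall>l. l \<notin> U \<longrightarrow> apply_bcontfun g l = 0) \<longrightarrow> g k = 0 \<longrightarrow> norm (\<Phi> g) \<le> 1 / real (Suc n))" for n
    using small_near_point[OF \<Phi>, of "1 / real (Suc n)" k] by (metis of_nat_0_less_iff zero_less_Suc zero_less_divide_1_iff)
  then obtain U where U: "\<And>n. open (U n)" "\<And>n. k \<in> U n"
    "\<And>n g. norm g \<le> 1 \<Longrightarrow> (\<And>l. l \<notin> U n \<Longrightarrow> apply_bcontfun g l = 0) \<Longrightarrow> g k = 0 \<Longrightarrow>
      norm (\<Phi> g) \<le> 1 / real (Suc n)" by metis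
  let ?U = "\<lambda>n. \<Inter>i\<le>n. U i"
  have "\<exists>\<phi> :: 'c \<Rightarrow>\<^sub>C 'k. norm \<phi> \<le> 1 \<and> apply_bcontfun \<phi> k = 1 \<and>
      (\<forall>l. l \<notin> ?U n \<longrightarrow> apply_bcontfun \<phi> l = 0) \<and>
      (\<forall>l. \<exists>r. 0 \<le> r \<and> r \<le> 1 \<and> apply_bcontfun \<phi> l = of_real r)" for n
  proof -
    have Un: "open (?U n)" "k \<in> ?U n" using U(1,2) by auto
    obtain \<phi> :: "'c \<Rightarrow>\<^sub>C real" and V where \<phi>: "open V" "k \<in> V" "V \<subseteq> ?U n" "\<forall>l\<in>V. \<phi> l = 1"
      "\<forall>l. l \<notin> ?U n \<longrightarrow> \<phi> l = 0" "\<forall>l. 0 \<le> \<phi> l \<and> \<phi> l \<le> 1"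
      by (rule bump[OF Un])
    then have \<phi>_V: "\<And>l. l \<in> V \<Longrightarrow> \<phi> l = 1" and \<phi>_U: "\<And>l. l \<notin> ?U n \<Longrightarrow> \<phi> l = 0"
      and \<phi>_01: "\<And>l. 0 \<le> \<phi> l" "\<And>l. \<phi> l \<le> 1" by auto
    let ?\<phi> = "mult_fun \<phi> (const_bcontfun 1) :: 'c \<Rightarrow>\<^sub>C 'k"
    have "norm ?\<phi> \<le> 1" by (rule norm_bound) (use \<phi>_01 in simp)
    moreover have "\<exists>r. 0 \<le> r \<and> r \<le> 1 \<and> ?\<phi> l = of_real r" for l
      using \<phi>_01[of l] by (intro exI[of _ "\<phi> l"]) (simp add: of_real_def)
    ultimately show ?thesis using \<phi>(2) \<phi>_V \<phi>_U by (intro exI[of _ ?\<phi>]) auto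
  qed
  then obtain \<phi> :: "nat \<Rightarrow> 'c \<Rightarrow>\<^sub>C 'k" where \<phi>: "\<And>n. norm (\<phi> n) \<le> 1" "\<And>n. \<phi> n k = 1"
    "\<And>n l. l \<notin> ?U n \<Longrightarrow> \<phi> n l = 0" "\<And>n l. \<exists>r. 0 \<le> r \<and> r \<le> 1 \<and> \<phi> n l = of_real r"
    by metis
  have diff: "norm (\<Phi> (\<phi> m) - \<Phi> (\<phi> n)) \<le> 1 / real (Suc N)" if mn: "N \<le> m" "N \<le> n" for m n N
  proof -
    have "norm (\<phi> m - \<phi> n) \<le> 1"
    proof (rule norm_bound)
      fix l
      obtain r s where "0 \<le> r" "r \<le> 1" "\<phi> m l = of_real r" "0 \<le> s" "s \<le> 1" "\<phi> n l = of_real s"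
        using \<phi>(4) by metis
      then show "norm ((\<phi> m - \<phi> n) l) \<le> 1" by (simp flip: of_real_diff)
    qed
    then have "norm (\<Phi> (\<phi> m - \<phi> n)) \<le> 1 / real (Suc N)"
    proof (rule U(3))
      show "(\<phi> m - \<phi> n) l = 0" if "l \<notin> U N" for l
      proof -
        have "l \<notin> ?U m" "l \<notin> ?U n" using that mn by blast+
        then show ?thesis by (simp add: \<phi>(3))
      qed
    qed (simp add: \<phi>(2))
    then show ?thesis using \<Phi> by (simp add: CK.dual_diff)
  qed
  have arch: "\<exists>N. 1 / real (Suc N) < e" if "0 < e" for e
    using reals_Archimedean[OF that] by (auto simp: inverse_eq_divide)
  have "Cauchy (\<lambda>n. \<Phi> (\<phi> n))"
  proof (rule metric_CauchyI)
    fix e :: real assume "0 < e"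
    then obtain N where N: "1 / real (Suc N) < e" using arch by blast
    have "dist (\<Phi> (\<phi> m)) (\<Phi> (\<phi> n)) < e" if "N \<le> m" "N \<le> n" for m n
      using le_less_trans[OF diff[OF that] N] by (simp only: dist_norm)
    then show "\<exists>M. \<forall>m\<ge>M. \<forall>n\<ge>M. dist (\<Phi> (\<phi> m)) (\<Phi> (\<phi> n)) < e" by blast
  qed
  then obtain c where c: "(\<lambda>n. \<Phi> (\<phi> n)) \<longlonglongrightarrow> c" using convergent_eq_Cauchy by blast
  have near_c: "norm (\<Phi> (\<phi> N) - c) \<le> 1 / real (Suc N)" for N
  proof (rule tendsto_upperbound)
    show "(\<lambda>n. norm (\<Phi> (\<phi> N) - \<Phi> (\<phi> n))) \<longlonglongrightarrow> norm (\<Phi> (\<phi> N) - c)" by (intro tendsto_intros c)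
    show "\<forall>\<^sub>F n in sequentially. norm (\<Phi> (\<phi> N) - \<Phi> (\<phi> n)) \<le> 1 / real (Suc N)"
      using diff[of N N] by (auto simp: eventually_sequentially)
  qed simp
  have "atom \<Phi> k c"
    unfolding atom_def
  proof (intro allI impI)
    fix e :: real assume e: "0 < e"
    then have "0 < e / 3" by simp
    then obtain N where N: "1 / real (Suc N) < e / 3" using arch by blast
    show "\<exists>W. open W \<and> k \<in> W \<and> (\<forall>g. norm g \<le> 1 \<longrightarrow> (\<forall>l. l \<notin> W \<longrightarrow> apply_bcontfun g l = 0) \<longrightarrow>
        norm (\<Phi> g - c * g k) \<le> e)"
    proof (intro exI[of _ "U N"] conjI U allI impI)
      fix g :: "'c \<Rightarrow>\<^sub>C 'k" assume g: "norm g \<le> 1" "\<forall>l. l \<notin> U N \<longrightarrow> g l = 0"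
      have gk: "norm (g k) \<le> 1" using norm_bounded[of g k] g(1) by simp
      let ?d = "g - scale_bcontfun (g k) (\<phi> N)"
      have "norm (scale_bcontfun (g k) (\<phi> N)) \<le> 1 * 1"
        unfolding CK.norm_sc using gk \<phi>(1)[of N] by (intro mult_mono) auto
      then have "norm ?d \<le> 2" using norm_triangle_ineq4[of g "scale_bcontfun (g k) (\<phi> N)"] g(1) by simp
      then have "norm ((1 / 2) *\<^sub>R ?d) \<le> 1" by simp
      then have "norm (\<Phi> ((1 / 2) *\<^sub>R ?d)) \<le> 1 / real (Suc N)"
      proof (rule U(3))
        show "((1 / 2) *\<^sub>R ?d) l = 0" if "l \<notin> U N" for l
        proof -
          have "l \<notin> ?U N" using that by blast
          then show ?thesis using g(2) that by (simp add: \<phi>(3))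
        qed
      qed (simp add: \<phi>(2))
      then have d: "norm (\<Phi> ?d) \<le> 2 / real (Suc N)"
        using \<Phi> by (simp add: CK.dual_scaleR norm_mult del: of_nat_Suc of_real_divide)
      have "\<Phi> ?d = \<Phi> g - g k * \<Phi> (\<phi> N)" using \<Phi> by (simp add: CK.dual_diff CK.dual_sc)
      then have "\<Phi> g - c * g k = \<Phi> ?d + g k * (\<Phi> (\<phi> N) - c)" by (simp add: algebra_simps)
      also have "norm \<dots> \<le> norm (\<Phi> ?d) + norm (g k) * norm (\<Phi> (\<phi> N) - c)"
        by (metis norm_mult norm_triangle_ineq)
      also have "\<dots> \<le> 2 / real (Suc N) + 1 * (1 / real (Suc N))"
        using d gk near_c[of N] by (intro add_mono mult_mono) auto
      finally show "norm (\<Phi> g - c * g k) \<le> e" using N by simp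
    qed
  qed
  then show ?thesis using that by blast
qed

end

lemma atomD:
  fixes \<Phi> :: "('c::t2_space \<Rightarrow>\<^sub>C 'k::rc_scalar) \<Rightarrow> 'k"
  assumes "atom \<Phi> k c" "0 < e"
  obtains U where "open U" "k \<in> U"
    "\<And>g. norm g \<le> 1 \<Longrightarrow> \<forall>l. l \<notin> U \<longrightarrow> apply_bcontfun g l = 0 \<Longrightarrow> norm (\<Phi> g - c * apply_bcontfun g k) \<le> e"
  using assms unfolding atom_def by blast

lemma atom_add:
  fixes \<Phi> \<Psi> :: "('c::t2_space \<Rightarrow>\<^sub>C 'k::rc_scalar) \<Rightarrow> 'k"
  assumes "atom \<Phi> k c" "atom \<Psi> k d"
  shows "atom (\<lambda>g. \<Phi> g + \<Psi> g) k (c + d)"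
  unfolding atom_def
proof (intro allI impI)
  fix e :: real assume "0 < e"
  then have e: "0 < e / 2" by simp
  obtain U where U: "open U" "k \<in> U"
    "\<And>g. norm g \<le> 1 \<Longrightarrow> \<forall>l. l \<notin> U \<longrightarrow> apply_bcontfun g l = 0 \<Longrightarrow> norm (\<Phi> g - c * apply_bcontfun g k) \<le> e / 2"
    using atomD[OF assms(1) e] by metis
  obtain V where V: "open V" "k \<in> V"
    "\<And>g. norm g \<le> 1 \<Longrightarrow> \<forall>l. l \<notin> V \<longrightarrow> apply_bcontfun g l = 0 \<Longrightarrow> norm (\<Psi> g - d * apply_bcontfun g k) \<le> e / 2"
    using atomD[OF assms(2) e] by metis
  show "\<exists>W. open W \<and> k \<in> W \<and> (\<forall>g. norm g \<le> 1 \<longrightarrow> (\<forall>l. l \<notin> W \<longrightarrow> apply_bcontfun g l = 0) \<longrightarrow>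
      norm (\<Phi> g + \<Psi> g - (c + d) * apply_bcontfun g k) \<le> e)"
  proof (intro exI[of _ "U \<inter> V"] conjI allI impI)
    fix g :: "'c \<Rightarrow>\<^sub>C 'k" assume g: "norm g \<le> 1" "\<forall>l. l \<notin> U \<inter> V \<longrightarrow> apply_bcontfun g l = 0"
    have "\<Phi> g + \<Psi> g - (c + d) * apply_bcontfun g k = (\<Phi> g - c * apply_bcontfun g k) + (\<Psi> g - d * apply_bcontfun g k)"
      by (simp add: algebra_simps)
    also have "norm \<dots> \<le> e / 2 + e / 2"
      using g by (intro norm_triangle_le add_mono U(3) V(3)) auto
    finally show "norm (\<Phi> g + \<Psi> g - (c + d) * apply_bcontfun g k) \<le> e" by simp
  qed (use U V in auto)
qed

lemma atom_cmult:
  fixes \<Phi> :: "('c::t2_space \<Rightarrow>\<^sub>C 'k::rc_scalar) \<Rightarrow> 'k"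
  assumes "atom \<Phi> k c"
  shows "atom (\<lambda>g. a * \<Phi> g) k (a * c)"
  unfolding atom_def
proof (intro allI impI)
  fix e :: real assume e0: "0 < e"
  have pos: "0 < norm a + 1" by (simp add: add_nonneg_pos)
  then have e: "0 < e / (norm a + 1)" using e0 by simp
  obtain U where U: "open U" "k \<in> U"
    "\<And>g. norm g \<le> 1 \<Longrightarrow> \<forall>l. l \<notin> U \<longrightarrow> apply_bcontfun g l = 0 \<Longrightarrow>
      norm (\<Phi> g - c * apply_bcontfun g k) \<le> e / (norm a + 1)"
    using atomD[OF assms e] by metis
  show "\<exists>W. open W \<and> k \<in> W \<and> (\<forall>g. norm g \<le> 1 \<longrightarrow> (\<forall>l. l \<notin> W \<longrightarrow> apply_bcontfun g l = 0) \<longrightarrow>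
      norm (a * \<Phi> g - a * c * apply_bcontfun g k) \<le> e)"
  proof (intro exI[of _ U] conjI allI impI U(1,2))
    fix g :: "'c \<Rightarrow>\<^sub>C 'k" assume g: "norm g \<le> 1" "\<forall>l. l \<notin> U \<longrightarrow> apply_bcontfun g l = 0"
    have "norm (a * \<Phi> g - a * c * apply_bcontfun g k) = norm a * norm (\<Phi> g - c * apply_bcontfun g k)"
      by (simp add: right_diff_distrib mult.assoc flip: norm_mult)
    also have "\<dots> \<le> (norm a + 1) * (e / (norm a + 1))"
      using U(3)[OF g] by (intro mult_mono) auto
    also have "\<dots> = e" using pos by simp
    finally show "norm (a * \<Phi> g - a * c * apply_bcontfun g k) \<le> e" .
  qed
qed

lemma atom_evaluation: "atom (\<lambda>g. apply_bcontfun g k) k 1"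
  unfolding atom_def by (auto intro!: exI[of _ UNIV])

lemma atom_diff:
  fixes \<Phi> \<Psi> :: "('c::t2_space \<Rightarrow>\<^sub>C 'k::rc_scalar) \<Rightarrow> 'k"
  assumes "atom \<Phi> k c" "atom \<Psi> k d"
  shows "atom (\<lambda>g. \<Phi> g - \<Psi> g) k (c - d)"
  using atom_add[OF assms(1) atom_cmult[OF assms(2), of "-1"]] by simp

lemma atom_remove:
  fixes \<Phi> :: "('c::t2_space \<Rightarrow>\<^sub>C 'k::rc_scalar) \<Rightarrow> 'k"
  assumes "atom \<Phi> k c"
  shows "atom (\<lambda>g. \<Phi> g - c * apply_bcontfun g k) k 0"
  using atom_diff[OF assms atom_cmult[OF atom_evaluation[of k], of c]] by simp

context fun_alg
begin

lemma eval_dual: "(\<lambda>g. apply_bcontfun g k) \<in> CKdual"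
  by (rule CK.dualI[where C=1]) (auto simp: norm_bounded)

text \<open>A function at which \<open>\<Psi>\<close> almost attains its norm can be changed near \<open>k\<close> so that its value at \<open>k\<close>
  becomes any given unimodular number; this hardly affects \<open>\<Psi>\<close>, which has no mass at \<open>k\<close>.\<close>

lemma norm_ge_atom_plus_rest:
  assumes \<Psi>: "\<Psi> \<in> CKdual" "atom \<Psi> k 0"
  shows "norm c + dual_norm UNIV \<Psi> \<le> dual_norm UNIV (\<lambda>g. c * apply_bcontfun g k + \<Psi> g)"
proof (rule field_le_epsilon)
  fix e :: real assume e0: "0 < e"
  then have e: "0 < e / 3" by simp
  obtain U where U: "open U" "k \<in> U"
    "\<And>g. norm g \<le> 1 \<Longrightarrow> \<forall>l. l \<notin> U \<longrightarrow> apply_bcontfun g l = 0 \<Longrightarrow> norm (\<Psi> g - 0 * apply_bcontfun g k) \<le> e / 3"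
    using atomD[OF \<Psi>(2) e] by metis
  obtain g where g: "norm g \<le> 1" "dual_norm UNIV \<Psi> - e / 3 < re (\<Psi> g)"
    using CK.dual_norm_approx[OF \<Psi>(1) e] by metis
  obtain \<phi> :: "'c \<Rightarrow>\<^sub>C real" and V where \<phi>: "open V" "k \<in> V" "V \<subseteq> U" "\<forall>l\<in>V. \<phi> l = 1"
    "\<forall>l. l \<notin> U \<longrightarrow> \<phi> l = 0" "\<forall>l. 0 \<le> \<phi> l \<and> \<phi> l \<le> 1"
    by (rule bump[OF U(1,2)])
  obtain \<theta> where \<theta>: "norm \<theta> = 1" "\<theta> * c = of_real (norm c)" using obtain_rotation by blast
  let ?h = "(1 / 2) *\<^sub>R mult_fun \<phi> (const_bcontfun \<theta> - g)"
  let ?g = "g + 2 *\<^sub>R ?h"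
  have "norm ?h \<le> 1"
  proof (rule norm_bound)
    fix l
    have "norm (\<theta> - g l) \<le> 2"
      using norm_triangle_ineq4[of \<theta> "g l"] \<theta>(1) norm_bounded[of g l] g(1) by linarith
    then have "\<phi> l * norm (\<theta> - g l) \<le> 1 * 2" using \<phi>(6) by (intro mult_mono) auto
    then show "norm (?h l) \<le> 1" using \<phi>(6) by simp
  qed
  then have \<Psi>h: "norm (\<Psi> ?h) \<le> e / 3" using U(3)[of ?h] \<phi>(5) by simp
  have "norm ?g \<le> 1"
  proof (rule norm_bound)
    fix l
    have "?g l = (1 - \<phi> l) *\<^sub>R g l + \<phi> l *\<^sub>R \<theta>" by (simp add: algebra_simps)
    then have "norm (?g l) \<le> (1 - \<phi> l) * norm (g l) + \<phi> l * norm \<theta>"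
      using norm_triangle_ineq[of "(1 - \<phi> l) *\<^sub>R g l" "\<phi> l *\<^sub>R \<theta>"] \<phi>(6) by simp
    also have "\<dots> \<le> (1 - \<phi> l) * 1 + \<phi> l * 1"
      using \<phi>(6) \<theta>(1) norm_bounded[of g l] g(1) by (intro add_mono mult_left_mono) auto
    finally show "norm (?g l) \<le> 1" by simp
  qed
  have sum_dual: "(\<lambda>g. c * apply_bcontfun g k + \<Psi> g) \<in> CKdual"
    by (intro CK.dual_plus CK.dual_cmult eval_dual \<Psi>)
  have "?g k = \<theta>" using \<phi>(2,4) by simp
  then have "c * ?g k = of_real (norm c)" using \<theta>(2) by (simp only: mult.commute)
  moreover have "\<Psi> ?g = \<Psi> g + of_real 2 * \<Psi> ?h"
    using CK.dual_add[OF \<Psi>(1), of g "2 *\<^sub>R ?h"] CK.dual_scaleR[OF \<Psi>(1), of ?h 2] by simp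
  ultimately have "re (c * ?g k + \<Psi> ?g) = norm c + re (\<Psi> g) + 2 * re (\<Psi> ?h)"
    by (simp only: re_add re_of_real re_of_real_mult)
  moreover have "re (c * ?g k + \<Psi> ?g) \<le> dual_norm UNIV (\<lambda>g. c * apply_bcontfun g k + \<Psi> g)"
    using CK.norm_le_dual_norm_ball[OF sum_dual UNIV_I \<open>norm ?g \<le> 1\<close>] re_le order_trans by blast
  moreover have "- (e / 3) \<le> re (\<Psi> ?h)" using \<Psi>h abs_re_le[of "\<Psi> ?h"] by linarith
  ultimately show "norm c + dual_norm UNIV \<Psi> \<le> dual_norm UNIV (\<lambda>g. c * apply_bcontfun g k + \<Psi> g) + e"
    using g(2) by linarith
qed

text \<open>A measure that annihilates \<open>A\<close> has no mass at \<open>k\<close>: integrate the peaking functions of small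
  neighbourhoods of \<open>k\<close>.\<close>

lemma annihilator_no_atom:
  assumes k: "k \<in> choquet_boundary A" and \<Phi>: "\<Phi> \<in> CKdual" "\<And>a. a \<in> A \<Longrightarrow> \<Phi> a = 0"
    and c: "atom \<Phi> k c"
  shows "c = 0"
proof -
  define \<Psi> where "\<Psi> g = \<Phi> g - c * apply_bcontfun g k" for g
  have \<Psi>: "\<Psi> \<in> CKdual" unfolding \<Psi>_def by (intro CK.dual_minus CK.dual_cmult eval_dual \<Phi>)
  have \<Psi>_atom: "atom \<Psi> k 0" using atom_remove[OF c] by (simp add: \<Psi>_def[abs_def])
  define N where "N = dual_norm UNIV \<Psi>"
  have N: "0 \<le> N" "\<And>g. norm (\<Psi> g) \<le> N * norm g"
    using CK.dual_norm_nonneg[OF \<Psi>] CK.norm_le_dual_norm[OF \<Psi>] by (auto simp: N_def)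
  have "norm c \<le> 0 + e" if e0: "0 < e" for e
  proof -
    define M where "M = N + 2"
    define d where "d = e / (2 * M)"
    have M: "0 < M" using N(1) by (simp add: M_def)
    then have d: "0 < d" "M * d = e / 2" using e0 by (simp_all add: d_def)
    obtain U where U: "open U" "k \<in> U"
      "\<And>g. norm g \<le> 1 \<Longrightarrow> \<forall>l. l \<notin> U \<longrightarrow> apply_bcontfun g l = 0 \<Longrightarrow> norm (\<Psi> g - 0 * apply_bcontfun g k) \<le> d"
      using atomD[OF \<Psi>_atom d(1)] by metis
    obtain \<phi> :: "'c \<Rightarrow>\<^sub>C real" and V where \<phi>: "open V" "k \<in> V" "V \<subseteq> U" "\<forall>l\<in>V. \<phi> l = 1"
      "\<forall>l. l \<notin> U \<longrightarrow> \<phi> l = 0" "\<forall>l. 0 \<le> \<phi> l \<and> \<phi> l \<le> 1"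
      by (rule bump[OF U(1,2)])
    obtain u where u: "u \<in> A" "\<And>l. norm (u l) \<le> 2" "1 / 2 \<le> norm (u k)" "\<And>l. l \<notin> V \<Longrightarrow> norm (u l) \<le> d"
      using peaking_function[OF k \<phi>(1,2) d(1)] by metis
    let ?h = "(1 / 2) *\<^sub>R mult_fun \<phi> u" and ?r = "u - mult_fun \<phi> u"
    have "norm ?h \<le> 1"
    proof (rule norm_bound)
      fix l
      have "\<phi> l * norm (u l) \<le> 1 * 2" using \<phi>(6) u(2)[of l] by (intro mult_mono) auto
      then show "norm (?h l) \<le> 1" using \<phi>(6) by simp
    qed
    then have \<Psi>h: "norm (\<Psi> ?h) \<le> d" using U(3)[of ?h] \<phi>(5) by simp
    have "norm ?r \<le> d"
    proof (rule norm_bound)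
      fix l
      have eq: "?r l = (1 - \<phi> l) *\<^sub>R u l" by (simp add: scaleR_left_diff_distrib)
      show "norm (?r l) \<le> d"
      proof (cases "l \<in> V")
        case True
        then show ?thesis using \<phi>(4) d(1) by (simp add: eq)
      next
        case False
        have "(1 - \<phi> l) * norm (u l) \<le> 1 * d" using \<phi>(6) u(4)[OF False] by (intro mult_mono) auto
        then show ?thesis unfolding eq using \<phi>(6) by simp
      qed
    qed
    then have "N * norm ?r \<le> N * d" using N(1) by (intro mult_left_mono)
    then have \<Psi>r: "norm (\<Psi> ?r) \<le> N * d" using N(2)[of ?r] by linarith
    have "\<Psi> u = of_real 2 * \<Psi> ?h + \<Psi> ?r"
    proof -
      have "u = 2 *\<^sub>R ?h + ?r" by simp
      then have "\<Psi> u = \<Psi> (2 *\<^sub>R ?h + ?r)" by (simp only:)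
      then show ?thesis
        using CK.dual_add[OF \<Psi>, of "2 *\<^sub>R ?h" ?r] CK.dual_scaleR[OF \<Psi>, of ?h 2] by simp
    qed
    then have "norm (\<Psi> u) \<le> 2 * norm (\<Psi> ?h) + norm (\<Psi> ?r)"
      using norm_triangle_ineq[of "of_real 2 * \<Psi> ?h" "\<Psi> ?r"]
      unfolding norm_mult norm_of_real by simp
    then have "norm (\<Psi> u) \<le> e / 2" using \<Psi>h \<Psi>r d(2) by (simp add: M_def distrib_right)
    moreover have "norm (\<Psi> u) = norm c * norm (u k)" using \<Phi>(2)[OF u(1)] by (simp add: \<Psi>_def norm_mult)
    moreover have "norm c * (1 / 2) \<le> norm c * norm (u k)" using u(3) by (intro mult_left_mono) auto
    ultimately show ?thesis by simp
  qed
  then have "norm c \<le> 0" by (rule field_le_epsilon)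
  then show ?thesis by simp
qed

text \<open>The projection maps \<open>f\<close> to \<open>\<mu> {k} \<delta>\<^sub>k\<close>, where \<open>\<mu>\<close> is any measure that represents \<open>f\<close>; by the
  previous lemma the mass does not depend on the choice of \<open>\<mu>\<close>. Taking \<open>\<mu>\<close> with the norm of \<open>f\<close>
  shows that this is an L-projection.\<close>

theorem L_summand_choquet_boundary:
  assumes k: "k \<in> choquet_boundary A"
  shows "L_summand scale_bcontfun A (range (\<lambda>c x. c * pe k x))"
proof -
  let ?D = "dual scale_bcontfun A"
  define mass where "mass f = (SOME c. \<exists>\<Phi>\<in>CKdual. (\<forall>a\<in>A. \<Phi> a = f a) \<and> atom \<Phi> k c)" for f
  have mass_eq: "mass f = c" if \<Phi>: "\<Phi> \<in> CKdual" "\<And>a. a \<in> A \<Longrightarrow> \<Phi> a = f a" "atom \<Phi> k c" for f \<Phi> c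
  proof -
    have "\<exists>c. \<exists>\<Phi>\<in>CKdual. (\<forall>a\<in>A. \<Phi> a = f a) \<and> atom \<Phi> k c" using \<Phi> by blast
    from someI_ex[OF this] obtain \<Psi> where \<Psi>: "\<Psi> \<in> CKdual" "\<forall>a\<in>A. \<Psi> a = f a" "atom \<Psi> k (mass f)"
      unfolding mass_def by blast
    have "mass f - c = 0"
    proof (rule annihilator_no_atom[OF k])
      show "(\<lambda>g. \<Psi> g - \<Phi> g) \<in> CKdual" using \<Psi> \<Phi> by (intro CK.dual_minus)
      show "atom (\<lambda>g. \<Psi> g - \<Phi> g) k (mass f - c)" by (rule atom_diff[OF \<Psi>(3) \<Phi>(3)])
    qed (use \<Psi>(2) \<Phi>(2) in simp)
    then show ?thesis by simp
  qed
  have ext: "\<exists>\<Phi>\<in>CKdual. (\<forall>a\<in>A. \<Phi> a = f a) \<and> atom \<Phi> k (mass f) \<and> dual_norm UNIV \<Phi> \<le> dual_norm A f"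
    if f: "f \<in> ?D" for f
  proof -
    obtain \<Phi> where \<Phi>: "\<Phi> \<in> CKdual" "\<And>a. a \<in> A \<Longrightarrow> \<Phi> a = f a" "dual_norm UNIV \<Phi> \<le> dual_norm A f"
      using norm_preserving_extension[OF f] by metis
    obtain c where "atom \<Phi> k c" using atom_exists[OF \<Phi>(1)] .
    then show ?thesis using \<Phi> mass_eq[of \<Phi> f c] by (intro bexI[of _ \<Phi>]) auto
  qed
  have mass_add: "mass (\<lambda>x. f x + g x) = mass f + mass g" if fg: "f \<in> ?D" "g \<in> ?D" for f g
  proof -
    obtain \<Phi> \<Psi> where "\<Phi> \<in> CKdual" "\<forall>a\<in>A. \<Phi> a = f a" "atom \<Phi> k (mass f)"
      "\<Psi> \<in> CKdual" "\<forall>a\<in>A. \<Psi> a = g a" "atom \<Psi> k (mass g)" 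
      using ext[OF fg(1)] ext[OF fg(2)] by blast
    then show ?thesis
      by (intro mass_eq[of "\<lambda>x. \<Phi> x + \<Psi> x"] atom_add CK.dual_plus) auto
  qed
  have mass_cmult: "mass (\<lambda>x. c * f x) = c * mass f" if f: "f \<in> ?D" for c f
  proof -
    obtain \<Phi> where "\<Phi> \<in> CKdual" "\<forall>a\<in>A. \<Phi> a = f a" "atom \<Phi> k (mass f)" using ext[OF f] by blast
    then show ?thesis by (intro mass_eq[of "\<lambda>x. c * \<Phi> x"] atom_cmult CK.dual_cmult) auto
  qed
  have mass_pe: "mass (pe k) = 1"
    by (rule mass_eq[OF eval_dual _ atom_evaluation]) (simp add: pe)
  have mass_multiple: "mass (\<lambda>x. c * pe k x) = c" for c
    using mass_cmult[OF pe_dual] mass_pe by simp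
  let ?P = "\<lambda>f x. mass f * pe k x"
  have multiple_dual: "(\<lambda>x. c * pe k x) \<in> ?D" for c by (rule dual_cmult[OF pe_dual])
  have norm_multiple: "dual_norm A (\<lambda>x. c * pe k x) = norm c" for c
    by (simp add: dual_norm_cmult[OF pe_dual] dual_norm_pe)
  have norm_split: "dual_norm A f = dual_norm A (?P f) + dual_norm A (\<lambda>x. f x - ?P f x)"
    if f: "f \<in> ?D" for f
  proof (rule antisym)
    show "dual_norm A f \<le> dual_norm A (?P f) + dual_norm A (\<lambda>x. f x - ?P f x)"
      using dual_norm_triangle[OF multiple_dual dual_minus[OF f multiple_dual], of "mass f" "mass f"]
      by simp
    obtain \<Phi> where \<Phi>: "\<Phi> \<in> CKdual" "\<forall>a\<in>A. \<Phi> a = f a" "atom \<Phi> k (mass f)"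
      "dual_norm UNIV \<Phi> \<le> dual_norm A f" using ext[OF f] by blast
    let ?\<Psi> = "\<lambda>g. \<Phi> g - mass f * apply_bcontfun g k"
    have \<Psi>: "?\<Psi> \<in> CKdual" by (intro CK.dual_minus CK.dual_cmult eval_dual \<Phi>)
    have "dual_norm A (\<lambda>x. f x - ?P f x) \<le> dual_norm UNIV ?\<Psi>"
    proof (rule dual_norm_le)
      fix x assume x: "x \<in> A" "norm x \<le> 1"
      then show "norm (f x - ?P f x) \<le> dual_norm UNIV ?\<Psi>"
        using CK.norm_le_dual_norm_ball[OF \<Psi> UNIV_I x(2)] \<Phi>(2) by (simp add: pe)
    qed
    moreover have "norm (mass f) + dual_norm UNIV ?\<Psi> \<le> dual_norm UNIV (\<lambda>g. mass f * apply_bcontfun g k + ?\<Psi> g)"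
      by (rule norm_ge_atom_plus_rest[OF \<Psi> atom_remove[OF \<Phi>(3)]])
    moreover have "(\<lambda>g. mass f * apply_bcontfun g k + ?\<Psi> g) = \<Phi>" by auto
    ultimately show "dual_norm A (?P f) + dual_norm A (\<lambda>x. f x - ?P f x) \<le> dual_norm A f"
      using \<Phi>(4) norm_multiple by simp
  qed
  show ?thesis
    unfolding L_summand_def
  proof (intro exI[of _ ?P] conjI ballI allI)
    have "(\<lambda>x. c * pe k x) \<in> ?P ` ?D" for c
      using multiple_dual[of c] by (rule image_eqI[rotated]) (simp add: mass_multiple)
    then show "?P ` ?D = range (\<lambda>c x. c * pe k x)" by auto
    fix f assume f: "f \<in> ?D"
    show "?P f \<in> ?D" by (rule multiple_dual)
    show "?P (?P f) = ?P f" by (simp only: mass_multiple)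
    show "dual_norm A f = dual_norm A (?P f) + dual_norm A (\<lambda>x. f x - ?P f x)"
      by (rule norm_split[OF f])
    show "?P (\<lambda>x. c * f x) = (\<lambda>x. c * ?P f x)" for c
      by (simp only: mass_cmult[OF f] mult.assoc)
    show "?P (\<lambda>x. f x + g x) = (\<lambda>x. ?P f x + ?P g x)" if "g \<in> ?D" for g
      by (simp only: mass_add[OF f that] distrib_right)
  qed
qed

lemma complete_A: "complete A"
  unfolding complete_def
proof (intro allI impI)
  fix f :: "nat \<Rightarrow> 'c \<Rightarrow>\<^sub>C 'k" assume f: "(\<forall>n. f n \<in> A) \<and> Cauchy f"
  then have "\<forall>e>0. \<exists>N. \<forall>m n x. N \<le> m \<and> N \<le> n \<and> True \<longrightarrow> dist (f m x) (f n x) < e"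
    unfolding Cauchy_def by (metis dist_fun_lt_imp_dist_val_lt)
  then obtain g where "uniform_limit UNIV f g sequentially"
    using uniformly_convergent_eq_cauchy[of "\<lambda>_. True" f]
    unfolding uniform_limit_sequentially_iff by auto
  from uniform_limit_bcontfunE[OF this sequentially_bot] obtain l where "f \<longlonglongrightarrow> l" by metis
  then show "\<exists>l\<in>A. f \<longlonglongrightarrow> l"
    using closed_sequentially[OF closed_A] f by blast
qed

lemma nice_embedding_choquet_boundary:
  "nice_embedding scale_bcontfun A (choquet_boundary A) apply_bcontfun"
  unfolding nice_embedding_def linear_isometry_Cb_def
proof (intro conjI ballI allI)
  fix x assume x: "x \<in> A"
  show "apply_bcontfun x \<in> Cb (choquet_boundary A)"
    unfolding Cb_def by (auto intro: bounded_subset[OF bounded_apply_bcontfun])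
  obtain k where k: "k \<in> choquet_boundary A" "norm (x k) = norm x"
    using norm_attained_on_choquet_boundary[OF x] .
  show "sup_norm (choquet_boundary A) (apply_bcontfun x) = norm x"
    unfolding sup_norm_def
    by (rule cSup_eq_maximum) (use k in \<open>auto simp: norm_bounded intro: image_eqI[of _ _ k]\<close>)
qed (use dual_norm_pe L_summand_choquet_boundary in auto)

lemma pairwise_independent_evaluations: "pairwise_independent S pe"
  unfolding pairwise_independent_def
proof (intro ballI impI allI)
  fix s t a b assume "s \<noteq> t" and zero: "\<forall>x. a * pe s x + b * pe t x = 0"
  obtain f where f: "f \<in> A" "f s \<noteq> f t" using separates_A[OF \<open>s \<noteq> t\<close>] by blast
  have "a + b = 0" using zero[rule_format, of "const_bcontfun 1"] by (simp add: pe const_A)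
  then have b: "b = - a" by (simp add: eq_neg_iff_add_eq_0 add.commute)
  have "a * (f s - f t) = 0" using zero[rule_format, of f] f(1) b by (simp add: pe algebra_simps)
  then show "a = 0 \<and> b = 0" using f(2) b by simp
qed

end

theorem corollary3p11:
  fixes sc :: "'k::rc_scalar \<Rightarrow> 'v::real_normed_vector \<Rightarrow> 'v"
    and X :: "'v set"
    and S :: "'s::t2_space set"
    and J :: "'v \<Rightarrow> 's \<Rightarrow> 'k"
    and A :: "('c::t2_space \<Rightarrow>\<^sub>C 'l::rc_scalar) set"
  shows
    "(banach_space_over sc X \<and> infinite_dimensional sc X \<and>
      nice_embedding sc X S J \<and> pairwise_independent S (point_functional X J) \<longrightarrow>
        ((\<exists>(I :: 'i set) le \<sigma>. \<exists>s0\<in>S.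
            directed_set I le \<and> \<not> (\<exists>m\<in>I. \<forall>a\<in>I. le a m) \<and>
            \<sigma> ` I \<subseteq> S \<and> inj_on (\<lambda>a. point_functional X J (\<sigma> a)) I \<and>
            net_converges (weak_star sc X) I le (\<lambda>a. point_functional X J (\<sigma> a))
              (point_functional X J s0))
          \<longrightarrow> convex_DLD2P sc X) \<and>
        (closedin (weak_star sc X) (point_functional X J ` S) \<longrightarrow> convex_DLD2P sc X) \<and>
        ((\<exists>x\<in>Delta_points sc X. smooth_at sc X x) \<longrightarrow> convex_DLD2P sc X)) \<and>
     (function_algebra A \<and> infinite_dimensional scale_bcontfun A \<longrightarrow>
        banach_space_over scale_bcontfun A \<and>
        nice_embedding scale_bcontfun A (choquet_boundary A) apply_bcontfun \<and>
        pairwise_independent (choquet_boundary A) (point_functional A apply_bcontfun))"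
proof (rule conjI; intro impI; elim conjE)
  assume X: "banach_space_over sc X" "infinite_dimensional sc X" "nice_embedding sc X S J"
    "pairwise_independent S (point_functional X J)"
  interpret nicely_embedded sc X S J
    by unfold_locales (use X in \<open>auto simp: banach_space_over_def\<close>)
  show "((\<exists>(I :: 'i set) le \<sigma>. \<exists>s0\<in>S.
            directed_set I le \<and> \<not> (\<exists>m\<in>I. \<forall>a\<in>I. le a m) \<and>
            \<sigma> ` I \<subseteq> S \<and> inj_on (\<lambda>a. point_functional X J (\<sigma> a)) I \<and>
            net_converges (weak_star sc X) I le (\<lambda>a. point_functional X J (\<sigma> a))
              (point_functional X J s0))
          \<longrightarrow> convex_DLD2P sc X) \<and>
        (closedin (weak_star sc X) (point_functional X J ` S) \<longrightarrow> convex_DLD2P sc X) \<and>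
        ((\<exists>x\<in>Delta_points sc X. smooth_at sc X x) \<longrightarrow> convex_DLD2P sc X)"
    by (intro conjI impI; (elim exE bexE conjE)?)
      (rule convex_DLD2P_if_convergent_net convex_DLD2P_if_closed[OF X(2)]
        convex_DLD2P_if_smooth_Delta_point; assumption)+
next
  assume A: "function_algebra A"
  interpret fun_alg A by unfold_locales (rule A)
  show "banach_space_over scale_bcontfun A \<and>
      nice_embedding scale_bcontfun A (choquet_boundary A) apply_bcontfun \<and>
      pairwise_independent (choquet_boundary A) (point_functional A apply_bcontfun)"
    using nice_embedding_choquet_boundary pairwise_independent_evaluations
    by (simp add: banach_space_over_def normed subspace complete_A)
qed

end
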